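(* Let $\xi=\ker(z\,d\theta+x\,dy-y\,dx)$ be the standard tight contact structure on $\mathbb{S}^1\times\mathbb{S}^2$, and let $[S],[\delta]\in\pi_2(\mathcal{C}(\mathbb{S}^1\times\mathbb{S}^2,\xi))$ be the two classes defined in the context. Then $[S]\neq[\delta]$ in $\pi_2(\mathcal{C}(\mathbb{S}^1\times\mathbb{S}^2,\xi))$ and the order of $[S]$ is infinite.
   Context: Coordinates on $\mathbb{S}^1\times\mathbb{S}^2$ are $(\theta;x,y,z)\in\mathbb{S}^1\times\mathbb{R}^3$ with $x^2+y^2+z^2=1$. $\mathcal{C}(\mathbb{S}^1\times\mathbb{S}^2,\xi)$ is the space of (cooriented) contact structures on $\mathbb{S}^1\times\mathbb{S}^2$ isotopic to $\xi$. Class $[S]$: put $\alpha_0=z\,d\theta+x\,dy-y\,dx$, $\alpha_1=x\,d\theta+y\,dz-z\,dy$, $\alpha_2=y\,d\theta+z\,dx-x\,dz$, and let $(e_0,e_1,e_2):\mathbb{S}^2\to\mathbb{R}^3$ be the standard embedding. Then $S:\mathbb{S}^2\to\mathcal{C}(\mathbb{S}^1\times\mathbb{S}^2,\xi)$ sends a point $q\in\mathbb{S}^2$ to the contact structure defined by the contact form $e_0(q)\alpha_0+e_1(q)\alpha_1+e_2(q)\alpha_2$. Class $[\delta]$: let $(\phi,\varphi)\in[0,\pi]\times[0,2\pi]$ be polar coordinates on $\mathbb{S}^2$; a point $(\phi,\varphi)\in\mathbb{S}^2$ determines an axis $l(\phi,\varphi)$ in $\mathbb{R}^3$, and $R^{\sigma}_{\phi,\varphi}\in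 SO(3)$ denotes the rotation of angle $\sigma$ along the axis $l(\phi,\varphi)$. Define $\delta(\phi,\varphi)\in\operatorname{Diff}(\mathbb{S}^1\times\mathbb{S}^2)$ by $\delta(\phi,\varphi)(\theta;x,y,z)=(\theta;R^{\theta}_{\phi,\varphi}(x,y,z))$. The map $\mathbb{S}^2\to\mathcal{C}(\mathbb{S}^1\times\mathbb{S}^2,\xi)$, $(\phi,\varphi)\mapsto\delta(\phi,\varphi)_*\xi$, represents $[\delta]$. *)

theory Defs
  imports "HOL-Analysis.Analysis" "HOL-Algebra.Group"
begin

section \<open>Smooth maps\<close>

fun Ck_on :: "nat \<Rightarrow> 'a::euclidean_space set \<Rightarrow> ('a \<Rightarrow> 'b::real_normed_vector) \<Rightarrow> bool" where
  "Ck_on 0 U f \<longleftrightarrow> continuous_on U f"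
| "Ck_on (Suc k) U f \<longleftrightarrow>
     (\<forall>x\<in>U. f differentiable (at x)) \<and> (\<forall>v. Ck_on k U (\<lambda>x. frechet_derivative f (at x) v))"

text \<open>As usual, a map on an arbitrary subset of a Euclidean space is smooth if near each point of
  the subset it extends to a smooth map on an open set.\<close>

definition smooth_on :: "'a::euclidean_space set \<Rightarrow> ('a \<Rightarrow> 'b::real_normed_vector) \<Rightarrow> bool" where
  "smooth_on A f \<longleftrightarrow>
     (\<forall>x\<in>A. \<exists>U g. open U \<and> x \<in> U \<and> (\<forall>k. Ck_on k U g) \<and> (\<forall>y\<in>A \<inter> U. g y = f y))"


section \<open>The manifold \<open>S\<^sup>1 \<times> S\<^sup>2\<close>\<close>

text \<open>The circle is the unit circle in the complex plane; \<open>\<theta>\<close> corresponds to \<open>cis \<theta>\<close>.\<close>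

type_synonym ambient = "complex \<times> (real^3)"

definition S1xS2 :: "ambient set" where
  "S1xS2 = sphere 0 1 \<times> sphere 0 1"

definition tangent_space :: "ambient \<Rightarrow> ambient set" where
  "tangent_space m = {(a, v). a \<bullet> fst m = 0 \<and> v \<bullet> snd m = 0}"

text \<open>The derivative within the submanifold is not unique as a linear map on the ambient space, but
  all choices agree on \<open>tangent_space m\<close>, and only their values there are ever used.\<close>

definition tangent_map :: "(ambient \<Rightarrow> 'b::real_normed_vector) \<Rightarrow> ambient \<Rightarrow> ambient \<Rightarrow> 'b" where
  "tangent_map f m v = frechet_derivative f (at m within S1xS2) v"

definition vector_field :: "(ambient \<Rightarrow> ambient) \<Rightarrow> bool" where
  "vector_field X \<longleftrightarrow> smooth_on S1xS2 X \<and> (\<forall>m\<in>S1xS2. X m \<in> tangent_space m)"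

definition lie_derivative :: "(ambient \<Rightarrow> ambient) \<Rightarrow> (ambient \<Rightarrow> real) \<Rightarrow> ambient \<Rightarrow> real" where
  "lie_derivative X f m = tangent_map f m (X m)"

definition diffeomorphism :: "(ambient \<Rightarrow> ambient) \<Rightarrow> bool" where
  "diffeomorphism F \<longleftrightarrow>
     bij_betw F S1xS2 S1xS2 \<and> smooth_on S1xS2 F \<and> smooth_on S1xS2 (inv_into S1xS2 F)"


section \<open>Contact structures\<close>

text \<open>A 1-form is represented by a smooth field of linear functionals on the ambient space, of which
  only the restrictions to the tangent spaces matter. The formula for the exterior derivative is
  that of any smooth extension, pulled back to the submanifold: for tangent \<open>u\<close>, \<open>v\<close> it does not
  depend on how the functionals are continued beyond the tangent spaces.\<close>

type_synonym form = "ambient \<Rightarrow> ambient \<Rightarrow> real"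

definition one_form :: "form \<Rightarrow> bool" where
  "one_form \<alpha> \<longleftrightarrow> (\<forall>m\<in>S1xS2. linear (\<alpha> m)) \<and> (\<forall>v. smooth_on S1xS2 (\<lambda>m. \<alpha> m v))"

definition exterior_derivative :: "form \<Rightarrow> ambient \<Rightarrow> ambient \<Rightarrow> ambient \<Rightarrow> real" where
  "exterior_derivative \<alpha> m u v = tangent_map (\<lambda>n. \<alpha> n v) m u - tangent_map (\<lambda>n. \<alpha> n u) m v"

definition form_wedge_d :: "form \<Rightarrow> ambient \<Rightarrow> ambient \<Rightarrow> ambient \<Rightarrow> ambient \<Rightarrow> real" where
  "form_wedge_d \<alpha> m u v w =
     \<alpha> m u * exterior_derivative \<alpha> m v w + \<alpha> m v * exterior_derivative \<alpha> m w u
       + \<alpha> m w * exterior_derivative \<alpha> m u v"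

definition contact_forms :: "form set" where
  "contact_forms = {\<alpha>. one_form \<alpha> \<and>
     (\<forall>m\<in>S1xS2. \<exists>u\<in>tangent_space m. \<exists>v\<in>tangent_space m. \<exists>w\<in>tangent_space m.
        form_wedge_d \<alpha> m u v w \<noteq> 0)}"

text \<open>A cooriented plane field assigns to each point the plane together with its positive side.\<close>

type_synonym plane_field = "ambient \<Rightarrow> ambient set \<times> ambient set"

definition cooriented_kernel :: "form \<Rightarrow> plane_field" where
  "cooriented_kernel \<alpha> =
     (\<lambda>m\<in>S1xS2. ({v \<in> tangent_space m. \<alpha> m v = 0}, {v \<in> tangent_space m. \<alpha> m v > 0}))"

definition pushforward :: "(ambient \<Rightarrow> ambient) \<Rightarrow> plane_field \<Rightarrow> plane_field" where
  "pushforward F \<eta> =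
     (\<lambda>m\<in>S1xS2. let n = inv_into S1xS2 F m
        in (tangent_map F n ` fst (\<eta> n), tangent_map F n ` snd (\<eta> n)))"

definition isotopic :: "plane_field \<Rightarrow> plane_field \<Rightarrow> bool" where
  "isotopic \<eta> \<zeta> \<longleftrightarrow>
     (\<exists>F :: real \<times> ambient \<Rightarrow> ambient.
        smooth_on ({0..1} \<times> S1xS2) F
      \<and> (\<forall>t\<in>{0..1}. diffeomorphism (\<lambda>m. F (t, m)))
      \<and> (\<forall>m\<in>S1xS2. F (0, m) = m)
      \<and> pushforward (\<lambda>m. F (1, m)) \<eta> = \<zeta>)"


section \<open>The space of contact structures\<close>

text \<open>The smooth topology on 1-forms is the one of the seminorms
  \<open>\<alpha> \<mapsto> sup \<bar>X\<^sub>1 (\<dots> (X\<^sub>k (\<alpha>(Y))))\<bar>\<close>, for vector fields \<open>X\<^sub>1, \<dots>, X\<^sub>k, Y\<close> and \<open>k \<ge> 0\<close>.\<close>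

definition iterated_derivative :: "(ambient \<Rightarrow> ambient) list \<Rightarrow> (ambient \<Rightarrow> ambient) \<Rightarrow> form
    \<Rightarrow> ambient \<Rightarrow> real" where
  "iterated_derivative Xs Y \<alpha> = foldr lie_derivative Xs (\<lambda>m. \<alpha> m (Y m))"

definition smooth_topology :: "form topology" where
  "smooth_topology = topology_generated_by
     {{\<beta>. one_form \<beta> \<and>
          (\<forall>m\<in>S1xS2. \<bar>iterated_derivative Xs Y \<beta> m - iterated_derivative Xs Y \<alpha> m\<bar> < e)}
      | Xs Y \<alpha> e. (\<forall>X\<in>set Xs. vector_field X) \<and> vector_field Y \<and> one_form \<alpha> \<and> e > 0}"

text \<open>Cooriented contact structures are contact forms up to multiplication by positive functions,
  so they carry the quotient topology under \<open>cooriented_kernel\<close>.\<close>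

definition contact_structures :: "plane_field topology" where
  "contact_structures = topology (\<lambda>U. U \<subseteq> cooriented_kernel ` contact_forms \<and>
     openin (subtopology smooth_topology contact_forms) {\<alpha> \<in> contact_forms. cooriented_kernel \<alpha> \<in> U})"

lemma openin_contact_structures:
  "openin contact_structures U \<longleftrightarrow> U \<subseteq> cooriented_kernel ` contact_forms \<and>
     openin (subtopology smooth_topology contact_forms) {\<alpha> \<in> contact_forms. cooriented_kernel \<alpha> \<in> U}"
proof -
  let ?T = "subtopology smooth_topology contact_forms"
  let ?P = "\<lambda>U. {\<alpha> \<in> contact_forms. cooriented_kernel \<alpha> \<in> U}"
  have int: "?P (U \<inter> V) = ?P U \<inter> ?P V" for U V by blast
  have un: "?P (\<Union>\<K>) = (\<Union>U\<in>\<K>. ?P U)" for \<K> by blast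
  have "istopology (\<lambda>U. U \<subseteq> cooriented_kernel ` contact_forms \<and> openin ?T (?P U))"
    unfolding istopology_def int un by (auto intro!: openin_Union)
  then show ?thesis
    unfolding contact_structures_def by (simp add: topology_inverse')
qed

definition contact_space :: "plane_field \<Rightarrow> plane_field topology" where
  "contact_space \<eta> = subtopology contact_structures {\<zeta>. isotopic \<eta> \<zeta>}"


section \<open>The second homotopy group\<close>

definition square :: "(real \<times> real) set" where
  "square = {0..1} \<times> {0..1}"

definition sq_maps :: "'a topology \<Rightarrow> 'a \<Rightarrow> (real \<times> real \<Rightarrow> 'a) set" where
  "sq_maps X x = {f. continuous_map (top_of_set square) X f \<and> (\<forall>b\<in>frontier square. f b = x)}"

definition sq_class :: "'a topology \<Rightarrow> 'a \<Rightarrow> (real \<times> real \<Rightarrow> 'a) \<Rightarrow> (real \<times> real \<Rightarrow> 'a) set" where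
  "sq_class X x f = {g \<in> sq_maps X x.
     homotopic_with (\<lambda>h. \<forall>b\<in>frontier square. h b = x) (top_of_set square) X f g}"

definition sq_join :: "(real \<times> real \<Rightarrow> 'a) \<Rightarrow> (real \<times> real \<Rightarrow> 'a) \<Rightarrow> real \<times> real \<Rightarrow> 'a" where
  "sq_join f g = (\<lambda>(s, t). if s \<le> 1/2 then f (2 * s, t) else g (2 * s - 1, t))"

definition pi2 :: "'a topology \<Rightarrow> 'a \<Rightarrow> (real \<times> real \<Rightarrow> 'a) set monoid" where
  "pi2 X x =
     \<lparr>carrier = sq_class X x ` sq_maps X x,
      mult = (\<lambda>A B. \<Union>f\<in>A. \<Union>g\<in>B. sq_class X x (sq_join f g)),
      one = sq_class X x (\<lambda>_. x)\<rparr>"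

text \<open>The identification of the square modulo its boundary with the 2-sphere: with \<open>(u, v)\<close> centred
  coordinates and \<open>d = (1 - u\<^sup>2) (1 - v\<^sup>2)\<close>, it is the homeomorphism \<open>(u, v) \<mapsto> (u/d, v/d)\<close> of the
  open square onto the plane followed by inverse stereographic projection from \<open>base_point\<close>, with
  denominators cleared. The boundary \<open>d = 0\<close> goes to \<open>base_point\<close>.\<close>

definition base_point :: "real^3" where
  "base_point = vector [1, 0, 0]"

definition collapse :: "real \<times> real \<Rightarrow> real^3" where
  "collapse = (\<lambda>(s, t). let u = 2 * s - 1; v = 2 * t - 1; d = (1 - u\<^sup>2) * (1 - v\<^sup>2) in
     (1 / (u\<^sup>2 + v\<^sup>2 + d\<^sup>2)) *\<^sub>R vector [u\<^sup>2 + v\<^sup>2 - d\<^sup>2, 2 * u * d, 2 * v * d])"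

definition sphere_class :: "'a topology \<Rightarrow> 'a \<Rightarrow> (real^3 \<Rightarrow> 'a) \<Rightarrow> (real \<times> real \<Rightarrow> 'a) set" where
  "sphere_class X x f = sq_class X x (f \<circ> collapse)"

text \<open>A sphere which does not pass through the base point \<open>x\<close> defines an element of \<open>pi2 X x\<close> only
  after a choice of path from \<open>x\<close> to it. The elements arising from all possible choices are the
  classes of the based spheres that are freely homotopic to the given one.\<close>

definition free_sphere_classes ::
    "'a topology \<Rightarrow> 'a \<Rightarrow> (real^3 \<Rightarrow> 'a) \<Rightarrow> (real \<times> real \<Rightarrow> 'a) set set" where
  "free_sphere_classes X x g =
     {sphere_class X x f | f. f base_point = x \<and>
        homotopic_with (\<lambda>_. True) (top_of_set (sphere 0 1)) X f g}"


section \<open>The standard structure and the two spheres\<close>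

text \<open>On the unit circle \<open>w = cis \<theta>\<close> one has \<open>dw = \<i> w d\<theta>\<close>.\<close>

definition d_theta :: form where
  "d_theta m v = Im (cnj (fst m) * fst v)"

definition alpha0 :: form where
  "alpha0 m v = snd m $ 3 * d_theta m v + snd m $ 1 * snd v $ 2 - snd m $ 2 * snd v $ 1"

definition alpha1 :: form where
  "alpha1 m v = snd m $ 1 * d_theta m v + snd m $ 2 * snd v $ 3 - snd m $ 3 * snd v $ 2"

definition alpha2 :: form where
  "alpha2 m v = snd m $ 2 * d_theta m v + snd m $ 3 * snd v $ 1 - snd m $ 1 * snd v $ 3"

definition xi :: plane_field where
  "xi = cooriented_kernel alpha0"

text \<open>The coordinates \<open>e\<^sub>0, e\<^sub>1, e\<^sub>2\<close> of a point of the sphere are its components with indices 1, 2, 3;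
  so \<open>S_sphere base_point = xi\<close>.\<close>

definition S_sphere :: "real^3 \<Rightarrow> plane_field" where
  "S_sphere q = cooriented_kernel (\<lambda>m v. q $ 1 * alpha0 m v + q $ 2 * alpha1 m v + q $ 3 * alpha2 m v)"

text \<open>Rotation about the axis through the unit vector \<open>q\<close> (Rodrigues' formula).\<close>

definition rotation :: "real^3 \<Rightarrow> real \<Rightarrow> real^3 \<Rightarrow> real^3" where
  "rotation q \<sigma> p = cos \<sigma> *\<^sub>R p + sin \<sigma> *\<^sub>R cross3 q p + ((1 - cos \<sigma>) * (q \<bullet> p)) *\<^sub>R q"

definition delta_diffeo :: "real^3 \<Rightarrow> ambient \<Rightarrow> ambient" where
  "delta_diffeo q m = (fst m, rotation q (Arg2pi (fst m)) (snd m))"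

definition delta_sphere :: "real^3 \<Rightarrow> plane_field" where
  "delta_sphere q = pushforward (delta_diffeo q) xi"

end

theory Submission
  imports Defs
begin

text \<open>Evaluating a cooriented contact structure at the point \<open>(1; 0, 0, 1)\<close> gives a continuous map from the
  space of contact structures to a 2-sphere of cooriented planes. The family \<open>S\<close> is linear in \<open>q\<close> and
  evaluates to the identity of the sphere. At this point \<open>\<xi>\<close> is the kernel of \<open>d\<theta>\<close>, which all \<open>\<delta>(q)\<close>
  preserve, so that the family \<open>\<delta>\<close> evaluates to a constant. So \<open>S\<close> has degree 1 and \<open>\<delta>\<close> has degree 0.

  The degree of a map of the square that is constant on the boundary is obtained from the Hopf fibration:
  one lifts the map to \<open>\<complex>\<^sup>2 - 0\<close> and counts how often the lift winds along the boundary. A lift is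
  transported along a homotopy in finitely many small steps, by orthogonal projection from one
  complex line to a nearby one.

  That \<open>\<delta>(q)\<close> is isotopic to \<open>\<xi>\<close> uses an explicit flow for the axis \<open>(0, 0, 1)\<close>, and a path of axes
  for the others.\<close>

section \<open>Degree via lifts to the Hopf fibration\<close>

text \<open>The structures \<open>delta_sphere q\<close> must be shown to be isotopic to
  \<open>xi\<close>, but \<open>delta_diffeo q\<close> alone gives no isotopy: it is the Gluck
  twist, which is not isotopic to the identity. Two facts help. The twist about q composed with the
  inverse of the twist about \<open>e3\<close> is isotopic to the identity, by moving the axis. And
  with r^2 = x^2 + y^2 and polar angle \<phi>, the twist about \<open>e3\<close> carries z d\<theta>
  + r^2 d\<phi> to (z - r^2) d\<theta> + r^2 d\<phi>; division by r^2 shows that off the poles this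
  amounts to a translation of z / r^2, which is where the explicit flow comes from.

  The sphere \<delta> does not pass through \<xi>, so its based class depends on a path, and the
  degree has to survive free homotopies that move the base point. For this reason a free homotopy to
  a constant is lifted over the whole sphere, and only then composed with the collapse of the
  square.\<close>

text \<open>The sphere is identified with the complex projective line: \<open>spans_line q a\<close> says that \<open>a\<close> is a
  nonzero fixed vector of the rank-one projection \<open>line_proj q\<close>; antipodal points give orthogonal lines.\<close>

definition spans_line :: "real^3 \<Rightarrow> complex \<times> complex \<Rightarrow> bool" where
  "spans_line q a \<longleftrightarrow> a \<noteq> 0 \<and>
     of_real (1 - q $ 1) * fst a = Complex (q $ 2) (q $ 3) * snd a \<and>
     Complex (q $ 2) (- (q $ 3)) * fst a = of_real (1 + q $ 1) * snd a"

text \<open>For unit \<open>q\<close> this is (1 + A) / 2, where A is the Hermitian matrix given by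
  \<open>q\<close> in the Pauli basis, with \<open>q $ 1\<close> on the diagonal. A squares to the
  identity, so the image is its eigenspace for the eigenvalue 1.\<close>

definition line_proj :: "real^3 \<Rightarrow> complex \<times> complex \<Rightarrow> complex \<times> complex" where
  "line_proj q a =
     ((of_real (1 + q $ 1) * fst a + Complex (q $ 2) (q $ 3) * snd a) / 2,
      (Complex (q $ 2) (- (q $ 3)) * fst a + of_real (1 - q $ 1) * snd a) / 2)"

lemma norm_vec3: "norm (q :: real^3) = sqrt ((q $ 1)\<^sup>2 + (q $ 2)\<^sup>2 + (q $ 3)\<^sup>2)"
  by (simp add: norm_vec_def L2_set_def sum_3)

lemma Complex_mult_conj:
  "Complex x y * Complex x (- y) = of_real (x\<^sup>2 + y\<^sup>2)"
  by (simp add: complex_eq_iff power2_eq_square)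

text \<open>Idempotence of the projection: for unit \<open>q\<close> the product
  \<open>z * z'\<close> is 1 - r^2, which turns both equations of \<open>spans_line\<close> into
  identities.\<close>

lemma line_proj_spans:
  assumes "norm q = 1" "line_proj q a \<noteq> 0"
  shows "spans_line q (line_proj q a)"
proof -
  define z z' r where "z = Complex (q $ 2) (q $ 3)" and "z' = Complex (q $ 2) (- (q $ 3))"
    and "r = complex_of_real (q $ 1)"
  have "(q $ 2)\<^sup>2 + (q $ 3)\<^sup>2 = 1 - (q $ 1)\<^sup>2"
    using assms(1) by (simp add: norm_vec3)
  then have zz: "z * z' = 1 - r\<^sup>2"
    unfolding z_def z'_def r_def Complex_mult_conj by simp
  have 1: "(1 - r) * (((1 + r) * fst a + z * snd a) / 2) = z * ((z' * fst a + (1 - r) * snd a) / 2)"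
    using zz by (simp add: field_simps power2_eq_square) algebra
  have 2: "z' * (((1 + r) * fst a + z * snd a) / 2) = (1 + r) * ((z' * fst a + (1 - r) * snd a) / 2)"
    using zz by (simp add: field_simps power2_eq_square) algebra
  show ?thesis
    using 1 2 assms(2) unfolding spans_line_def line_proj_def z_def z'_def r_def by simp
qed

lemma line_proj_id: "spans_line q a \<Longrightarrow> line_proj q a = a"
  unfolding spans_line_def line_proj_def by (auto simp: prod_eq_iff algebra_simps)

text \<open>Only antipodal points give orthogonal lines: a vector fixed at \<open>p\<close> and
  killed at \<open>q\<close> is an eigenvector with eigenvalue 2 of the Hermitian matrix of
  \<open>p - q\<close>, whose eigenvalues are plus and minus \<open>norm (p - q)\<close>.\<close>

lemma line_proj_nonzero:
  assumes "spans_line p a" "norm (p - q) < 2"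
  shows "line_proj q a \<noteq> 0"
proof
  assume 0: "line_proj q a = 0"
  define z z' d where "z = Complex (p $ 2 - q $ 2) (p $ 3 - q $ 3)"
    and "z' = Complex (p $ 2 - q $ 2) (- (p $ 3 - q $ 3))" and "d = complex_of_real (p $ 1 - q $ 1)"
  have zs: "z = Complex (p $ 2) (p $ 3) - Complex (q $ 2) (q $ 3)"
    "z' = Complex (p $ 2) (- (p $ 3)) - Complex (q $ 2) (- (q $ 3))"
    by (simp_all add: z_def z'_def complex_eq_iff)
  have q: "of_real (1 + q $ 1) * fst a + Complex (q $ 2) (q $ 3) * snd a = 0"
     "Complex (q $ 2) (- (q $ 3)) * fst a + of_real (1 - q $ 1) * snd a = 0"
    using 0 by (simp_all add: line_proj_def zero_prod_def)
  have p: "of_real (1 - p $ 1) * fst a = Complex (p $ 2) (p $ 3) * snd a"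
     "Complex (p $ 2) (- (p $ 3)) * fst a = of_real (1 + p $ 1) * snd a"
    using assms(1) by (simp_all add: spans_line_def)
  have 1: "(2 - d) * fst a = z * snd a" "(2 + d) * snd a = z' * fst a"
    using p q unfolding zs d_def by (simp_all, algebra+)
  have zz: "z * z' = of_real ((p $ 2 - q $ 2)\<^sup>2 + (p $ 3 - q $ 3)\<^sup>2)"
    unfolding z_def z'_def Complex_mult_conj ..
  have "(norm (p - q))\<^sup>2 < 2\<^sup>2"
    using assms(2) by (intro power_strict_mono) auto
  then have lt: "(p $ 1 - q $ 1)\<^sup>2 + (p $ 2 - q $ 2)\<^sup>2 + (p $ 3 - q $ 3)\<^sup>2 < 4"
    by (simp add: norm_vec3)
  \<comment> \<open>The determinant of the linear system \<open>1\<close>; it equals 4 - |p -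
    q|^2.\<close>
  define e where "e = 4 - ((p $ 1 - q $ 1)\<^sup>2 + (p $ 2 - q $ 2)\<^sup>2 + (p $ 3 - q $ 3)\<^sup>2)"
  have e: "complex_of_real e = 4 - d\<^sup>2 - z * z'"
    unfolding e_def d_def zz by simp
  have "of_real e * fst a = 0" "of_real e * snd a = 0"
    unfolding e using 1 by algebra+
  moreover have "e \<noteq> 0" using lt by (simp add: e_def)
  ultimately have "a = 0" by (simp add: prod_eq_iff)
  then show False using assms(1) by (simp add: spans_line_def)
qed

text \<open>Write 2 = (1 - r) + (1 + r) and use the equations of \<open>a\<close> and
  \<open>b\<close> crosswise.\<close>

lemma spans_line_proportional:
  assumes "spans_line q a" "spans_line q b"
  shows "fst a * snd b = snd a * fst b"
proof -
  define z z' r where "z = Complex (q $ 2) (q $ 3)" and "z' = Complex (q $ 2) (- (q $ 3))"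
    and "r = complex_of_real (q $ 1)"
  have "(1 - r) * fst a = z * snd a" "z' * fst a = (1 + r) * snd a"
    "(1 - r) * fst b = z * snd b" "z' * fst b = (1 + r) * snd b"
    using assms by (simp_all add: spans_line_def z_def z'_def r_def)
  then have "2 * (fst a * snd b) = 2 * (snd a * fst b)"
    by algebra
  then show ?thesis by simp
qed

text \<open>The Hermitian quotient <a, b> / <b, b>. Unlike a quotient of components it is one
  continuous formula wherever \<open>b\<close> is nonzero.\<close>

definition line_ratio :: "complex \<times> complex \<Rightarrow> complex \<times> complex \<Rightarrow> complex" where
  "line_ratio a b = (fst a * cnj (fst b) + snd a * cnj (snd b)) /
     (fst b * cnj (fst b) + snd b * cnj (snd b))"

lemma line_ratio_denom: "b \<noteq> 0 \<Longrightarrow> fst b * cnj (fst b) + snd b * cnj (snd b) \<noteq> 0"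
proof -
  assume "b \<noteq> 0"
  have "fst b * cnj (fst b) + snd b * cnj (snd b) = of_real ((cmod (fst b))\<^sup>2 + (cmod (snd b))\<^sup>2)"
    unfolding of_real_add by (simp only: complex_norm_square)
  moreover have "(cmod (fst b))\<^sup>2 + (cmod (snd b))\<^sup>2 \<noteq> 0"
    using \<open>b \<noteq> 0\<close> by (auto simp: prod_eq_iff sum_power2_eq_zero_iff)
  ultimately show ?thesis by (metis of_real_eq_0_iff)
qed

lemma line_ratio:
  assumes "spans_line q a" "spans_line q b"
  shows "fst a = line_ratio a b * fst b" "snd a = line_ratio a b * snd b" "line_ratio a b \<noteq> 0"
proof -
  have n: "fst b * cnj (fst b) + snd b * cnj (snd b) \<noteq> 0"
    using assms(2) by (intro line_ratio_denom) (auto simp: spans_line_def)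
  note p = spans_line_proportional[OF assms]
  show 1: "fst a = line_ratio a b * fst b"
    unfolding line_ratio_def using n p by (simp add: field_simps)
  show 2: "snd a = line_ratio a b * snd b"
    unfolding line_ratio_def using n p by (simp add: field_simps)
  show "line_ratio a b \<noteq> 0"
    using 1 2 assms(1) by (auto simp: spans_line_def prod_eq_iff)
qed

lemma spans_line_scale:
  assumes "spans_line q a" "k \<noteq> 0"
  shows "spans_line q (k * fst a, k * snd a)"
  using assms unfolding spans_line_def by (auto simp: prod_eq_iff mult.left_commute[of _ k])

lemma continuous_on_line_proj:
  assumes "continuous_on S q" "continuous_on S a"
  shows "continuous_on S (\<lambda>x. line_proj (q x) (a x))"
  unfolding line_proj_def by (intro continuous_intros assms) auto

text \<open>Covering homotopy property of the Hopf fibration. Where the homotopy is stationary the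
  vector is kept exactly, because a projection fixes the vectors of its own line; this preserves the
  boundary values of lifts.\<close>

lemma lift_homotopy:
  fixes H :: "real \<times> 'a::metric_space \<Rightarrow> real^3" and a :: "'a \<Rightarrow> complex \<times> complex"
  assumes X: "compact X" and H: "continuous_on ({0..1} \<times> X) H" "H ` ({0..1} \<times> X) \<subseteq> sphere 0 1"
    and a: "continuous_on X a" "\<And>x. x \<in> X \<Longrightarrow> spans_line (H (0, x)) (a x)"
  obtains b where "continuous_on X b" "\<And>x. x \<in> X \<Longrightarrow> spans_line (H (1, x)) (b x)"
    "\<And>x. x \<in> X \<Longrightarrow> \<forall>t\<in>{0..1}. H (t, x) = H (0, x) \<Longrightarrow> b x = a x"
proof -
  have "uniformly_continuous_on ({0..1} \<times> X) H"
    using X H(1) by (intro compact_uniformly_continuous compact_Times) auto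
  \<comment> \<open>The bound 1 stays below 2, the bound in
    \<open>line_proj_nonzero\<close>.\<close>
  then obtain d where d: "d > 0" "\<And>y z. y \<in> {0..1} \<times> X \<Longrightarrow> z \<in> {0..1} \<times> X \<Longrightarrow> dist z y < d
      \<Longrightarrow> dist (H z) (H y) < 1"
    unfolding uniformly_continuous_on_def by (metis zero_less_one)
  obtain n :: nat where n: "n > 0" "1 / real n < d"
    using d(1) by (metis nat_approx_posE zero_less_Suc)
  have "\<exists>b. continuous_on X b \<and> (\<forall>x\<in>X. spans_line (H (real k / n, x)) (b x) \<and>
      ((\<forall>t\<in>{0..1}. H (t, x) = H (0, x)) \<longrightarrow> b x = a x))" if "k \<le> n" for k
    using that
  proof (induction k)
    case 0
    show ?case by (rule exI[of _ a]) (simp add: a)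
  next
    case (Suc k)
    from Suc.IH[OF Suc_leD[OF Suc.prems]]
    obtain b where b: "continuous_on X b"
      "\<And>x. x \<in> X \<Longrightarrow> spans_line (H (real k / n, x)) (b x)"
      "\<And>x. x \<in> X \<Longrightarrow> (\<forall>t\<in>{0..1}. H (t, x) = H (0, x)) \<Longrightarrow> b x = a x"
      by blast
    let ?s = "real k / n" and ?t = "real (Suc k) / n"
    have st: "?s \<in> {0..1}" "?t \<in> {0..1}" using Suc.prems n by (auto simp: field_simps)
    define c where "c = (\<lambda>x. line_proj (H (?t, x)) (b x))"
    have "continuous_on X c"
      unfolding c_def using st
      by (intro continuous_on_line_proj b(1) continuous_on_compose2[OF H(1)] continuous_intros) auto
    moreover have "spans_line (H (?t, x)) (c x)" if x: "x \<in> X" for x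
    proof -
      have "dist (?t, x) (?s, x) < d"
        using n by (simp add: dist_Pair_Pair dist_real_def diff_divide_distrib[symmetric])
      then have "dist (H (?t, x)) (H (?s, x)) < 1"
        using d(2) st x by auto
      then have "norm (H (?s, x) - H (?t, x)) < 2"
        by (simp add: dist_norm norm_minus_commute)
      moreover have "norm (H (?t, x)) = 1"
        using H(2) st(2) x by (metis (no_types, lifting) SigmaI image_subset_iff mem_sphere_0)
      ultimately show ?thesis
        unfolding c_def using line_proj_spans line_proj_nonzero[OF b(2)[OF x]] by blast
    qed
    moreover have "c x = a x" if x: "x \<in> X" and const: "\<forall>t\<in>{0..1}. H (t, x) = H (0, x)" for x
      unfolding c_def using b(2)[OF x] b(3)[OF x const] const st
      by (metis line_proj_id)
    ultimately show ?case by (intro exI[of _ c]) blast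
  qed
  from this[of n] n obtain b where "continuous_on X b"
      "\<And>x. x \<in> X \<Longrightarrow> spans_line (H (1, x)) (b x)"
      "\<And>x. x \<in> X \<Longrightarrow> (\<forall>t\<in>{0..1}. H (t, x) = H (0, x)) \<Longrightarrow> b x = a x"
    by (simp, blast)
  then show ?thesis using that by blast
qed

section \<open>The degree of maps of the square that are constant on the boundary\<close>

lemma frontier_square: "frontier square = {(s, t). s \<in> {0..1} \<and> t \<in> {0..1} \<and> (s = 0 \<or> s = 1 \<or> t = 0 \<or> t = 1)}"
  unfolding square_def frontier_def by (auto simp: interior_Times closure_Times)

text \<open>The fibre over \<open>base_point\<close> consists of the multiples of (1, 0). The lift
  is normalised on three sides, so that all the winding happens on the side \<open>s = 1\<close>,
  where \<open>sq_join\<close> attaches the next square. It is a relation; that at most one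
  \<open>d\<close> fits is \<open>hopf_degree_unique\<close>.\<close>

definition hopf_degree :: "(real \<times> real \<Rightarrow> real^3) \<Rightarrow> int \<Rightarrow> bool" where
  "hopf_degree f d \<longleftrightarrow> (\<exists>a. continuous_on square a \<and> (\<forall>x\<in>square. spans_line (f x) (a x)) \<and>
     (\<forall>s\<in>{0..1}. a (s, 0) = (1, 0) \<and> a (s, 1) = (1, 0) \<and> a (0, s) = (1, 0) \<and>
        a (1, s) = (exp (2 * pi * \<i> * of_int d * of_real s), 0)))"

lemma spans_line_base: "spans_line base_point (1, 0)"
  by (simp add: spans_line_def base_point_def complex_eq_iff zero_prod_def)

lemma hopf_degree_const: "hopf_degree (\<lambda>_. base_point) 0"
  unfolding hopf_degree_def
  by (intro exI[of _ "\<lambda>_. (1, 0)"]) (simp add: spans_line_base)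

lemma hopf_degree_cong:
  assumes "hopf_degree f d" "\<And>x. x \<in> square \<Longrightarrow> f x = g x" shows "hopf_degree g d"
  using assms unfolding hopf_degree_def by (metis (no_types, lifting))

text \<open>On the middle line the left lift is \<open>E t\<close> times (1, 0) and the right one is
  (1, 0), so the right lift is multiplied by \<open>E t\<close> throughout. On the far side the
  exponentials multiply, and \<open>E 0 = E 1 = 1\<close> keeps bottom and top normalised.\<close>

lemma hopf_degree_join:
  assumes "hopf_degree f d" "hopf_degree g e"
  shows "hopf_degree (sq_join f g) (d + e)"
proof -
  obtain a where a: "continuous_on square a" "\<And>x. x \<in> square \<Longrightarrow> spans_line (f x) (a x)"
    "\<And>s. s \<in> {0..1} \<Longrightarrow> a (s, 0) = (1, 0) \<and> a (s, 1) = (1, 0) \<and> a (0, s) = (1, 0) \<and>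
        a (1, s) = (exp (2 * pi * \<i> * of_int d * of_real s), 0)"
    using assms(1) unfolding hopf_degree_def by blast
  obtain b where b: "continuous_on square b" "\<And>x. x \<in> square \<Longrightarrow> spans_line (g x) (b x)"
    "\<And>s. s \<in> {0..1} \<Longrightarrow> b (s, 0) = (1, 0) \<and> b (s, 1) = (1, 0) \<and> b (0, s) = (1, 0) \<and>
        b (1, s) = (exp (2 * pi * \<i> * of_int e * of_real s), 0)"
    using assms(2) unfolding hopf_degree_def by blast
  define E where "E = (\<lambda>t :: real. exp (2 * pi * \<i> * of_int d * of_real t))"
  have E1: "E 0 = 1" "E 1 = 1"
    unfolding E_def using exp_integer_2pi[of "of_int d"] by (simp_all add: mult_ac)
  define c where "c = (\<lambda>x :: real \<times> real. if fst x \<le> 1/2 then a (2 * fst x, snd x)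
     else (E (snd x) * fst (b (2 * fst x - 1, snd x)), E (snd x) * snd (b (2 * fst x - 1, snd x))))"
  have sq: "square = ({0..1/2} \<times> {0..1}) \<union> ({1/2..1} \<times> {0..1})"
    by (auto simp: square_def)
  have "continuous_on square c"
    unfolding sq c_def
  proof (rule continuous_on_cases)
    show "continuous_on ({0..1/2} \<times> {0..1}) (\<lambda>x. a (2 * fst x, snd x))"
      by (intro continuous_on_compose2[OF a(1)] continuous_intros) (auto simp: square_def)
    show "continuous_on ({1/2..1} \<times> {0..1}) (\<lambda>x. (E (snd x) * fst (b (2 * fst x - 1, snd x)),
         E (snd x) * snd (b (2 * fst x - 1, snd x))))"
      unfolding E_def
      by (intro continuous_intros continuous_on_compose2[OF b(1)]) (auto simp: square_def)
    show "\<forall>x. x \<in> {0..1/2} \<times> {0..1} \<and> \<not> fst x \<le> 1 / 2 \<or> x \<in> {1/2..1} \<times> {0..1} \<and> fst x \<le> 1 / 2 \<longrightarrow>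
        a (2 * fst x, snd x) =
        (E (snd x) * fst (b (2 * fst x - 1, snd x)), E (snd x) * snd (b (2 * fst x - 1, snd x)))"
    proof (intro allI impI)
      fix x :: "real \<times> real"
      assume "x \<in> {0..1/2} \<times> {0..1} \<and> \<not> fst x \<le> 1 / 2 \<or> x \<in> {1/2..1} \<times> {0..1} \<and> fst x \<le> 1 / 2"
      then have "2 * fst x = 1" "snd x \<in> {0..1}" by auto
      then show "a (2 * fst x, snd x) =
        (E (snd x) * fst (b (2 * fst x - 1, snd x)), E (snd x) * snd (b (2 * fst x - 1, snd x)))"
        using a(3)[of "snd x"] b(3)[of "snd x"] by (simp add: E_def)
    qed
  qed (auto intro!: closed_Times)
  moreover have "spans_line (sq_join f g x) (c x)" if "x \<in> square" for x
    using that a(2)[of "(2 * fst x, snd x)"] b(2)[of "(2 * fst x - 1, snd x)"]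
    unfolding sq_join_def c_def by (auto simp: square_def E_def split_def intro!: spans_line_scale)
  moreover have "c (s, 0) = (1, 0) \<and> c (s, 1) = (1, 0) \<and> c (0, s) = (1, 0) \<and>
      c (1, s) = (exp (2 * pi * \<i> * of_int (d + e) * of_real s), 0)" if s: "s \<in> {0..1}" for s
  proof -
    have "c (s, 0) = (1, 0)" "c (s, 1) = (1, 0)"
      using s a(3)[of "2 * s"] b(3)[of "2 * s - 1"] by (auto simp: c_def E1)
    moreover have "c (0, s) = (1, 0)"
      using s a(3)[of s] by (auto simp: c_def)
    moreover have "c (1, s) = (exp (2 * pi * \<i> * of_int (d + e) * of_real s), 0)"
      using s b(3)[of s] by (auto simp: c_def E_def simp flip: exp_add) (simp add: algebra_simps)
    ultimately show ?thesis by blast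
  qed
  ultimately show ?thesis unfolding hopf_degree_def by blast
qed

lemma compact_square: "compact square"
  unfolding square_def by (intro compact_Times) auto

lemma continuous_map_top_of_set_prod:
  "continuous_map (prod_topology (top_of_set S) (top_of_set T)) (top_of_set U) H \<longleftrightarrow>
    continuous_on (S \<times> T) H \<and> H ` (S \<times> T) \<subseteq> U"
proof -
  have "prod_topology (top_of_set S) (top_of_set T) = top_of_set (S \<times> T)"
    by (simp add: subtopology_Times)
  then show ?thesis
    by (metis continuous_map_subtopology_eu image_subset_iff_funcset)
qed

lemma homotopic_withD:
  assumes "homotopic_with P (top_of_set S) (top_of_set U) f g"
  shows "\<exists>h. continuous_on ({0..1::real} \<times> S) h \<and> h ` ({0..1} \<times> S) \<subseteq> U \<and> (\<lambda>x. h (0, x)) = f \<and>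
    (\<lambda>x. h (1, x)) = g \<and> (\<forall>t\<in>{0..1}. P (\<lambda>x. h (t, x)))"
proof -
  obtain h where h: "continuous_map (prod_topology (top_of_set {0..1::real}) (top_of_set S)) (top_of_set U) h \<and>
      (\<forall>x. h (0, x) = f x) \<and> (\<forall>x. h (1, x) = g x) \<and> (\<forall>t\<in>{0..1}. P (\<lambda>x. h (t, x)))"
    using assms[unfolded homotopic_with_def] ..
  have "(\<lambda>x. h (0, x)) = f" "(\<lambda>x. h (1, x)) = g"
    by (rule ext, use h in metis)+
  with h[THEN conjunct1, unfolded continuous_map_top_of_set_prod] h[THEN conjunct2, THEN conjunct2, THEN conjunct2]
  show ?thesis by metis
qed

text \<open>The homotopy is stationary on the frontier, so the transported lift has the same
  boundary values as the old one.\<close>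

lemma hopf_degree_homotopic:
  assumes "hopf_degree f d"
    "homotopic_with (\<lambda>h. \<forall>b\<in>frontier square. h b = c) (top_of_set square) (top_of_set (sphere 0 1)) f g"
  shows "hopf_degree g d"
proof -
  obtain a where a: "continuous_on square a" "\<And>x. x \<in> square \<Longrightarrow> spans_line (f x) (a x)"
    "\<And>s. s \<in> {0..1} \<Longrightarrow> a (s, 0) = (1, 0) \<and> a (s, 1) = (1, 0) \<and> a (0, s) = (1, 0) \<and>
        a (1, s) = (exp (2 * pi * \<i> * of_int d * of_real s), 0)"
    using assms(1) unfolding hopf_degree_def by blast
  from homotopic_withD[OF assms(2)] obtain H where
    H': "continuous_on ({0..1::real} \<times> square) H" "H ` ({0..1} \<times> square) \<subseteq> sphere 0 1" and
    H: "(\<lambda>x. H (0, x)) = f" "(\<lambda>x. H (1, x)) = g" "\<forall>t\<in>{0..1}. \<forall>b\<in>frontier square. H (t, b) = c"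
    by (elim exE conjE) (rule that)
  obtain b where b: "continuous_on square b" "\<And>x. x \<in> square \<Longrightarrow> spans_line (H (1, x)) (b x)"
    "\<And>x. x \<in> square \<Longrightarrow> \<forall>t\<in>{0..1}. H (t, x) = H (0, x) \<Longrightarrow> b x = a x"
    using lift_homotopy[OF compact_square H' a(1) a(2)[folded H(1)]] by blast
  have "b x = a x" if "x \<in> frontier square" for x
  proof (rule b(3))
    show "x \<in> square" using that unfolding frontier_square by (auto simp: square_def)
    show "\<forall>t\<in>{0..1}. H (t, x) = H (0, x)"
      using H(3) that by simp
  qed
  then have "b (s, 0) = (1, 0) \<and> b (s, 1) = (1, 0) \<and> b (0, s) = (1, 0) \<and>
      b (1, s) = (exp (2 * pi * \<i> * of_int d * of_real s), 0)" if "s \<in> {0..1}" for s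
    using a(3)[OF that] that by (auto simp: frontier_square)
  then show ?thesis
    unfolding hopf_degree_def using b(1) b(2)[unfolded H(2)[THEN fun_cong]]
    by (intro exI[of _ b]) simp
qed

text \<open>Two lifts differ by a nowhere zero function on the contractible square, which has a
  continuous logarithm \<open>L\<close>. On three sides \<open>L\<close> is constant, so it agrees
  at both ends of the fourth, along which it has to grow by 2 pi i (d - e).\<close>

lemma hopf_degree_unique:
  assumes "hopf_degree f d" "hopf_degree f e"
  shows "d = e"
proof -
  obtain a where a: "continuous_on square a" "\<And>x. x \<in> square \<Longrightarrow> spans_line (f x) (a x)"
    "\<And>s. s \<in> {0..1} \<Longrightarrow> a (s, 0) = (1, 0) \<and> a (s, 1) = (1, 0) \<and> a (0, s) = (1, 0) \<and>
        a (1, s) = (exp (2 * pi * \<i> * of_int d * of_real s), 0)"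
    using assms(1) unfolding hopf_degree_def by blast
  obtain b where b: "continuous_on square b" "\<And>x. x \<in> square \<Longrightarrow> spans_line (f x) (b x)"
    "\<And>s. s \<in> {0..1} \<Longrightarrow> b (s, 0) = (1, 0) \<and> b (s, 1) = (1, 0) \<and> b (0, s) = (1, 0) \<and>
        b (1, s) = (exp (2 * pi * \<i> * of_int e * of_real s), 0)"
    using assms(2) unfolding hopf_degree_def by blast
  define k where "k = (\<lambda>x. line_ratio (a x) (b x))"
  have "\<forall>x\<in>square. b x \<noteq> 0" using b(2) by (auto simp: spans_line_def)
  then have "continuous_on square k"
    unfolding k_def line_ratio_def by (intro continuous_intros a(1) b(1)) (auto simp: line_ratio_denom)
  moreover have "k x \<noteq> 0" if "x \<in> square" for x
    unfolding k_def using line_ratio(3)[OF a(2) b(2)] that by blast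
  moreover have "contractible square"
    unfolding square_def by (intro convex_imp_contractible convex_Times) auto
  ultimately obtain L where L: "continuous_on square L" "\<And>x. x \<in> square \<Longrightarrow> k x = exp (L x)"
    using continuous_logarithm_on_contractible by metis
  \<comment> \<open>Logarithms of 1 lie in the discrete set 2 pi i Z, so a continuous choice of them
    on an interval is constant.\<close>
  have const: "h s = h s'" if h: "continuous_on {0..1} h" "\<And>s. s \<in> {0..1} \<Longrightarrow> exp (h s) = 1"
      and "s \<in> {0..1}" "s' \<in> {0..1}" for h :: "real \<Rightarrow> complex" and s s'
  proof -
    have "h constant_on {0..1}"
    proof (rule continuous_discrete_range_constant[OF _ h(1)])
      show "\<exists>e>0. \<forall>y. y \<in> {0..1} \<and> h y \<noteq> h x \<longrightarrow> e \<le> norm (h y - h x)" if "x \<in> {0..1}" for x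
      proof (intro exI[of _ "2 * pi"] conjI allI impI; (elim conjE)?)
        fix y :: real assume y: "y \<in> {0..1}" "h y \<noteq> h x"
        have "exp (h y) = exp (h x)" using h(2) that y by simp
        then obtain n where n: "h y = h x + of_int (2 * n) * pi * \<i>" unfolding exp_eq by auto
        with y have "n \<noteq> 0" by auto
        have "norm (h y - h x) = 2 * pi * \<bar>of_int n\<bar>"
          unfolding n by (simp add: norm_mult)
        moreover have "\<bar>real_of_int n\<bar> \<ge> 1" using \<open>n \<noteq> 0\<close> by linarith
        ultimately show "2 * pi \<le> norm (h y - h x)" by (simp add: mult_left_le)
      qed simp
    qed simp
    then show ?thesis using that(3,4) unfolding constant_on_def by metis
  qed
  have edge: "continuous_on {0..1} (\<lambda>s. L (p s))" if "continuous_on {0..1} p" "p ` {0..1} \<subseteq> square"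
    for p :: "real \<Rightarrow> real \<times> real"
    using continuous_on_compose2[OF L(1) that(1)] that(2) by blast
  have kb: "k (s, 0) = 1" "k (s, 1) = 1" "k (0, s) = 1"
     "k (1, s) = exp (2 * pi * \<i> * of_int (d - e) * of_real s)" if "s \<in> {0..1}" for s
  proof -
    show "k (s, 0) = 1" "k (s, 1) = 1" "k (0, s) = 1"
      using a(3)[OF that] b(3)[OF that] by (simp_all add: k_def line_ratio_def)
    show "k (1, s) = exp (2 * pi * \<i> * of_int (d - e) * of_real s)"
      using a(3)[OF that] b(3)[OF that]
      by (simp add: k_def line_ratio_def exp_diff[symmetric] algebra_simps)
  qed
  have edges: "continuous_on {0..1} (\<lambda>s. L (s, 0))" "continuous_on {0..1} (\<lambda>s. L (s, 1))"
    "continuous_on {0..1} (\<lambda>s. L (0, s))" "continuous_on {0..1} (\<lambda>s. L (1, s))"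
    by (rule edge; force simp: square_def intro!: continuous_intros)+
  have "exp (L (s, 0)) = 1" "exp (L (s, 1)) = 1" "exp (L (0, s)) = 1" if "s \<in> {0..1}" for s
    using kb[OF that] L(2)[of "(s, 0)"] L(2)[of "(s, 1)"] L(2)[of "(0, s)"] that
    by (auto simp: square_def)
  note kL = this
  have "L (1, 0) = L (0, 0)"
    using const[of "\<lambda>s. L (s, 0)" 1 0] kL edges by simp
  moreover have "L (0, 0) = L (0, 1)"
    using const[of "\<lambda>s. L (0, s)" 0 1] kL edges by simp
  moreover have "L (0, 1) = L (1, 1)"
    using const[of "\<lambda>s. L (s, 1)" 0 1] kL edges by simp
  moreover have "L (1, 0) = L (1, 1) - 2 * pi * \<i> * of_int (d - e)"
  proof -
    define h where "h = (\<lambda>s. L (1, s) - 2 * pi * \<i> * of_int (d - e) * of_real s)"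
    have "continuous_on {0..1} h"
      unfolding h_def by (intro continuous_intros edges)
    moreover have "exp (h s) = 1" if "s \<in> {0..1}" for s
    proof -
      have "exp (L (1, s)) = exp (2 * pi * \<i> * of_int (d - e) * of_real s)"
        using L(2)[of "(1, s)"] kb(4)[OF that] that by (simp add: square_def)
      then show ?thesis by (simp add: h_def exp_diff)
    qed
    ultimately have "h 0 = h 1" using const by force
    then show ?thesis by (simp add: h_def)
  qed
  ultimately have "2 * pi * \<i> * of_int (d - e) = 0" by simp
  then show ?thesis by (simp add: complex_eq_iff)
qed

text \<open>The homotopy is lifted over the whole sphere, backwards from the constant map with its
  constant lift. This gives a lift of \<open>f\<close> defined on the sphere; composed with
  \<open>c\<close> it cannot wind along the boundary, which goes to a single point.\<close>

lemma hopf_degree_nullhomotopic: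
  assumes f: "f base_point = base_point" and
    hom: "homotopic_with (\<lambda>_. True) (top_of_set (sphere 0 1)) (top_of_set (sphere 0 1)) f (\<lambda>_. base_point)"
    and c: "continuous_on square c" "c ` square \<subseteq> sphere 0 1" "\<And>b. b \<in> frontier square \<Longrightarrow> c b = base_point"
  shows "hopf_degree (f \<circ> c) 0"
proof -
  from homotopic_withD[OF hom[unfolded homotopic_with_sym[of _ _ _ f]]] obtain H where
    H': "continuous_on ({0..1::real} \<times> sphere 0 1) H" "H ` ({0..1} \<times> sphere 0 1) \<subseteq> sphere 0 1" and
    H0: "(\<lambda>x. H (0, x)) = (\<lambda>_. base_point)" and H1: "(\<lambda>x. H (1, x)) = f"
    by (elim exE conjE) (rule that)
  have H: "H (0, x) = base_point" "H (1, x) = f x" for x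
    using H0 H1 by metis+
  obtain a where a: "continuous_on (sphere 0 1) a" "\<And>x. x \<in> sphere 0 1 \<Longrightarrow> spans_line (H (1, x)) (a x)"
    using lift_homotopy[OF compact_sphere H' continuous_on_const, of "(1, 0)"]
    by (metis H(1) spans_line_base)
  have bp: "base_point \<in> sphere 0 1"
    by (simp add: base_point_def norm_vec3)
  \<comment> \<open>The lift may end over \<open>base_point\<close> with any vector of the line;
    \<open>k\<close> rescales it to (1, 0).\<close>
  define k where "k = line_ratio (1, 0) (a base_point)"
  have "spans_line base_point (a base_point)"
    using a(2)[OF bp] H(2) f by simp
  note k = line_ratio[OF spans_line_base this, folded k_def, simplified]
  define b where "b = (\<lambda>x. (k * fst (a (c x)), k * snd (a (c x))))"
  have "continuous_on square b"
    unfolding b_def using c by (intro continuous_intros continuous_on_compose2[OF a(1)]) auto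
  moreover have "spans_line ((f \<circ> c) x) (b x)" if "x \<in> square" for x
    using a(2)[of "c x"] H(2) c(2) that k(3) by (auto simp: b_def intro!: spans_line_scale)
  moreover have "b x = (1, 0)" if "x \<in> frontier square" for x
    using c(3)[OF that] k by (simp add: b_def)
  ultimately show ?thesis
    unfolding hopf_degree_def by (intro exI[of _ b]) (simp add: frontier_square)
qed

text \<open>The line over \<open>collapse (s, t)\<close> has the homogeneous coordinates \<open>[u + \<i> v : d]\<close> of the
  stereographic projection.\<close>

definition collapse_lift :: "real \<times> real \<Rightarrow> complex \<times> complex" where
  "collapse_lift = (\<lambda>(s, t). (Complex (2 * s - 1) (2 * t - 1),
     of_real ((1 - (2 * s - 1)\<^sup>2) * (1 - (2 * t - 1)\<^sup>2))))"

section \<open>The collapse map and its degree\<close>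

lemma collapse_denom:
  fixes u v :: real
  assumes "d = (1 - u\<^sup>2) * (1 - v\<^sup>2)"
  shows "u\<^sup>2 + v\<^sup>2 + d\<^sup>2 > 0"
proof (cases "u = 0 \<and> v = 0")
  case True
  then show ?thesis using assms by simp
next
  case False
  then have "u\<^sup>2 + v\<^sup>2 > 0" by (simp add: sum_power2_gt_zero_iff)
  then show ?thesis by (simp add: add_pos_nonneg)
qed

lemma collapse_lift_spans: "spans_line (collapse x) (collapse_lift x)"
proof -
  define u v d where "u = 2 * fst x - 1" and "v = 2 * snd x - 1" and d: "d = (1 - u\<^sup>2) * (1 - v\<^sup>2)"
  define N where "N = u\<^sup>2 + v\<^sup>2 + d\<^sup>2"
  have N: "N > 0" unfolding N_def by (rule collapse_denom[OF d])
  have c: "collapse x = (1 / N) *\<^sub>R vector [u\<^sup>2 + v\<^sup>2 - d\<^sup>2, 2 * u * d, 2 * v * d]"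
    by (simp add: collapse_def split_def Let_def u_def v_def d N_def)
  have l: "collapse_lift x = (Complex u v, of_real d)"
    by (simp add: collapse_lift_def split_def u_def v_def d)
  have "u \<noteq> 0 \<or> v \<noteq> 0 \<or> d \<noteq> 0" using N by (auto simp: N_def)
  moreover have "(1 - (u\<^sup>2 + v\<^sup>2 - d\<^sup>2) / N) = 2 * d\<^sup>2 / N" "(1 + (u\<^sup>2 + v\<^sup>2 - d\<^sup>2) / N) = 2 * (u\<^sup>2 + v\<^sup>2) / N"
    using N by (simp_all add: field_simps) (simp_all add: N_def)
  ultimately show ?thesis
    unfolding spans_line_def c l
    by (simp add: complex_eq_iff zero_prod_def Re_complex_div_eq_0) (simp add: power2_eq_square algebra_simps add_divide_distrib)
qed

lemma collapse_norm: "norm (collapse x) = 1"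
proof -
  define u v d where "u = 2 * fst x - 1" and "v = 2 * snd x - 1" and d: "d = (1 - u\<^sup>2) * (1 - v\<^sup>2)"
  define N where "N = u\<^sup>2 + v\<^sup>2 + d\<^sup>2"
  have N: "N > 0" unfolding N_def by (rule collapse_denom[OF d])
  have c: "collapse x = (1 / N) *\<^sub>R vector [u\<^sup>2 + v\<^sup>2 - d\<^sup>2, 2 * u * d, 2 * v * d]"
    by (simp add: collapse_def split_def Let_def u_def v_def d N_def)
  have "(u\<^sup>2 + v\<^sup>2 - d\<^sup>2)\<^sup>2 + (2 * u * d)\<^sup>2 + (2 * v * d)\<^sup>2 = N\<^sup>2"
    unfolding N_def by (simp add: power2_eq_square algebra_simps)
  then have "norm (vector [u\<^sup>2 + v\<^sup>2 - d\<^sup>2, 2 * u * d, 2 * v * d] :: real^3) = N"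
    using N by (simp add: norm_vec3)
  then show ?thesis using N by (simp add: c)
qed

lemma continuous_collapse: "continuous_on S collapse"
proof -
  have eq: "collapse = (\<lambda>x. let u = 2 * fst x - 1; v = 2 * snd x - 1; d = (1 - u\<^sup>2) * (1 - v\<^sup>2) in
     (1 / (u\<^sup>2 + v\<^sup>2 + d\<^sup>2)) *\<^sub>R
       ((u\<^sup>2 + v\<^sup>2 - d\<^sup>2) *\<^sub>R axis 1 1 + (2 * u * d) *\<^sub>R axis 2 1 + (2 * v * d) *\<^sub>R axis 3 1))"
    by (auto simp: collapse_def split_def Let_def vec_eq_iff forall_3 axis_def)
  show ?thesis
    unfolding eq Let_def
    by (intro continuous_intros) (metis collapse_denom less_irrefl)
qed

lemma collapse_frontier:
  assumes "x \<in> frontier square" shows "collapse x = base_point"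
proof -
  define u v d where "u = 2 * fst x - 1" and "v = 2 * snd x - 1" and d: "d = (1 - u\<^sup>2) * (1 - v\<^sup>2)"
  define N where "N = u\<^sup>2 + v\<^sup>2 + d\<^sup>2"
  have N: "N > 0" unfolding N_def by (rule collapse_denom[OF d])
  have c: "collapse x = (1 / N) *\<^sub>R vector [u\<^sup>2 + v\<^sup>2 - d\<^sup>2, 2 * u * d, 2 * v * d]"
    by (simp add: collapse_def split_def Let_def u_def v_def d N_def)
  have "d = 0" using assms by (auto simp: frontier_square d u_def v_def)
  then show ?thesis using N unfolding c by (simp add: vec_eq_iff forall_3 base_point_def N_def) auto
qed

text \<open>On the boundary the lift is \<open>u + \<i> v\<close>. It is multiplied by \<open>exp g\<close>, where \<open>g\<close> extends a function on
  the boundary that makes the product 1 on three sides.\<close>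

lemma hopf_degree_collapse: "hopf_degree collapse 1"
proof -
  define z where "z = (\<lambda>x :: real \<times> real. Complex (2 * fst x - 1) (2 * snd x - 1))"
  define S where "S = ({0} \<times> {0..1} \<union> {0..1} \<times> {0} \<union> {0..1} \<times> {1} :: (real \<times> real) set)"
  define T where "T = ({1} \<times> {0..1} :: (real \<times> real) set)"
  \<comment> \<open>On \<open>T\<close> the real part of \<open>z\<close> is 1, and on
    \<open>S\<close> the values \<open>- z\<close> avoid the nonpositive reals, so each formula is
    continuous on its part. The constants - pi i and - 2 pi i make the two agree at the common
    corners (1, 0) and (1, 1).\<close>
  define E where "E = (\<lambda>x. if x \<in> T then - Ln (z x) + 2 * pi * \<i> * of_real (snd x) - 2 * pi * \<i>
      else - Ln (- z x) - pi * \<i>)"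
  have corner: "Ln (- (1 + \<i>)) = Ln (1 + \<i>) - pi * \<i>" "Ln (- (1 - \<i>)) = Ln (1 - \<i>) + pi * \<i>"
    by (subst Ln_minus; simp add: complex_eq_iff mult.commute)+
  have "continuous_on (T \<union> S) E"
    unfolding E_def
  proof (rule continuous_on_cases)
    show "closed T" "closed S" unfolding S_def T_def by (intro closed_Un closed_Times; simp)+
    show "continuous_on T (\<lambda>x. - Ln (z x) + 2 * pi * \<i> * of_real (snd x) - 2 * pi * \<i>)"
      unfolding z_def T_def by (intro continuous_intros) (auto simp: complex_nonpos_Reals_iff)
    show "continuous_on S (\<lambda>x. - Ln (- z x) - pi * \<i>)"
      unfolding z_def S_def by (intro continuous_intros) (auto simp: complex_nonpos_Reals_iff)
    have "- Ln (z x) + 2 * pi * \<i> * of_real (snd x) - 2 * pi * \<i> = - Ln (- z x) - pi * \<i>"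
      if "x = (1, 0) \<or> x = (1, 1)" for x
    proof -
      have z: "z (1, 0) = 1 - \<i>" "z (1, 1) = 1 + \<i>" by (simp_all add: z_def complex_eq_iff)
      from that show ?thesis
      proof
        assume "x = (1, 0)"
        then show ?thesis using corner(2) by (simp only: z) simp
      next
        assume "x = (1, 1)"
        then show ?thesis using corner(1) by (simp only: z) simp
      qed
    qed
    moreover have "x = (1, 0) \<or> x = (1, 1)" if "x \<in> S" "x \<in> T" for x
      using that by (auto simp: S_def T_def)
    ultimately show "\<forall>x. x \<in> T \<and> x \<notin> T \<or> x \<in> S \<and> x \<in> T \<longrightarrow>
      - Ln (z x) + 2 * pi * \<i> * of_real (snd x) - 2 * pi * \<i> = - Ln (- z x) - pi * \<i>"
      by blast
  qed
  moreover have "closedin (top_of_set square) (T \<union> S)"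
    by (rule closed_subset) (auto simp: S_def T_def square_def intro!: closed_Un closed_Times)
  ultimately obtain g where g: "continuous_on square g" "\<And>x. x \<in> T \<union> S \<Longrightarrow> g x = E x"
    using Tietze_unbounded by metis
  define a where "a = (\<lambda>x. (exp (g x) * fst (collapse_lift x), exp (g x) * snd (collapse_lift x)))"
  have "continuous_on square a"
    unfolding a_def collapse_lift_def split_def by (intro continuous_intros g(1))
  moreover have "spans_line (collapse x) (a x)" for x
    unfolding a_def by (intro spans_line_scale collapse_lift_spans) simp
  moreover have aS: "a x = (1, 0)" if "x \<in> S" "x \<notin> T" for x
  proof -
    have "- z x \<noteq> 0" using that by (auto simp: S_def z_def complex_eq_iff)
    then have "exp (E x) * z x = 1"
      using that(2) by (simp add: E_def exp_diff exp_minus field_simps)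
    then show ?thesis
      using that g(2)[of x] by (auto simp: a_def collapse_lift_def z_def S_def)
  qed
  moreover have aT: "a x = (exp (2 * pi * \<i> * of_real (snd x)), 0)" if "x \<in> T" for x
  proof -
    have "z x \<noteq> 0" using that by (auto simp: T_def z_def complex_eq_iff)
    then have "exp (E x) * z x = exp (2 * pi * \<i> * of_real (snd x))"
      using that by (simp add: E_def exp_diff exp_add exp_minus field_simps)
    then show ?thesis
      using that g(2)[of x] by (auto simp: a_def collapse_lift_def z_def T_def)
  qed
  moreover have "a (s, 0) = (1, 0) \<and> a (s, 1) = (1, 0) \<and> a (0, s) = (1, 0) \<and>
      a (1, s) = (exp (2 * pi * \<i> * of_int 1 * of_real s), 0)" if "s \<in> {0..1}" for s
  proof (intro conjI)
    show "a (s, 0) = (1, 0)"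
      using aS[of "(s, 0)"] aT[of "(s, 0)"] that by (cases "s = 1") (auto simp: S_def T_def)
    show "a (s, 1) = (1, 0)"
      using aS[of "(s, 1)"] aT[of "(s, 1)"] that by (cases "s = 1") (auto simp: S_def T_def)
    show "a (0, s) = (1, 0)"
      using aS[of "(0, s)"] that by (auto simp: S_def T_def)
    show "a (1, s) = (exp (2 * pi * \<i> * of_int 1 * of_real s), 0)"
      using aT[of "(1, s)"] that by (auto simp: T_def)
  qed
  ultimately show ?thesis unfolding hopf_degree_def by (intro exI[of _ a]) blast
qed

section \<open>Smooth maps\<close>

text \<open>Since \<open>U\<close> is open, agreement on \<open>U\<close> passes to the derivatives
  at its points, which drives the induction.\<close>

lemma Ck_on_cong:
  assumes "open U" "\<And>x. x \<in> U \<Longrightarrow> f x = g x" "Ck_on k U f"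
  shows "Ck_on k U g"
  using assms(2,3)
proof (induction k arbitrary: f g)
  case 0
  then show ?case using continuous_on_cong[of U U f g] by simp
next
  case (Suc k)
  have d: "frechet_derivative f (at x) = frechet_derivative g (at x)" "g differentiable (at x)" if "x \<in> U" for x
  proof -
    have f: "f differentiable (at x)" using Suc.prems that by simp
    show "frechet_derivative f (at x) = frechet_derivative g (at x)"
      by (rule frechet_derivative_transform_within_open[OF f assms(1) that Suc.prems(1)])
    have "(f has_derivative frechet_derivative f (at x)) (at x)"
      using f by (simp add: frechet_derivative_works)
    then have "(g has_derivative frechet_derivative f (at x)) (at x)"
      by (rule has_derivative_transform_within_open[OF _ assms(1) that Suc.prems(1)])
    then show "g differentiable (at x)" by (auto simp: differentiable_def)
  qed
  have "Ck_on k U (\<lambda>x. frechet_derivative g (at x) v)" for v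
    by (rule Suc.IH[of "\<lambda>x. frechet_derivative f (at x) v"]) (use d Suc.prems(2) in auto)
  then show ?case using d by auto
qed

lemma Ck_on_subset: "Ck_on k U f \<Longrightarrow> V \<subseteq> U \<Longrightarrow> Ck_on k V f"
proof (induction k arbitrary: f)
  case 0
  then show ?case by (auto intro: continuous_on_subset)
next
  case (Suc k)
  then show ?case by (simp add: subset_iff)
qed

lemma Ck_on_Suc_imp: "Ck_on (Suc k) U f \<Longrightarrow> Ck_on k U f"
proof (induction k arbitrary: f)
  case 0
  then show ?case
    by (auto intro!: continuous_at_imp_continuous_on differentiable_imp_continuous_within)
qed simp

text \<open>Lets an explicit formula stand in for \<open>frechet_derivative\<close>, so that the
  closure rules below become inductions on \<open>k\<close> over the usual rules of
  differentiation.\<close>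

lemma Ck_on_SucI:
  assumes "open U" "\<And>x. x \<in> U \<Longrightarrow> (f has_derivative f' x) (at x)" "\<And>v. Ck_on k U (\<lambda>x. f' x v)"
  shows "Ck_on (Suc k) U f"
proof -
  have "Ck_on k U (\<lambda>x. frechet_derivative f (at x) v)" for v
    by (rule Ck_on_cong[OF assms(1) _ assms(3)]) (simp add: frechet_derivative_at[OF assms(2), symmetric])
  moreover have "f differentiable (at x)" if "x \<in> U" for x
    using assms(2)[OF that] unfolding differentiable_def by blast
  ultimately show ?thesis by simp
qed

lemma Ck_on_SucD:
  assumes "Ck_on (Suc k) U f" "x \<in> U"
  shows "(f has_derivative frechet_derivative f (at x)) (at x)"
proof -
  have "f differentiable (at x)" using assms by simp
  then show ?thesis by (rule frechet_derivative_works[THEN iffD1])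
qed

lemma Ck_on_const: "open U \<Longrightarrow> Ck_on k U (\<lambda>_. c)"
proof (induction k arbitrary: c)
  case (Suc k)
  show ?case
    by (rule Ck_on_SucI[OF Suc.prems, where f'="\<lambda>_ _. 0"]) (simp, rule Suc.IH[OF Suc.prems])
qed simp

lemma Ck_on_bounded_linear_comp:
  assumes "open U" "bounded_linear L" "Ck_on k U f"
  shows "Ck_on k U (\<lambda>x. L (f x))"
  using assms(3)
proof (induction k arbitrary: f)
  case 0
  then show ?case using bounded_linear.continuous_on[OF assms(2)] by simp
next
  case (Suc k)
  show ?case
    by (rule Ck_on_SucI[OF assms(1) bounded_linear.has_derivative[OF assms(2) Ck_on_SucD[OF Suc.prems]]])
       (assumption, rule Suc.IH, use Suc.prems in simp)
qed

lemma Ck_on_id: "open U \<Longrightarrow> Ck_on k U (\<lambda>x. x)"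
proof (cases k)
  case (Suc n)
  assume "open U"
  then show ?thesis unfolding Suc
    by (intro Ck_on_SucI[where f'="\<lambda>_ v. v"] Ck_on_const) (auto intro: derivative_eq_intros)
qed auto

lemma Ck_on_add:
  assumes "open U" "Ck_on k U f" "Ck_on k U g"
  shows "Ck_on k U (\<lambda>x. f x + g x)"
  using assms(2,3)
proof (induction k arbitrary: f g)
  case 0
  then show ?case by (auto intro: continuous_intros)
next
  case (Suc k)
  show ?case
    by (rule Ck_on_SucI[OF assms(1) has_derivative_add[OF Ck_on_SucD[OF Suc.prems(1)] Ck_on_SucD[OF Suc.prems(2)]]])
       (use Suc in auto)
qed

lemma Ck_on_bounded_bilinear:
  assumes "open U" "bounded_bilinear B" "Ck_on k U f" "Ck_on k U g"
  shows "Ck_on k U (\<lambda>x. B (f x) (g x))"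
  using assms(3,4)
proof (induction k arbitrary: f g)
  case 0
  then show ?case using assms(2) by (auto intro: bounded_bilinear.continuous_on)
next
  case (Suc k)
  show ?case
    by (rule Ck_on_SucI[OF assms(1) bounded_bilinear.FDERIV[OF assms(2) Ck_on_SucD[OF Suc.prems(1)] Ck_on_SucD[OF Suc.prems(2)]]])
       (use Suc.prems in \<open>auto intro!: Ck_on_add assms(1) Suc.IH intro: Ck_on_Suc_imp\<close>)
qed

lemma Ck_on_mult:
  fixes f g :: "'a::euclidean_space \<Rightarrow> real"
  shows "open U \<Longrightarrow> Ck_on k U f \<Longrightarrow> Ck_on k U g \<Longrightarrow> Ck_on k U (\<lambda>x. f x * g x)"
  by (rule Ck_on_bounded_bilinear[OF _ bounded_bilinear_mult])

text \<open>The derivative is a product of copies of the function itself and the derivative of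
  \<open>f\<close>, so the induction on \<open>k\<close> closes.\<close>

lemma Ck_on_inverse:
  fixes f :: "'a::euclidean_space \<Rightarrow> real"
  assumes "open U" "Ck_on k U f" "\<And>x. x \<in> U \<Longrightarrow> f x \<noteq> 0"
  shows "Ck_on k U (\<lambda>x. inverse (f x))"
  using assms(2)
proof (induction k)
  case 0
  then show ?case using assms(3) by (auto intro: continuous_intros)
next
  case (Suc k)
  have d: "((\<lambda>x. inverse (f x)) has_derivative
      (\<lambda>v. (- 1 * (inverse (f x) * inverse (f x))) * frechet_derivative f (at x) v)) (at x)" if "x \<in> U" for x
    using Ck_on_SucD[OF Suc.prems that] assms(3)[OF that]
    by (auto intro!: derivative_eq_intros simp: fun_eq_iff)
  have D: "Ck_on k U (\<lambda>x. frechet_derivative f (at x) v)" for v using Suc.prems by simp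
  note IH = Suc.IH[OF Ck_on_Suc_imp[OF Suc.prems]]
  show ?case
    by (rule Ck_on_SucI[OF assms(1) d]) (assumption | intro Ck_on_mult Ck_on_const assms(1) IH D)+
qed

lemma Ck_on_sqrt:
  fixes f :: "'a::euclidean_space \<Rightarrow> real"
  assumes "open U" "Ck_on k U f" "\<And>x. x \<in> U \<Longrightarrow> f x > 0"
  shows "Ck_on k U (\<lambda>x. sqrt (f x))"
  using assms(2)
proof (induction k)
  case 0
  then show ?case by (auto intro: continuous_intros)
next
  case (Suc k)
  have d: "((\<lambda>x. sqrt (f x)) has_derivative
      (\<lambda>v. (1 / 2 * inverse (sqrt (f x))) * frechet_derivative f (at x) v)) (at x)" if "x \<in> U" for x
    using Ck_on_SucD[OF Suc.prems that] assms(3)[OF that]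
    by (auto intro!: derivative_eq_intros simp: fun_eq_iff field_simps)
  have D: "Ck_on k U (\<lambda>x. frechet_derivative f (at x) v)" for v using Suc.prems by simp
  note IH = Suc.IH[OF Ck_on_Suc_imp[OF Suc.prems]]
  have nz: "sqrt (f x) \<noteq> 0" if "x \<in> U" for x using assms(3)[OF that] by simp
  show ?case
    by (rule Ck_on_SucI[OF assms(1) d]) (assumption | intro Ck_on_mult Ck_on_const Ck_on_inverse assms(1) IH D | erule nz)+
qed

text \<open>Proved together because each of the two is, up to sign, the derivative of the
  other.\<close>

lemma Ck_on_sin_cos:
  fixes f :: "'a::euclidean_space \<Rightarrow> real"
  assumes "open U" "Ck_on k U f"
  shows "Ck_on k U (\<lambda>x. sin (f x)) \<and> Ck_on k U (\<lambda>x. cos (f x))"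
  using assms(2)
proof (induction k)
  case 0
  then show ?case by (auto intro: continuous_intros)
next
  case (Suc k)
  have s: "((\<lambda>x. sin (f x)) has_derivative (\<lambda>v. cos (f x) * frechet_derivative f (at x) v)) (at x)"
    and c: "((\<lambda>x. cos (f x)) has_derivative (\<lambda>v. (- 1 * sin (f x)) * frechet_derivative f (at x) v)) (at x)"
    if "x \<in> U" for x
    using Ck_on_SucD[OF Suc.prems that] by (auto intro!: derivative_eq_intros simp: fun_eq_iff)
  have IH: "Ck_on k U (\<lambda>x. sin (f x))" "Ck_on k U (\<lambda>x. cos (f x))"
    using Suc.IH[OF Ck_on_Suc_imp[OF Suc.prems]] by blast+
  have D: "Ck_on k U (\<lambda>x. frechet_derivative f (at x) v)" for v using Suc.prems by simp
  show ?case
    by (intro conjI Ck_on_SucI[OF assms(1) s] Ck_on_SucI[OF assms(1) c] Ck_on_mult Ck_on_const assms(1) IH D)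
qed

section \<open>Smoothness on arbitrary subsets\<close>

lemma smooth_onI:
  "(\<And>x. x \<in> A \<Longrightarrow> \<exists>U g. open U \<and> x \<in> U \<and> (\<forall>k. Ck_on k U g) \<and> (\<forall>y\<in>A \<inter> U. g y = f y)) \<Longrightarrow> smooth_on A f"
  by (simp add: smooth_on_def)

lemma smooth_onE:
  assumes "smooth_on A f" "x \<in> A"
  obtains U g where "open U" "x \<in> U" "\<forall>k. Ck_on k U g" "\<forall>y\<in>A \<inter> U. g y = f y"
proof -
  have "\<exists>U g. open U \<and> x \<in> U \<and> (\<forall>k. Ck_on k U g) \<and> (\<forall>y\<in>A \<inter> U. g y = f y)"
    using assms unfolding smooth_on_def by (rule bspec)
  then show ?thesis
  proof (elim exE conjE)
    fix U g assume "open U" "x \<in> U" "\<forall>k. Ck_on k U g" "\<forall>y\<in>A \<inter> U. g y = f y"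
    then show thesis by (intro that[of U g]) simp_all
  qed
qed

lemma smooth_on_cong: "smooth_on A f \<Longrightarrow> (\<And>x. x \<in> A \<Longrightarrow> f x = g x) \<Longrightarrow> smooth_on A g"
  unfolding smooth_on_def by simp

lemma smooth_on_bounded_linear:
  assumes "bounded_linear L" "smooth_on A f"
  shows "smooth_on A (\<lambda>x. L (f x))"
proof (rule smooth_onI)
  fix x assume x: "x \<in> A"
  obtain U g where U: "open U" "x \<in> U" "\<forall>k. Ck_on k U g" "\<forall>y\<in>A \<inter> U. g y = f y"
    by (rule smooth_onE[OF assms(2) x])
  note U = U(1,2) U(3)[rule_format] U(4)[rule_format, OF IntI]
  show "\<exists>U g. open U \<and> x \<in> U \<and> (\<forall>k. Ck_on k U g) \<and> (\<forall>y\<in>A \<inter> U. g y = L (f y))"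
    by (rule exI[of _ U], rule exI[of _ "\<lambda>x. L (g x)"])
      (use U(1,2) Ck_on_bounded_linear_comp[OF U(1) assms(1) U(3)] in \<open>simp add: U(4)\<close>)
qed

text \<open>Local extensions of both arguments are combined on the intersection of their domains;
  this reduces closure rules to the case of open sets.\<close>

lemma smooth_on_binary:
  fixes A :: "'a::euclidean_space set"
  assumes "smooth_on A f" "smooth_on A g"
    and op: "\<And>k (U :: 'a set) f' g'. open U \<Longrightarrow> Ck_on k U f' \<Longrightarrow> Ck_on k U g' \<Longrightarrow> Ck_on k U (\<lambda>x. op (f' x) (g' x))"
  shows "smooth_on A (\<lambda>x. op (f x) (g x))"
proof (rule smooth_onI)
  fix x assume x: "x \<in> A"
  obtain U f' where U: "open U" "x \<in> U" "\<forall>k. Ck_on k U f'" "\<forall>y\<in>A \<inter> U. f' y = f y"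
    by (rule smooth_onE[OF assms(1) x])
  note U = U(1,2) U(3)[rule_format] U(4)[rule_format, OF IntI]
  obtain V g' where V: "open V" "x \<in> V" "\<forall>k. Ck_on k V g'" "\<forall>y\<in>A \<inter> V. g' y = g y"
    by (rule smooth_onE[OF assms(2) x])
  note V = V(1,2) V(3)[rule_format] V(4)[rule_format, OF IntI]
  have "Ck_on k (U \<inter> V) (\<lambda>x. op (f' x) (g' x))" for k
    by (intro op open_Int U V Ck_on_subset[OF U(3)] Ck_on_subset[OF V(3)]) auto
  then show "\<exists>U h. open U \<and> x \<in> U \<and> (\<forall>k. Ck_on k U h) \<and> (\<forall>y\<in>A \<inter> U. h y = op (f y) (g y))"
    by (intro exI[of _ "U \<inter> V"] exI[of _ "\<lambda>x. op (f' x) (g' x)"]) (simp add: U V open_Int)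
qed

text \<open>The local extension \<open>f'\<close> may leave \<open>V\<close> although
  \<open>f\<close> does not, so its domain is shrunk to the open set \<open>W\<close> on which it
  stays in \<open>V\<close>.\<close>

lemma smooth_on_unary:
  fixes A :: "'a::euclidean_space set"
  assumes f: "smooth_on A f" and V: "open V" "f ` A \<subseteq> V"
    and op: "\<And>k (U :: 'a set) f'. open U \<Longrightarrow> Ck_on k U f' \<Longrightarrow> f' ` U \<subseteq> V \<Longrightarrow> Ck_on k U (\<lambda>x. op (f' x))"
  shows "smooth_on A (\<lambda>x. op (f x))"
proof (rule smooth_onI)
  fix x assume x: "x \<in> A"
  obtain U f' where U: "open U" "x \<in> U" "\<forall>k. Ck_on k U f'" "\<forall>y\<in>A \<inter> U. f' y = f y"
    by (rule smooth_onE[OF f x])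
  note U = U(1,2) U(3)[rule_format] U(4)[rule_format, OF IntI]
  define W where "W = U \<inter> f' -` V"
  have W: "open W" unfolding W_def using U(3)[of 0] U(1) V(1)
    by (metis Ck_on.simps(1) continuous_open_preimage)
  have "Ck_on k W (\<lambda>x. op (f' x))" for k
    by (intro op W Ck_on_subset[OF U(3)]) (auto simp: W_def)
  moreover have "x \<in> W" using U x V(2) by (force simp: W_def)
  ultimately show "\<exists>U h. open U \<and> x \<in> U \<and> (\<forall>k. Ck_on k U h) \<and> (\<forall>y\<in>A \<inter> U. h y = op (f y))"
    by (intro exI[of _ W] exI[of _ "\<lambda>x. op (f' x)"]) (use W U in \<open>simp add: W_def\<close>)
qed

lemma smooth_on_const: "smooth_on A (\<lambda>_. c)"
  by (rule smooth_onI) (blast intro: Ck_on_const)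

lemma smooth_on_id: "smooth_on A (\<lambda>x. x)"
  by (rule smooth_onI) (blast intro: Ck_on_id)

lemma smooth_on_add: "smooth_on A f \<Longrightarrow> smooth_on A g \<Longrightarrow> smooth_on A (\<lambda>x. f x + g x)"
  by (rule smooth_on_binary[where op="(+)"]) (auto intro: Ck_on_add)

lemma smooth_on_bounded_bilinear:
  "bounded_bilinear B \<Longrightarrow> smooth_on A f \<Longrightarrow> smooth_on A g \<Longrightarrow> smooth_on A (\<lambda>x. B (f x) (g x))"
  by (rule smooth_on_binary[where op=B]) (auto intro: Ck_on_bounded_bilinear)

lemmas smooth_on_mult = smooth_on_bounded_bilinear[OF bounded_bilinear_mult]
  and smooth_on_scaleR = smooth_on_bounded_bilinear[OF bounded_bilinear_scaleR]
  and smooth_on_inner = smooth_on_bounded_bilinear[OF bounded_bilinear_inner]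
  and smooth_on_minus = smooth_on_bounded_linear[OF bounded_linear_minus[OF bounded_linear_ident]]
  and smooth_on_fst = smooth_on_bounded_linear[OF bounded_linear_fst]
  and smooth_on_snd = smooth_on_bounded_linear[OF bounded_linear_snd]
  and smooth_on_vec_nth = smooth_on_bounded_linear[OF bounded_linear_vec_nth]
  and smooth_on_Re = smooth_on_bounded_linear[OF bounded_linear_Re]
  and smooth_on_Im = smooth_on_bounded_linear[OF bounded_linear_Im]

lemma bounded_bilinear_cross3: "bounded_bilinear cross3"
  using bilinear_cross by (simp add: bilinear_conv_bounded_bilinear)

lemmas smooth_on_cross3 = smooth_on_bounded_bilinear[OF bounded_bilinear_cross3]

lemma smooth_on_diff: "smooth_on A f \<Longrightarrow> smooth_on A g \<Longrightarrow> smooth_on A (\<lambda>x. f x - g x)"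
  using smooth_on_add[OF _ smooth_on_minus, of A f g] by simp

lemma smooth_on_power:
  fixes f :: "_ \<Rightarrow> real"
  shows "smooth_on A f \<Longrightarrow> smooth_on A (\<lambda>x. f x ^ n)"
  by (induction n) (auto intro: smooth_on_const smooth_on_mult)

lemma smooth_on_sum: "(\<And>i. i \<in> I \<Longrightarrow> smooth_on A (f i)) \<Longrightarrow> smooth_on A (\<lambda>x. \<Sum>i\<in>I. f i x)"
  by (induction I rule: infinite_finite_induct) (auto intro: smooth_on_const smooth_on_add)

lemma smooth_on_Pair:
  assumes "smooth_on A f" "smooth_on A g"
  shows "smooth_on A (\<lambda>x. (f x, g x))"
proof -
  have "bounded_linear (\<lambda>x. (x, 0))" "bounded_linear (\<lambda>x. (0, x))"
    by (auto intro: bounded_linear_Pair)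
  then have "smooth_on A (\<lambda>x. (f x, 0) + (0, g x))"
    by (intro smooth_on_add) (auto intro: smooth_on_bounded_linear assms)
  then show ?thesis by simp
qed

lemma smooth_on_inverse:
  fixes f :: "'a::euclidean_space \<Rightarrow> real"
  assumes "smooth_on A f" "\<And>x. x \<in> A \<Longrightarrow> f x \<noteq> 0"
  shows "smooth_on A (\<lambda>x. inverse (f x))"
  by (rule smooth_on_unary[OF assms(1), of "- {0}" inverse]) (use assms(2) in \<open>auto intro!: Ck_on_inverse\<close>)

lemma smooth_on_divide:
  fixes f g :: "'a::euclidean_space \<Rightarrow> real"
  assumes "smooth_on A f" "smooth_on A g" "\<And>x. x \<in> A \<Longrightarrow> g x \<noteq> 0"
  shows "smooth_on A (\<lambda>x. f x / g x)"
  unfolding divide_inverse by (intro smooth_on_mult smooth_on_inverse assms)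

lemma smooth_on_sqrt:
  fixes f :: "'a::euclidean_space \<Rightarrow> real"
  assumes "smooth_on A f" "\<And>x. x \<in> A \<Longrightarrow> f x > 0"
  shows "smooth_on A (\<lambda>x. sqrt (f x))"
  by (rule smooth_on_unary[OF assms(1), of "{0<..}" sqrt]) (use assms(2) in \<open>auto intro!: Ck_on_sqrt\<close>)

lemma smooth_on_sin:
  fixes f :: "'a::euclidean_space \<Rightarrow> real"
  shows "smooth_on A f \<Longrightarrow> smooth_on A (\<lambda>x. sin (f x))"
  by (rule smooth_on_unary[of A f UNIV sin]) (use Ck_on_sin_cos in auto)

lemma smooth_on_cos:
  fixes f :: "'a::euclidean_space \<Rightarrow> real"
  shows "smooth_on A f \<Longrightarrow> smooth_on A (\<lambda>x. cos (f x))"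
  by (rule smooth_on_unary[of A f UNIV cos]) (use Ck_on_sin_cos in auto)

lemmas smooth_on_intros = smooth_on_const smooth_on_id smooth_on_add smooth_on_diff smooth_on_minus
  smooth_on_mult smooth_on_scaleR smooth_on_inner smooth_on_cross3 smooth_on_power smooth_on_sum
  smooth_on_Pair smooth_on_fst smooth_on_snd smooth_on_vec_nth smooth_on_Re smooth_on_Im
  smooth_on_divide smooth_on_sqrt smooth_on_sin smooth_on_cos

lemma smooth_on_has_derivative:
  assumes "open U" "x \<in> A" "x \<in> U" "Ck_on (Suc 0) U g" "\<And>y. y \<in> A \<Longrightarrow> y \<in> U \<Longrightarrow> g y = f y"
  shows "(f has_derivative frechet_derivative g (at x)) (at x within A)"
proof -
  have "(g has_derivative frechet_derivative g (at x)) (at x within A)"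
    using Ck_on_SucD[OF assms(4,3)] has_derivative_at_withinI by blast
  moreover obtain d where d: "d > 0" "ball x d \<subseteq> U" using assms(1,3) openE by blast
  ultimately show ?thesis
    using has_derivative_transform_within[OF _ d(1) assms(2)] assms(5)
    by (metis dist_commute mem_ball subset_iff)
qed

lemma smooth_on_imp_differentiable:
  assumes "smooth_on A f" "x \<in> A" shows "f differentiable (at x within A)"
proof -
  obtain U g where U: "open U" "x \<in> U" "\<forall>k. Ck_on k U g" "\<forall>y\<in>A \<inter> U. g y = f y"
    by (rule smooth_onE[OF assms])
  note U = U(1,2) U(3)[rule_format] U(4)[rule_format, OF IntI]
  show ?thesis
    using smooth_on_has_derivative[OF U(1) assms(2) U(2) U(3) U(4)] unfolding differentiable_def by blast
qed

lemma smooth_on_imp_continuous_on: "smooth_on A f \<Longrightarrow> continuous_on A f"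
  by (simp add: smooth_on_imp_differentiable differentiable_imp_continuous_within continuous_on_eq_continuous_within)

section \<open>Tangent maps and pushforwards\<close>

text \<open>The line \<open>p + t *\<^sub>R v\<close> is projected radially to the sphere. By
  orthogonality its length is \<open>r t\<close>, whose derivative at 0 vanishes, so the velocity
  remains \<open>v\<close>.\<close>

lemma sphere_curve:
  fixes p v :: "'a::euclidean_space"
  assumes "norm p = 1" "v \<bullet> p = 0"
  obtains \<gamma> :: "real \<Rightarrow> 'a" where "\<forall>t. norm (\<gamma> t) = 1" "\<gamma> 0 = p" "(\<gamma> has_derivative (\<lambda>t. t *\<^sub>R v)) (at 0)"
proof
  define r where "r = (\<lambda>t. sqrt (1 + t\<^sup>2 * (norm v)\<^sup>2))"
  have pos: "1 + t\<^sup>2 * (norm v)\<^sup>2 > 0" for t by (rule add_pos_nonneg) auto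
  have n: "norm (p + t *\<^sub>R v) = r t" for t
  proof -
    have "(norm (p + t *\<^sub>R v))\<^sup>2 = 1 + t\<^sup>2 * (norm v)\<^sup>2"
      using assms by (simp add: power2_norm_eq_inner inner_simps inner_commute[of p v] norm_eq_1)
        (simp add: power2_eq_square)
    then show ?thesis unfolding r_def using norm_ge_zero real_sqrt_unique by metis
  qed
  show "\<forall>t. norm ((1 / r t) *\<^sub>R (p + t *\<^sub>R v)) = 1"
    using pos[THEN less_imp_neq] n by (simp add: r_def)
  show "(1 / r 0) *\<^sub>R (p + 0 *\<^sub>R v) = p" by (simp add: r_def)
  show "((\<lambda>t. (1 / r t) *\<^sub>R (p + t *\<^sub>R v)) has_derivative (\<lambda>t. t *\<^sub>R v)) (at 0)"
    unfolding r_def by (auto intro!: derivative_eq_intros)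
qed

lemma tangent_curve:
  assumes "m \<in> S1xS2" "v \<in> tangent_space m"
  obtains \<gamma> :: "real \<Rightarrow> ambient" where "range \<gamma> \<subseteq> S1xS2" "\<gamma> 0 = m" "(\<gamma> has_derivative (\<lambda>t. t *\<^sub>R v)) (at 0)"
proof -
  have m: "norm (fst m) = 1" "norm (snd m) = 1" "fst v \<bullet> fst m = 0" "snd v \<bullet> snd m = 0"
    using assms by (auto simp: S1xS2_def tangent_space_def mem_Times_iff split_def)
  obtain g where g: "\<forall>t. norm (g t) = 1" "g 0 = fst m" "(g has_derivative (\<lambda>t. t *\<^sub>R fst v)) (at 0)"
    by (rule sphere_curve[OF m(1,3)])
  obtain h where h: "\<forall>t. norm (h t) = 1" "h 0 = snd m" "(h has_derivative (\<lambda>t. t *\<^sub>R snd v)) (at 0)"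
    by (rule sphere_curve[OF m(2,4)])
  show ?thesis
  proof
    show "range (\<lambda>t. (g t, h t)) \<subseteq> S1xS2" using g(1) h(1) by (auto simp: S1xS2_def)
    show "(g 0, h 0) = m" using g h by simp
    show "((\<lambda>t. (g t, h t)) has_derivative (\<lambda>t. t *\<^sub>R v)) (at 0)"
      using has_derivative_Pair[OF g(3) h(3)] by (simp add: scaleR_prod_def)
  qed
qed

text \<open>Composition with a curve in \<open>S1xS2\<close> of velocity \<open>v\<close> reduces
  this to uniqueness of derivatives in one real variable.\<close>

lemma tangent_derivative_unique:
  assumes "m \<in> S1xS2" "v \<in> tangent_space m"
    "(f has_derivative f1) (at m within S1xS2)" "(f has_derivative f2) (at m within S1xS2)"
  shows "f1 v = f2 v"
proof -
  obtain \<gamma> :: "real \<Rightarrow> ambient" where \<gamma>: "range \<gamma> \<subseteq> S1xS2" "\<gamma> 0 = m" "(\<gamma> has_derivative (\<lambda>t. t *\<^sub>R v)) (at 0)"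
    by (rule tangent_curve[OF assms(1,2)])
  have "((\<lambda>t. f (\<gamma> t)) has_derivative (\<lambda>t. f' (t *\<^sub>R v))) (at 0)"
    if "(f has_derivative f') (at m within S1xS2)" for f'
    using has_derivative_in_compose[OF \<gamma>(3), of f f'] has_derivative_subset[OF that \<gamma>(1)] \<gamma>(2) by simp
  from has_derivative_unique[OF this[OF assms(3)] this[OF assms(4)]] show ?thesis
    by (metis scaleR_one)
qed

text \<open>The rule by which tangent maps are computed: on tangent vectors the arbitrary choice
  behind \<open>tangent_map\<close> is invisible.\<close>

lemma tangent_map_eq:
  assumes "m \<in> S1xS2" "v \<in> tangent_space m" "(f has_derivative f') (at m within S1xS2)"
  shows "tangent_map f m v = f' v"
proof -
  have "f differentiable (at m within S1xS2)" using assms(3) unfolding differentiable_def by blast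
  then have "(f has_derivative frechet_derivative f (at m within S1xS2)) (at m within S1xS2)"
    by (rule frechet_derivative_works[THEN iffD1])
  then show ?thesis
    unfolding tangent_map_def by (rule tangent_derivative_unique[OF assms(1,2) _ assms(3)])
qed

lemma tangent_map_linear:
  assumes "smooth_on S1xS2 f" "m \<in> S1xS2"
  shows "bounded_linear (tangent_map f m)" "(f has_derivative tangent_map f m) (at m within S1xS2)"
proof -
  have "tangent_map f m = frechet_derivative f (at m within S1xS2)"
    by (simp add: tangent_map_def fun_eq_iff)
  with smooth_on_imp_differentiable[OF assms]
  show "(f has_derivative tangent_map f m) (at m within S1xS2)"
    by (metis frechet_derivative_works)
  then show "bounded_linear (tangent_map f m)" by (rule has_derivative_bounded_linear)
qed

text \<open>\<open>Ck_on\<close> controls derivatives in fixed directions only, so the varying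
  direction \<open>X m\<close> is expanded in \<open>Basis\<close>. The sum \<open>h\<close> is then
  the required local extension.\<close>

lemma smooth_on_lie_derivative:
  assumes "vector_field X" "smooth_on S1xS2 f"
  shows "smooth_on S1xS2 (lie_derivative X f)"
proof (rule smooth_onI)
  fix m assume m: "m \<in> S1xS2"
  obtain U g where U: "open U" "m \<in> U" "\<forall>k. Ck_on k U g" "\<forall>y\<in>S1xS2 \<inter> U. g y = f y"
    by (rule smooth_onE[OF assms(2) m])
  note U = U(1,2) U(3)[rule_format] U(4)[rule_format, OF IntI]
  have "smooth_on S1xS2 X" using assms(1) by (simp add: vector_field_def)
  then obtain V Y where V: "open V" "m \<in> V" "\<forall>k. Ck_on k V Y" "\<forall>y\<in>S1xS2 \<inter> V. Y y = X y"
    by (rule smooth_onE[OF _ m])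
  note V = V(1,2) V(3)[rule_format] V(4)[rule_format, OF IntI]
  define h where "h = (\<lambda>x. \<Sum>b\<in>Basis. (Y x \<bullet> b) * frechet_derivative g (at x) b)"
  have o: "open (U \<inter> V)" by (intro open_Int U V)
  have sum: "Ck_on k (U \<inter> V) (\<lambda>x. \<Sum>b\<in>B. q b x)" if "finite B" "\<And>b. Ck_on k (U \<inter> V) (q b)"
    for k and B :: "ambient set" and q :: "ambient \<Rightarrow> ambient \<Rightarrow> real"
    using that by (induction B rule: finite_induct) (simp_all add: Ck_on_const Ck_on_add o)
  have "Ck_on k (U \<inter> V) h" for k
    unfolding h_def
  proof (intro sum finite_Basis Ck_on_mult o)
    show "Ck_on k (U \<inter> V) (\<lambda>x. Y x \<bullet> b)" for b
      by (rule Ck_on_bounded_linear_comp[OF o bounded_linear_inner_left Ck_on_subset[OF V(3)]]) simp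
    show "Ck_on k (U \<inter> V) (\<lambda>x. frechet_derivative g (at x) b)" for b
      using Ck_on_subset[OF U(3)[of "Suc k"], of "U \<inter> V"] by (simp only: Ck_on.simps) blast
  qed
  moreover have "h y = lie_derivative X f y" if y: "y \<in> S1xS2" "y \<in> U" "y \<in> V" for y
  proof -
    have d: "(f has_derivative frechet_derivative g (at y)) (at y within S1xS2)"
      by (rule smooth_on_has_derivative[OF U(1) y(1,2) U(3) U(4)])
    have "lie_derivative X f y = frechet_derivative g (at y) (X y)"
      unfolding lie_derivative_def using assms(1) y by (intro tangent_map_eq d) (auto simp: vector_field_def)
    also have "\<dots> = frechet_derivative g (at y) (\<Sum>b\<in>Basis. (X y \<bullet> b) *\<^sub>R b)"
      by (simp add: euclidean_representation)
    also have "\<dots> = h y"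
      unfolding h_def V(4)[OF y(1,3)] using has_derivative_linear[OF d] by (simp add: linear_sum linear_cmul)
    finally show ?thesis by simp
  qed
  ultimately show "\<exists>U g. open U \<and> m \<in> U \<and> (\<forall>k. Ck_on k U g) \<and> (\<forall>y\<in>S1xS2 \<inter> U. g y = lie_derivative X f y)"
    by (intro exI[of _ "U \<inter> V"] exI[of _ h]) (simp add: o U V)
qed

text \<open>The formula for \<open>f\<close> is assumed on \<open>S1xS2\<close> only, which is the
  form in which the induction over iterated derivatives supplies it.\<close>

lemma lie_derivative_sum:
  assumes X: "vector_field X" and g: "\<And>i. i \<in> I \<Longrightarrow> smooth_on S1xS2 (g i)"
    and f: "\<And>m. m \<in> S1xS2 \<Longrightarrow> f m = (\<Sum>i\<in>I. c i * g i m)" and m: "m \<in> S1xS2"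
  shows "lie_derivative X f m = (\<Sum>i\<in>I. c i * lie_derivative X (g i) m)"
proof -
  have "((\<lambda>x. \<Sum>i\<in>I. c i * g i x) has_derivative (\<lambda>v. \<Sum>i\<in>I. c i * tangent_map (g i) m v)) (at m within S1xS2)"
    by (intro has_derivative_sum has_derivative_mult_right tangent_map_linear g m)
  then have "(f has_derivative (\<lambda>v. \<Sum>i\<in>I. c i * tangent_map (g i) m v)) (at m within S1xS2)"
    by (rule has_derivative_transform[OF m, rotated]) (simp add: f)
  from tangent_map_eq[OF m _ this] show ?thesis
    using X m by (simp add: lie_derivative_def vector_field_def)
qed

lemma smooth_on_iterated_lie:
  assumes "\<forall>X\<in>set Xs. vector_field X" "smooth_on S1xS2 f"
  shows "smooth_on S1xS2 (foldr lie_derivative Xs f)"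
  using assms by (induction Xs) (auto intro: smooth_on_lie_derivative)

lemma iterated_lie_sum:
  assumes "\<forall>X\<in>set Xs. vector_field X" and g: "\<And>i. i \<in> I \<Longrightarrow> smooth_on S1xS2 (g i)"
    and f: "\<And>m. m \<in> S1xS2 \<Longrightarrow> f m = (\<Sum>i\<in>I. c i * g i m)" and m: "m \<in> S1xS2"
  shows "foldr lie_derivative Xs f m = (\<Sum>i\<in>I. c i * foldr lie_derivative Xs (g i) m)"
  using assms(1) m
proof (induction Xs arbitrary: m)
  case Nil
  then show ?case by (simp add: f)
next
  case (Cons X Xs)
  have "lie_derivative X (foldr lie_derivative Xs f) m = (\<Sum>i\<in>I. c i * lie_derivative X (foldr lie_derivative Xs (g i)) m)"
    using Cons.prems by (intro lie_derivative_sum smooth_on_iterated_lie g Cons.IH) auto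
  then show ?case by simp
qed

text \<open>The squared norms of both components of \<open>F\<close> are constant on
  \<open>S1xS2\<close>, so their derivatives along tangent vectors vanish.\<close>

lemma tangent_map_in_tangent_space:
  assumes F: "smooth_on S1xS2 F" "F ` S1xS2 \<subseteq> S1xS2" and m: "m \<in> S1xS2" "v \<in> tangent_space m"
  shows "tangent_map F m v \<in> tangent_space (F m)"
proof -
  note d = tangent_map_linear(2)[OF F(1) m(1)]
  have one: "fst (F n) \<bullet> fst (F n) = 1" "snd (F n) \<bullet> snd (F n) = 1" if "n \<in> S1xS2" for n
    using F(2) that by (force simp: S1xS2_def norm_eq_1)+
  have "((\<lambda>n. fst (F n) \<bullet> fst (F n)) has_derivative (\<lambda>_. 0)) (at m within S1xS2)"
    "((\<lambda>n. snd (F n) \<bullet> snd (F n)) has_derivative (\<lambda>_. 0)) (at m within S1xS2)"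
    by (rule has_derivative_transform[OF m(1) _ has_derivative_const[of 1]], simp add: one)+
  note c = this
  have "((\<lambda>n. fst (F n) \<bullet> fst (F n)) has_derivative (\<lambda>v. 2 * (fst (tangent_map F m v) \<bullet> fst (F m)))) (at m within S1xS2)"
    "((\<lambda>n. snd (F n) \<bullet> snd (F n)) has_derivative (\<lambda>v. 2 * (snd (tangent_map F m v) \<bullet> snd (F m)))) (at m within S1xS2)"
    by (auto intro!: derivative_eq_intros d simp: inner_commute)
  from tangent_derivative_unique[OF m this(1) c(1)] tangent_derivative_unique[OF m this(2) c(2)]
  show ?thesis by (simp add: tangent_space_def split_def)
qed

text \<open>In the chain rule the derivative of \<open>g\<close> is taken in a direction that
  depends on the point; expansion in \<open>Basis\<close> leaves fixed directions, to which the
  induction hypothesis applies.\<close>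

lemma Ck_on_compose:
  fixes f :: "'a::euclidean_space \<Rightarrow> 'b::euclidean_space"
  assumes "open U" "open V" "f ` U \<subseteq> V" "Ck_on k U f" "Ck_on k V g"
  shows "Ck_on k U (\<lambda>x. g (f x))"
  using assms(4,5)
proof (induction k arbitrary: g)
  case 0
  then show ?case using continuous_on_compose2[OF _ _ assms(3)] by simp
next
  case (Suc k)
  have d: "((\<lambda>x. g (f x)) has_derivative
      (\<lambda>v. \<Sum>b\<in>Basis. (frechet_derivative f (at x) v \<bullet> b) *\<^sub>R frechet_derivative g (at (f x)) b)) (at x)"
    if x: "x \<in> U" for x
  proof -
    have fx: "f x \<in> V" using assms(3) x by blast
    note dg = Ck_on_SucD[OF Suc.prems(2) fx]
    have 1: "((\<lambda>x. g (f x)) has_derivative (\<lambda>v. frechet_derivative g (at (f x)) (frechet_derivative f (at x) v))) (at x)"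
      by (rule has_derivative_compose[OF Ck_on_SucD[OF Suc.prems(1) x] dg])
    have "frechet_derivative g (at (f x)) w = (\<Sum>b\<in>Basis. (w \<bullet> b) *\<^sub>R frechet_derivative g (at (f x)) b)" for w
      using linear_sum[OF has_derivative_linear[OF dg], of "\<lambda>b. (w \<bullet> b) *\<^sub>R b" Basis]
      by (simp add: euclidean_representation linear_cmul[OF has_derivative_linear[OF dg]])
    then have 2: "(\<lambda>v. frechet_derivative g (at (f x)) (frechet_derivative f (at x) v)) =
        (\<lambda>v. \<Sum>b\<in>Basis. (frechet_derivative f (at x) v \<bullet> b) *\<^sub>R frechet_derivative g (at (f x)) b)"
      by (rule ext)
    show ?thesis using 1 unfolding 2 .
  qed
  have sum: "Ck_on k U (\<lambda>x. \<Sum>b\<in>B. q b x)" if "finite B" "\<And>b. Ck_on k U (q b)"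
    for B :: "'b set" and q :: "'b \<Rightarrow> 'a \<Rightarrow> 'c"
    using that by (induction B rule: finite_induct) (simp_all add: Ck_on_const Ck_on_add assms(1))
  have Df: "Ck_on k U (\<lambda>x. frechet_derivative f (at x) v \<bullet> b)" for v b
    by (rule Ck_on_bounded_linear_comp[OF assms(1) bounded_linear_inner_left]) (use Suc.prems(1) in simp)
  have Dg: "Ck_on k U (\<lambda>x. frechet_derivative g (at (f x)) b)" for b
    by (rule Suc.IH[OF Ck_on_Suc_imp[OF Suc.prems(1)]]) (use Suc.prems(2) in simp)
  show ?case
    by (rule Ck_on_SucI[OF assms(1) d], assumption,
      rule sum[OF finite_Basis Ck_on_bounded_bilinear[OF assms(1) bounded_bilinear_scaleR Df Dg]])
qed

lemma smooth_on_compose: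
  fixes f :: "'a::euclidean_space \<Rightarrow> 'b::euclidean_space"
  assumes "smooth_on A f" "f ` A \<subseteq> B" "smooth_on B g"
  shows "smooth_on A (\<lambda>x. g (f x))"
proof (rule smooth_onI)
  fix x assume x: "x \<in> A"
  obtain U f' where U: "open U" "x \<in> U" "\<forall>k. Ck_on k U f'" "\<forall>y\<in>A \<inter> U. f' y = f y"
    by (rule smooth_onE[OF assms(1) x])
  note U = U(1,2) U(3)[rule_format] U(4)[rule_format, OF IntI]
  have "f x \<in> B" using assms(2) x by blast
  obtain V g' where V: "open V" "f x \<in> V" "\<forall>k. Ck_on k V g'" "\<forall>y\<in>B \<inter> V. g' y = g y"
    by (rule smooth_onE[OF assms(3) \<open>f x \<in> B\<close>])
  note V = V(1,2) V(3)[rule_format] V(4)[rule_format, OF IntI]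
  define W where "W = U \<inter> f' -` V"
  have W: "open W" unfolding W_def using U(3)[of 0] U(1) V(1)
    by (metis Ck_on.simps(1) continuous_open_preimage)
  have "Ck_on k W (\<lambda>x. g' (f' x))" for k
    by (rule Ck_on_compose[OF W V(1) _ Ck_on_subset[OF U(3)] V(3)]) (auto simp: W_def)
  moreover have "x \<in> W" using U(2) V(2) U(4)[OF x U(2)] by (simp add: W_def)
  moreover have "g' (f' y) = g (f y)" if "y \<in> A" "y \<in> W" for y
  proof -
    have "f' y = f y" using that U(4) by (simp add: W_def)
    moreover have "f' y \<in> V" using that(2) by (simp add: W_def)
    moreover have "f y \<in> B" using assms(2) that(1) by blast
    ultimately show ?thesis using V(4)[of "f y"] by simp
  qed
  ultimately show "\<exists>U h. open U \<and> x \<in> U \<and> (\<forall>k. Ck_on k U h) \<and> (\<forall>y\<in>A \<inter> U. h y = g (f y))"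
    by (intro exI[of _ W] exI[of _ "\<lambda>x. g' (f' x)"]) (simp add: W)
qed

lemma tangent_map_compose:
  assumes F: "smooth_on S1xS2 F" "F ` S1xS2 \<subseteq> S1xS2" and G: "smooth_on S1xS2 G"
    and m: "m \<in> S1xS2" "v \<in> tangent_space m"
  shows "tangent_map (\<lambda>n. G (F n)) m v = tangent_map G (F m) (tangent_map F m v)"
proof -
  have Fm: "F m \<in> S1xS2" using F(2) m(1) by blast
  have "((\<lambda>n. G (F n)) has_derivative (\<lambda>v. tangent_map G (F m) (tangent_map F m v))) (at m within S1xS2)"
    using has_derivative_in_compose[OF tangent_map_linear(2)[OF F(1) m(1)]
        has_derivative_subset[OF tangent_map_linear(2)[OF G Fm] F(2)]] .
  then show ?thesis by (rule tangent_map_eq[OF m])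
qed

lemma tangent_map_cong:
  assumes "smooth_on S1xS2 F" "\<And>n. n \<in> S1xS2 \<Longrightarrow> F n = G n" "m \<in> S1xS2" "v \<in> tangent_space m"
  shows "tangent_map F m v = tangent_map G m v"
proof -
  have "(G has_derivative tangent_map F m) (at m within S1xS2)"
    by (rule has_derivative_transform[OF assms(3) _ tangent_map_linear(2)[OF assms(1,3)]]) (simp add: assms(2))
  from tangent_map_eq[OF assms(3,4) this] show ?thesis by simp
qed

section \<open>Diffeomorphisms with a given inverse, and pushforwards of contact forms\<close>

definition inverse_diffeos :: "(ambient \<Rightarrow> ambient) \<Rightarrow> (ambient \<Rightarrow> ambient) \<Rightarrow> bool" where
  "inverse_diffeos F G \<longleftrightarrow> smooth_on S1xS2 F \<and> smooth_on S1xS2 G \<and> F ` S1xS2 \<subseteq> S1xS2 \<and> G ` S1xS2 \<subseteq> S1xS2 \<and>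
     (\<forall>m\<in>S1xS2. G (F m) = m \<and> F (G m) = m)"

lemma inverse_diffeosD:
  assumes "inverse_diffeos F G"
  shows "smooth_on S1xS2 F" "F ` S1xS2 \<subseteq> S1xS2" "m \<in> S1xS2 \<Longrightarrow> F m \<in> S1xS2" "m \<in> S1xS2 \<Longrightarrow> G (F m) = m"
    "inverse_diffeos G F"
  using assms by (auto simp: inverse_diffeos_def)

lemma inverse_diffeos_compose:
  assumes "inverse_diffeos F G" "inverse_diffeos F' G'"
  shows "inverse_diffeos (\<lambda>m. F' (F m)) (\<lambda>m. G (G' m))"
proof -
  note F = inverse_diffeosD[OF assms(1)] and F' = inverse_diffeosD[OF assms(2)]
  note G = inverse_diffeosD[OF F(5)] and G' = inverse_diffeosD[OF F'(5)]
  show ?thesis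
    unfolding inverse_diffeos_def
    using smooth_on_compose[OF F(1,2) F'(1)] smooth_on_compose[OF G'(1,2) G(1)]
    by (simp add: F(3,4) F'(3,4) G(3,4) G'(3,4) image_subset_iff)
qed

lemma inverse_diffeos_bij: "inverse_diffeos F G \<Longrightarrow> bij_betw F S1xS2 S1xS2"
  by (rule bij_betw_byWitness[where f'=G]) (auto simp: inverse_diffeos_def)

lemma inverse_diffeos_inv_into:
  assumes "inverse_diffeos F G" "m \<in> S1xS2" shows "inv_into S1xS2 F m = G m"
  using inverse_diffeos_bij[OF assms(1)] assms inverse_diffeosD(3,4)[OF inverse_diffeosD(5)[OF assms(1)]]
  by (intro inv_into_f_eq) (auto simp: bij_betw_def)

lemma inverse_diffeos_diffeomorphism:
  assumes "inverse_diffeos F G" shows "diffeomorphism F"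
  unfolding diffeomorphism_def
  using inverse_diffeos_bij[OF assms] inverse_diffeosD(1)[OF assms]
    smooth_on_cong[OF inverse_diffeosD(1)[OF inverse_diffeosD(5)[OF assms]], of "inv_into S1xS2 F"]
    inverse_diffeos_inv_into[OF assms] by simp

lemma inverse_diffeos_tangent:
  assumes "inverse_diffeos F G" "m \<in> S1xS2" "v \<in> tangent_space m"
  shows "tangent_map F m v \<in> tangent_space (F m)" "tangent_map G (F m) (tangent_map F m v) = v"
proof -
  note F = inverse_diffeosD[OF assms(1)]
  show "tangent_map F m v \<in> tangent_space (F m)"
    by (rule tangent_map_in_tangent_space[OF F(1,2) assms(2,3)])
  have "tangent_map G (F m) (tangent_map F m v) = tangent_map (\<lambda>n. G (F n)) m v"
    by (rule tangent_map_compose[OF F(1,2) inverse_diffeosD(1)[OF F(5)] assms(2,3), symmetric])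
  also have "\<dots> = tangent_map (\<lambda>n. n) m v"
    by (rule tangent_map_cong[OF smooth_on_id _ assms(2,3), symmetric]) (simp add: F(4))
  also have "\<dots> = v"
    by (rule tangent_map_eq[OF assms(2,3) has_derivative_ident])
  finally show "tangent_map G (F m) (tangent_map F m v) = v" .
qed

text \<open>The positive factor makes up for contact forms being determined only up to positive functions.\<close>

definition pushes :: "(ambient \<Rightarrow> ambient) \<Rightarrow> (ambient \<Rightarrow> ambient) \<Rightarrow> form \<Rightarrow> form \<Rightarrow> bool" where
  "pushes F G \<alpha> \<beta> \<longleftrightarrow> inverse_diffeos F G \<and>
     (\<forall>m\<in>S1xS2. \<exists>c>0. \<forall>v\<in>tangent_space m. \<beta> (F m) (tangent_map F m v) = c * \<alpha> m v)"

lemma pushes_pushforward: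
  assumes "pushes F G \<alpha> \<beta>"
  shows "pushforward F (cooriented_kernel \<alpha>) = cooriented_kernel \<beta>"
proof
  fix m
  have FG: "inverse_diffeos F G" using assms by (simp add: pushes_def)
  note GF = inverse_diffeosD(5)[OF FG]
  show "pushforward F (cooriented_kernel \<alpha>) m = cooriented_kernel \<beta> m"
  proof (cases "m \<in> S1xS2")
    case True
    define n where "n = G m"
    have n: "n \<in> S1xS2" "F n = m"
      using inverse_diffeosD(3,4)[OF GF True] by (simp_all add: n_def)
    obtain c where c: "c > 0" "\<And>v. v \<in> tangent_space n \<Longrightarrow> \<beta> m (tangent_map F n v) = c * \<alpha> n v"
      using assms n unfolding pushes_def by blast
    \<comment> \<open>\<open>P\<close> will be both \<open>x = 0\<close> and \<open>0 < x\<close>,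
      conditions that multiplication by the positive \<open>c\<close> preserves.\<close>
    have img: "tangent_map F n ` {v \<in> tangent_space n. P (\<alpha> n v)} = {v \<in> tangent_space m. P (\<beta> m v)}"
      if P: "\<And>x. P (c * x) \<longleftrightarrow> P x" for P :: "real \<Rightarrow> bool"
    proof (intro Set.set_eqI iffI)
      fix w assume "w \<in> tangent_map F n ` {v \<in> tangent_space n. P (\<alpha> n v)}"
      then show "w \<in> {v \<in> tangent_space m. P (\<beta> m v)}"
        using inverse_diffeos_tangent(1)[OF FG n(1)] c(2) P n(2) by auto
    next
      fix w assume w: "w \<in> {v \<in> tangent_space m. P (\<beta> m v)}"
      define v where "v = tangent_map G m w"
      have v: "v \<in> tangent_space n" "tangent_map F n v = w"
        using inverse_diffeos_tangent[OF GF True, of w] w unfolding v_def n_def by simp_all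
      then have "P (\<alpha> n v)" using w c(2)[OF v(1)] P by (metis (no_types, lifting) mem_Collect_eq)
      with v show "w \<in> tangent_map F n ` {v \<in> tangent_space n. P (\<alpha> n v)}" by (intro image_eqI[of _ _ v]) auto
    qed
    have "tangent_map F n ` {v \<in> tangent_space n. \<alpha> n v = 0} = {v \<in> tangent_space m. \<beta> m v = 0}"
      using img[of "\<lambda>x. x = 0"] c(1) by simp
    moreover have "tangent_map F n ` {v \<in> tangent_space n. 0 < \<alpha> n v} = {v \<in> tangent_space m. 0 < \<beta> m v}"
      using img[of "\<lambda>x. 0 < x"] c(1) by (simp add: zero_less_mult_iff)
    ultimately show ?thesis
      using True n(1) unfolding pushforward_def cooriented_kernel_def
      by (simp add: inverse_diffeos_inv_into[OF FG] n_def[symmetric] Let_def)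
  next
    case False
    then show ?thesis by (simp add: pushforward_def cooriented_kernel_def)
  qed
qed

lemma pushes_sym:
  assumes "pushes F G \<alpha> \<beta>" shows "pushes G F \<beta> \<alpha>"
  unfolding pushes_def
proof (intro conjI ballI)
  have FG: "inverse_diffeos F G" using assms by (simp add: pushes_def)
  then show GF: "inverse_diffeos G F" by (rule inverse_diffeosD(5))
  fix m assume m: "m \<in> S1xS2"
  define n where "n = G m"
  have n: "n \<in> S1xS2" "F n = m"
    using inverse_diffeosD(3,4)[OF GF m] by (simp_all add: n_def)
  obtain c where c: "c > 0" "\<And>v. v \<in> tangent_space n \<Longrightarrow> \<beta> m (tangent_map F n v) = c * \<alpha> n v"
    using assms n unfolding pushes_def by blast
  have "\<alpha> n (tangent_map G m w) = (1 / c) * \<beta> m w" if "w \<in> tangent_space m" for w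
    using inverse_diffeos_tangent[OF GF m that] c(2)[of "tangent_map G m w"] c(1) n_def by simp
  then show "\<exists>c>0. \<forall>v\<in>tangent_space m. \<alpha> (G m) (tangent_map G m v) = c * \<beta> m v"
    using c(1) by (intro exI[of _ "1 / c"]) (simp add: n_def)
qed

lemma pushes_trans:
  assumes "pushes F G \<alpha> \<beta>" "pushes F' G' \<beta> \<gamma>"
  shows "pushes (\<lambda>m. F' (F m)) (\<lambda>m. G (G' m)) \<alpha> \<gamma>"
  unfolding pushes_def
proof (intro conjI ballI)
  have FG: "inverse_diffeos F G" "inverse_diffeos F' G'" using assms by (simp_all add: pushes_def)
  show "inverse_diffeos (\<lambda>m. F' (F m)) (\<lambda>m. G (G' m))"
    by (rule inverse_diffeos_compose[OF FG])
  note F = inverse_diffeosD[OF FG(1)] and F' = inverse_diffeosD[OF FG(2)]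
  fix m assume m: "m \<in> S1xS2"
  obtain c where c: "c > 0" "\<And>v. v \<in> tangent_space m \<Longrightarrow> \<beta> (F m) (tangent_map F m v) = c * \<alpha> m v"
    using assms(1) m unfolding pushes_def by blast
  obtain d where d: "d > 0" "\<And>v. v \<in> tangent_space (F m) \<Longrightarrow>
      \<gamma> (F' (F m)) (tangent_map F' (F m) v) = d * \<beta> (F m) v"
    using assms(2) F(3)[OF m] unfolding pushes_def by blast
  have "\<gamma> (F' (F m)) (tangent_map (\<lambda>m. F' (F m)) m v) = d * c * \<alpha> m v" if v: "v \<in> tangent_space m" for v
    using tangent_map_compose[OF F(1,2) F'(1) m v] d(2) c(2)[OF v] inverse_diffeos_tangent(1)[OF FG(1) m v] by simp
  then show "\<exists>c>0. \<forall>v\<in>tangent_space m. \<gamma> (F' (F m)) (tangent_map (\<lambda>m. F' (F m)) m v) = c * \<alpha> m v"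
    using c(1) d(1) by (intro exI[of _ "d * c"]) simp
qed

lemma pushes_pullback:
  assumes "inverse_diffeos F G" "\<And>m v. m \<in> S1xS2 \<Longrightarrow> v \<in> tangent_space m \<Longrightarrow> \<beta> m v = \<alpha> (G m) (tangent_map G m v)"
  shows "pushes F G \<alpha> \<beta>"
  unfolding pushes_def
proof (intro conjI ballI assms(1) exI[of _ 1])
  fix m v assume m: "m \<in> S1xS2" "v \<in> tangent_space m"
  show "\<beta> (F m) (tangent_map F m v) = 1 * \<alpha> m v"
    using assms(2)[OF inverse_diffeosD(3)[OF assms(1) m(1)] inverse_diffeos_tangent(1)[OF assms(1) m]]
      inverse_diffeos_tangent(2)[OF assms(1) m] inverse_diffeosD(4)[OF assms(1) m(1)] by simp
qed simp

section \<open>The topology on contact structures\<close>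

text \<open>Families of functions for which Lie derivatives in \<open>m\<close> act on the second factors only, so that all the
  seminorms depend continuously on the parameter \<open>q\<close>.\<close>

inductive separated :: "'q::metric_space set \<Rightarrow> ('q \<Rightarrow> ambient \<Rightarrow> real) \<Rightarrow> bool" for Q where
  separated_base: "continuous_on Q c \<Longrightarrow> smooth_on S1xS2 g \<Longrightarrow> separated Q (\<lambda>q m. c q * g m)"
| separated_add: "separated Q f \<Longrightarrow> separated Q g \<Longrightarrow> separated Q (\<lambda>q m. f q m + g q m)"

lemma separated_param: "continuous_on Q c \<Longrightarrow> separated Q (\<lambda>q m. c q)"
  using separated_base[OF _ smooth_on_const[of S1xS2 1]] by simp

lemma separated_smooth: "smooth_on S1xS2 g \<Longrightarrow> separated Q (\<lambda>q m. g m)"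
  using separated_base[OF continuous_on_const[of Q 1]] by simp

lemma separated_mult:
  assumes "separated Q f" "separated Q g"
  shows "separated Q (\<lambda>q m. f q m * g q m)"
  using assms(1)
proof induction
  case (separated_base c h)
  from assms(2) show ?case
  proof induction
    case (separated_base c' h')
    have "separated Q (\<lambda>q m. (c q * c' q) * (h m * h' m))"
      using separated.separated_base[OF continuous_on_mult[OF \<open>continuous_on Q c\<close> separated_base(1)]
          smooth_on_mult[OF \<open>smooth_on S1xS2 h\<close> separated_base(2)]] .
    then show ?case by (simp add: mult_ac)
  next
    case (separated_add f g)
    from separated.separated_add[OF separated_add.IH] show ?case by (simp add: algebra_simps)
  qed
next
  case (separated_add f g')
  from separated.separated_add[OF separated_add.IH] show ?case by (simp add: algebra_simps)
qed

lemma separated_minus: "separated Q f \<Longrightarrow> separated Q (\<lambda>q m. - f q m)"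
  using separated_mult[OF separated_param[OF continuous_on_const[of Q "-1"]], of f] by simp

lemma separated_diff: "separated Q f \<Longrightarrow> separated Q g \<Longrightarrow> separated Q (\<lambda>q m. f q m - g q m)"
  using separated_add[OF _ separated_minus, of Q f g] by simp

lemma separated_iterated:
  assumes "separated Q f" "\<forall>X\<in>set Xs. vector_field X"
  shows "(\<forall>q. smooth_on S1xS2 (f q)) \<and> continuous_on (S1xS2 \<times> Q) (\<lambda>(m, q). foldr lie_derivative Xs (f q) m)"
  using assms(1)
proof induction
  case (separated_base c g)
  have sm: "smooth_on S1xS2 (\<lambda>m. c q * g m)" for q
    using separated_base(2) by (intro smooth_on_mult smooth_on_const)
  have "foldr lie_derivative Xs (\<lambda>m. c q * g m) m = c q * foldr lie_derivative Xs g m" if "m \<in> S1xS2" for q m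
    using iterated_lie_sum[OF assms(2), of "{0::nat}" "\<lambda>_. g" _ "\<lambda>_. c q", OF separated_base(2) _ that] by simp
  moreover have "continuous_on (S1xS2 \<times> Q) (\<lambda>x. c (snd x) * foldr lie_derivative Xs g (fst x))"
    using smooth_on_imp_continuous_on[OF smooth_on_iterated_lie[OF assms(2) separated_base(2)]] separated_base(1)
    by (intro continuous_on_mult) (auto intro!: continuous_on_compose2[of _ _ _ fst] continuous_on_compose2[of _ _ _ snd]
         continuous_on_fst continuous_on_snd continuous_on_id)
  ultimately have "continuous_on (S1xS2 \<times> Q) (\<lambda>(m, q). foldr lie_derivative Xs (\<lambda>m. c q * g m) m)"
    by (subst continuous_on_cong[OF refl, of _ _ "\<lambda>x. c (snd x) * foldr lie_derivative Xs g (fst x)"]) auto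
  with sm show ?case by blast
next
  case (separated_add f g)
  have sm: "smooth_on S1xS2 (f q)" "smooth_on S1xS2 (g q)" for q using separated_add.IH by blast+
  have "foldr lie_derivative Xs (\<lambda>m. f q m + g q m) m = foldr lie_derivative Xs (f q) m + foldr lie_derivative Xs (g q) m"
    if "m \<in> S1xS2" for q m
    using iterated_lie_sum[OF assms(2), of "{True, False}" "\<lambda>b. if b then f q else g q" _ "\<lambda>_. 1", OF _ _ that]
    by (simp add: sm)
  moreover have "continuous_on (S1xS2 \<times> Q) (\<lambda>x. (case x of (m, q) \<Rightarrow> foldr lie_derivative Xs (f q) m) +
      (case x of (m, q) \<Rightarrow> foldr lie_derivative Xs (g q) m))"
    using separated_add.IH by (intro continuous_on_add) blast+
  ultimately have "continuous_on (S1xS2 \<times> Q) (\<lambda>(m, q). foldr lie_derivative Xs (\<lambda>m. f q m + g q m) m)"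
    by (subst continuous_on_cong[OF refl, of _ _ "\<lambda>x. (case x of (m, q) \<Rightarrow> foldr lie_derivative Xs (f q) m) +
      (case x of (m, q) \<Rightarrow> foldr lie_derivative Xs (g q) m)"]) auto
  with sm show ?case by (blast intro: smooth_on_add)
qed

section \<open>Continuity of maps to the space of contact structures\<close>

lemma compact_S1xS2: "compact S1xS2"
  unfolding S1xS2_def by (intro compact_Times compact_sphere)

lemma smooth_on_form_field:
  assumes "one_form \<alpha>" "smooth_on S1xS2 Y"
  shows "smooth_on S1xS2 (\<lambda>m. \<alpha> m (Y m))"
proof (rule smooth_on_cong)
  show "smooth_on S1xS2 (\<lambda>m. \<Sum>b\<in>Basis. (Y m \<bullet> b) * \<alpha> m b)"
    using assms by (intro smooth_on_intros) (auto simp: one_form_def simp del: split_paired_All)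
  fix m :: ambient assume "m \<in> S1xS2"
  then have lin: "linear (\<alpha> m)" using assms(1) by (simp add: one_form_def)
  have "\<alpha> m (Y m) = \<alpha> m (\<Sum>b\<in>Basis. (Y m \<bullet> b) *\<^sub>R b)" by (simp add: euclidean_representation)
  then show "(\<Sum>b\<in>Basis. (Y m \<bullet> b) * \<alpha> m b) = \<alpha> m (Y m)"
    by (simp add: linear_sum[OF lin] linear_cmul[OF lin])
qed

text \<open>Every one-form lies in a subbasic set around itself, for instance that of the zero field
  and no Lie derivatives.\<close>

lemma topspace_smooth_topology: "topspace smooth_topology = {\<alpha>. one_form \<alpha>}"
proof (intro subset_antisym subsetI)
  fix \<alpha> :: form assume "\<alpha> \<in> {\<alpha>. one_form \<alpha>}"
  then have \<alpha>: "one_form \<alpha>" by simp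
  have zero: "vector_field (\<lambda>_. 0)"
    by (simp add: vector_field_def smooth_on_const tangent_space_def zero_prod_def)
  let ?B = "{\<beta>. one_form \<beta> \<and> (\<forall>m\<in>S1xS2. \<bar>iterated_derivative [] (\<lambda>_. 0) \<beta> m
      - iterated_derivative [] (\<lambda>_. 0) \<alpha> m\<bar> < (1::real))}"
  have "?B \<in> {{\<beta>. one_form \<beta> \<and>
          (\<forall>m\<in>S1xS2. \<bar>iterated_derivative Xs Y \<beta> m - iterated_derivative Xs Y \<alpha> m\<bar> < e)}
      | Xs Y \<alpha> e. (\<forall>X\<in>set Xs. vector_field X) \<and> vector_field Y \<and> one_form \<alpha> \<and> e > 0}"
    by (rule CollectI, rule exI[of _ "[]"], rule exI[of _ "\<lambda>_. 0"], rule exI[of _ \<alpha>], rule exI[of _ 1])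
      (simp add: \<alpha> zero)
  moreover have "\<alpha> \<in> ?B" using \<alpha> by simp
  ultimately show "\<alpha> \<in> topspace smooth_topology"
    unfolding smooth_topology_def topology_generated_by_topspace by blast
qed (auto simp: smooth_topology_def)

text \<open>The parameters that violate a subbasic bound form the projection of a closed subset of
  \<open>S1xS2 \<times> Q\<close> along the compact factor, which is closed. So joint continuity
  yields bounds uniform in \<open>m\<close>.\<close>

lemma continuous_map_smooth_topology:
  fixes Q :: "'q::euclidean_space set"
  assumes "\<And>q. q \<in> Q \<Longrightarrow> one_form (\<beta> q)"
    "\<And>Y. vector_field Y \<Longrightarrow> separated Q (\<lambda>q m. \<beta> q m (Y m))"
  shows "continuous_map (top_of_set Q) smooth_topology \<beta>"
  unfolding smooth_topology_def
proof (rule continuous_on_generated_topo)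
  show "\<beta> ` topspace (top_of_set Q) \<subseteq> \<Union> {{\<beta>. one_form \<beta> \<and>
          (\<forall>m\<in>S1xS2. \<bar>iterated_derivative Xs Y \<beta> m - iterated_derivative Xs Y \<alpha> m\<bar> < e)}
      | Xs Y \<alpha> e. (\<forall>X\<in>set Xs. vector_field X) \<and> vector_field Y \<and> one_form \<alpha> \<and> e > 0}"
  proof
    fix \<gamma> assume "\<gamma> \<in> \<beta> ` topspace (top_of_set Q)"
    then have "one_form \<gamma>" using assms(1) by auto
    then show "\<gamma> \<in> \<Union> {{\<beta>. one_form \<beta> \<and>
          (\<forall>m\<in>S1xS2. \<bar>iterated_derivative Xs Y \<beta> m - iterated_derivative Xs Y \<alpha> m\<bar> < e)}
      | Xs Y \<alpha> e. (\<forall>X\<in>set Xs. vector_field X) \<and> vector_field Y \<and> one_form \<alpha> \<and> e > 0}"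
      using topspace_smooth_topology by (simp add: smooth_topology_def)
  qed
  fix \<U> assume "\<U> \<in> {{\<beta>. one_form \<beta> \<and>
          (\<forall>m\<in>S1xS2. \<bar>iterated_derivative Xs Y \<beta> m - iterated_derivative Xs Y \<alpha> m\<bar> < e)}
      | Xs Y \<alpha> e. (\<forall>X\<in>set Xs. vector_field X) \<and> vector_field Y \<and> one_form \<alpha> \<and> e > 0}"
  then obtain Xs Y \<alpha> e where U: "\<U> = {\<beta>. one_form \<beta> \<and>
          (\<forall>m\<in>S1xS2. \<bar>iterated_derivative Xs Y \<beta> m - iterated_derivative Xs Y \<alpha> m\<bar> < e)}"
     "\<forall>X\<in>set Xs. vector_field X" "vector_field Y" "one_form \<alpha>" "e > (0::real)"
    by blast
  have Y: "smooth_on S1xS2 Y" using U(3) by (simp add: vector_field_def)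
  define I where "I = (\<lambda>q m. iterated_derivative Xs Y (\<beta> q) m)"
  define A where "A = iterated_derivative Xs Y \<alpha>"
  have I: "continuous_on (S1xS2 \<times> Q) (\<lambda>(m, q). I q m)"
    using separated_iterated[OF assms(2)[OF U(3)] U(2)] by (simp add: I_def iterated_derivative_def)
  have "continuous_on S1xS2 A"
    unfolding A_def iterated_derivative_def
    by (intro smooth_on_imp_continuous_on smooth_on_iterated_lie U(2) smooth_on_form_field U(4) Y)
  then have "continuous_on (S1xS2 \<times> Q) (\<lambda>x. A (fst x))"
    by (intro continuous_on_compose2[of S1xS2 A _ fst] continuous_on_fst continuous_on_id) auto
  with I have "continuous_on (S1xS2 \<times> Q) (\<lambda>x. \<bar>(case x of (m, q) \<Rightarrow> I q m) - A (fst x)\<bar>)"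
    by (intro continuous_on_rabs continuous_on_diff)
  then have "closedin (top_of_set (S1xS2 \<times> Q)) ((S1xS2 \<times> Q) \<inter>
      (\<lambda>x. \<bar>(case x of (m, q) \<Rightarrow> I q m) - A (fst x)\<bar>) -` {e..})"
    by (rule continuous_closedin_preimage) simp
  from closedin_compact_projection[OF compact_S1xS2 this]
  have "closedin (top_of_set Q) {q \<in> Q. \<exists>m\<in>S1xS2. e \<le> \<bar>I q m - A m\<bar>}"
    by (rule back_subst[of "closedin (top_of_set Q)"]) auto
  then have "openin (top_of_set Q) (Q - {q \<in> Q. \<exists>m\<in>S1xS2. e \<le> \<bar>I q m - A m\<bar>})"
    using openin_diff[OF openin_subtopology_self] by blast
  moreover have "Q - {q \<in> Q. \<exists>m\<in>S1xS2. e \<le> \<bar>I q m - A m\<bar>} = \<beta> -` \<U> \<inter> topspace (top_of_set Q)"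
    using assms(1) unfolding U(1) I_def A_def by (auto simp: not_le)
  ultimately show "openin (top_of_set Q) (\<beta> -` \<U> \<inter> topspace (top_of_set Q))" by simp
qed

lemma topspace_contact_structures: "topspace contact_structures = cooriented_kernel ` contact_forms"
proof -
  have "openin contact_structures (cooriented_kernel ` contact_forms)"
  proof -
    have "{\<alpha> \<in> contact_forms. cooriented_kernel \<alpha> \<in> cooriented_kernel ` contact_forms} = contact_forms" by blast
    moreover have "contact_forms \<subseteq> topspace smooth_topology"
      by (auto simp: topspace_smooth_topology contact_forms_def)
    ultimately show ?thesis
      unfolding openin_contact_structures by (simp add: openin_subtopology_refl)
  qed
  moreover have "topspace contact_structures \<subseteq> cooriented_kernel ` contact_forms"
    using openin_topspace[of contact_structures] unfolding openin_contact_structures by blast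
  ultimately show ?thesis using openin_subset by blast
qed

lemma continuous_map_cooriented_kernel:
  "continuous_map (subtopology smooth_topology contact_forms) contact_structures cooriented_kernel"
  unfolding continuous_map_def
proof (intro conjI allI impI)
  show "cooriented_kernel \<in> topspace (subtopology smooth_topology contact_forms) \<rightarrow> topspace contact_structures"
    by (auto simp: topspace_contact_structures)
  fix U assume U: "openin contact_structures U"
  have "{x \<in> topspace (subtopology smooth_topology contact_forms). cooriented_kernel x \<in> U} =
      {\<alpha> \<in> contact_forms. cooriented_kernel \<alpha> \<in> U}"
    by (auto simp: topspace_smooth_topology contact_forms_def)
  then show "openin (subtopology smooth_topology contact_forms)
      {x \<in> topspace (subtopology smooth_topology contact_forms). cooriented_kernel x \<in> U}"
    using U unfolding openin_contact_structures by simp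
qed

lemma continuous_map_contact_space:
  fixes Q :: "'q::euclidean_space set"
  assumes "\<And>q. q \<in> Q \<Longrightarrow> \<beta> q \<in> contact_forms" "\<And>q. q \<in> Q \<Longrightarrow> isotopic \<eta> (cooriented_kernel (\<beta> q))"
    "\<And>Y. vector_field Y \<Longrightarrow> separated Q (\<lambda>q m. \<beta> q m (Y m))"
  shows "continuous_map (top_of_set Q) (contact_space \<eta>) (\<lambda>q. cooriented_kernel (\<beta> q))"
proof -
  have "continuous_map (top_of_set Q) (subtopology smooth_topology contact_forms) \<beta>"
    using continuous_map_smooth_topology[of Q \<beta>] assms(1,3)
    by (auto simp: continuous_map_in_subtopology contact_forms_def)
  from continuous_map_compose[OF this continuous_map_cooriented_kernel] assms(2)
  show ?thesis unfolding contact_space_def by (auto simp: continuous_map_in_subtopology o_def)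
qed

text \<open>The seminorm without Lie derivatives bounds the difference at every point, in particular
  at \<open>m\<close>. The seminorms use global fields, hence \<open>Y\<close> in place of a single
  vector.\<close>

lemma continuous_map_form_eval:
  assumes m: "m \<in> S1xS2" and Y: "vector_field Y"
  shows "continuous_map smooth_topology euclidean (\<lambda>\<alpha>. \<alpha> m (Y m))"
  unfolding continuous_map_def
proof (intro conjI allI impI)
  fix U :: "real set" assume "openin euclidean U"
  then have U: "open U" by simp
  show "openin smooth_topology {\<alpha> \<in> topspace smooth_topology. \<alpha> m (Y m) \<in> U}"
  proof (subst openin_subopen, intro ballI)
    fix \<alpha> assume "\<alpha> \<in> {\<alpha> \<in> topspace smooth_topology. \<alpha> m (Y m) \<in> U}"
    then have \<alpha>: "one_form \<alpha>" "\<alpha> m (Y m) \<in> U" by (auto simp: topspace_smooth_topology)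
    then obtain e where e: "e > 0" "ball (\<alpha> m (Y m)) e \<subseteq> U" using U openE by blast
    define B where "B = {\<beta>. one_form \<beta> \<and>
      (\<forall>m\<in>S1xS2. \<bar>iterated_derivative [] Y \<beta> m - iterated_derivative [] Y \<alpha> m\<bar> < e)}"
    have "B \<in> {{\<beta>. one_form \<beta> \<and>
          (\<forall>m\<in>S1xS2. \<bar>iterated_derivative Xs Y \<beta> m - iterated_derivative Xs Y \<alpha> m\<bar> < e)}
      | Xs Y \<alpha> e. (\<forall>X\<in>set Xs. vector_field X) \<and> vector_field Y \<and> one_form \<alpha> \<and> e > 0}"
      by (rule CollectI, rule exI[of _ "[]"], rule exI[of _ Y], rule exI[of _ \<alpha>], rule exI[of _ e])
        (simp add: \<alpha> Y e B_def)
    then have "openin smooth_topology B"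
      unfolding smooth_topology_def by (rule topology_generated_by_Basis)
    moreover have "\<alpha> \<in> B" using \<alpha> e by (simp add: B_def)
    moreover have "B \<subseteq> {\<alpha> \<in> topspace smooth_topology. \<alpha> m (Y m) \<in> U}"
    proof
      fix \<beta> assume \<beta>: "\<beta> \<in> B"
      then have "\<bar>\<beta> m (Y m) - \<alpha> m (Y m)\<bar> < e"
        using m by (simp add: B_def iterated_derivative_def)
      then have "\<beta> m (Y m) \<in> U" using e(2) by (auto simp: dist_real_def abs_minus_commute)
      with \<beta> show "\<beta> \<in> {\<alpha> \<in> topspace smooth_topology. \<alpha> m (Y m) \<in> U}"
        by (simp add: topspace_smooth_topology B_def)
    qed
    ultimately show "\<exists>T. openin smooth_topology T \<and> \<alpha> \<in> T \<and> T \<subseteq> {\<alpha> \<in> topspace smooth_topology. \<alpha> m (Y m) \<in> U}"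
      by blast
  qed
qed auto

text \<open>The tangent frame at \<open>ev_point\<close> is chosen such that the evaluation of \<open>S_sphere q\<close> is \<open>q\<close>.\<close>

definition ev_point :: ambient where
  "ev_point = (1, vector [0, 0, 1])"

definition ev_vec :: "form \<Rightarrow> real^3" where
  "ev_vec \<alpha> = vector [\<alpha> ev_point (\<i>, 0), \<alpha> ev_point (0, vector [0, -1, 0]), \<alpha> ev_point (0, vector [1, 0, 0])]"

definition ev_form :: "form \<Rightarrow> real^3" where
  "ev_form \<alpha> = (1 / norm (ev_vec \<alpha>)) *\<^sub>R ev_vec \<alpha>"

text \<open>Some contact form of the structure is chosen; by \<open>ev_form_kernel\<close> the
  normalised vector does not depend on it.\<close>

definition ev_plane :: "plane_field \<Rightarrow> real^3" where
  "ev_plane \<eta> = ev_form (SOME \<alpha>. \<alpha> \<in> contact_forms \<and> cooriented_kernel \<alpha> = \<eta>)"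

section \<open>Evaluation at one point\<close>

lemma ev_point: "ev_point \<in> S1xS2"
  by (simp add: ev_point_def S1xS2_def norm_vec3)

text \<open>The tangent vector with coordinates \<open>x\<close> in the frame of
  \<open>ev_vec\<close>, so that a form acts on it as the inner product with its
  \<open>ev_vec\<close>.\<close>

definition ev_dir :: "real^3 \<Rightarrow> ambient" where
  "ev_dir x = (x $ 1 *\<^sub>R \<i>, vector [x $ 3, - (x $ 2), 0])"

lemma ev_dir_tangent: "ev_dir x \<in> tangent_space ev_point"
  by (simp add: tangent_space_def ev_dir_def ev_point_def inner_vec_def sum_3)

lemma tangent_ev_dir:
  assumes "v \<in> tangent_space ev_point" obtains x where "v = ev_dir x"
proof
  show "v = ev_dir (vector [Im (fst v), - (snd v $ 2), snd v $ 1])"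
    using assms by (auto simp: tangent_space_def ev_dir_def ev_point_def inner_vec_def sum_3 complex_eq_iff
        vec_eq_iff forall_3 prod_eq_iff split_def inner_complex_def)
qed

lemma form_ev_dir:
  assumes "linear (\<alpha> ev_point)" shows "\<alpha> ev_point (ev_dir x) = ev_vec \<alpha> \<bullet> x"
proof -
  have "ev_dir x = x $ 1 *\<^sub>R (\<i>, 0) + x $ 2 *\<^sub>R (0, vector [0, -1, 0]) + x $ 3 *\<^sub>R (0, vector [1, 0, 0])"
    by (auto simp: ev_dir_def prod_eq_iff vec_eq_iff forall_3)
  then have "\<alpha> ev_point (ev_dir x) = x $ 1 * \<alpha> ev_point (\<i>, 0) + x $ 2 * \<alpha> ev_point (0, vector [0, -1, 0])
      + x $ 3 * \<alpha> ev_point (0, vector [1, 0, 0])"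
    using assms by (simp only: linear_add linear_cmul real_scaleR_def)
  then show ?thesis by (simp add: ev_vec_def inner_vec_def sum_3 mult.commute)
qed

lemma contact_form_linear: "\<alpha> \<in> contact_forms \<Longrightarrow> m \<in> S1xS2 \<Longrightarrow> linear (\<alpha> m)"
  by (simp add: contact_forms_def one_form_def)

text \<open>Where a form vanishes on the tangent space, every term of the wedge has a zero factor,
  against the contact condition.\<close>

lemma ev_vec_nonzero:
  assumes "\<alpha> \<in> contact_forms" shows "ev_vec \<alpha> \<noteq> 0"
proof
  assume 0: "ev_vec \<alpha> = 0"
  have "\<alpha> ev_point v = 0" if v: "v \<in> tangent_space ev_point" for v
  proof -
    obtain x where "v = ev_dir x" by (rule tangent_ev_dir[OF v])
    then show ?thesis using form_ev_dir[of \<alpha>, OF contact_form_linear[OF assms ev_point]] 0 by simp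
  qed
  then have "form_wedge_d \<alpha> ev_point u v w = 0" if "u \<in> tangent_space ev_point" "v \<in> tangent_space ev_point"
     "w \<in> tangent_space ev_point" for u v w
    using that by (simp add: form_wedge_d_def)
  then show False using assms ev_point unfolding contact_forms_def by blast
qed

text \<open>Tested at \<open>x = a - b\<close>: if the vectors differ, \<open>a\<close> gives 1 - a
  . b > 0 while \<open>b\<close> gives a . b - 1 < 0.\<close>

lemma unit_vectors_eq:
  fixes a b :: "'a::real_inner"
  assumes "norm a = 1" "norm b = 1" "\<And>x. a \<bullet> x > 0 \<Longrightarrow> b \<bullet> x > 0"
  shows "a = b"
proof (rule ccontr)
  assume "a \<noteq> b"
  have aa: "a \<bullet> a = 1" "b \<bullet> b = 1" using assms by (simp_all add: norm_eq_1)
  have "(a - b) \<bullet> (a - b) > 0" using \<open>a \<noteq> b\<close> by simp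
  then have lt: "a \<bullet> b < 1" using aa by (simp add: inner_simps inner_commute)
  then have "a \<bullet> (a - b) > 0" using aa by (simp add: inner_simps)
  from assms(3)[OF this] lt aa show False by (simp add: inner_simps inner_commute)
qed

text \<open>In frame coordinates the positive side at \<open>ev_point\<close> is an open half-space,
  and this determines its unit normal.\<close>

lemma ev_form_kernel:
  assumes "\<alpha> \<in> contact_forms" "\<beta> \<in> contact_forms" "cooriented_kernel \<alpha> = cooriented_kernel \<beta>"
  shows "ev_form \<alpha> = ev_form \<beta>"
proof (rule unit_vectors_eq)
  show "norm (ev_form \<alpha>) = 1" "norm (ev_form \<beta>) = 1"
    using ev_vec_nonzero assms by (simp_all add: ev_form_def)
  fix x assume x: "ev_form \<alpha> \<bullet> x > 0"
  have "{v \<in> tangent_space ev_point. \<alpha> ev_point v > 0} = {v \<in> tangent_space ev_point. \<beta> ev_point v > 0}"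
    using fun_cong[OF assms(3), of ev_point] ev_point by (simp add: cooriented_kernel_def)
  then have "\<alpha> ev_point (ev_dir x) > 0 \<longleftrightarrow> \<beta> ev_point (ev_dir x) > 0"
    using ev_dir_tangent[of x] by blast
  then show "ev_form \<beta> \<bullet> x > 0"
    using x ev_vec_nonzero[OF assms(1)] ev_vec_nonzero[OF assms(2)]
    by (simp add: ev_form_def form_ev_dir[of \<alpha>, OF contact_form_linear[OF assms(1) ev_point]]
        form_ev_dir[of \<beta>, OF contact_form_linear[OF assms(2) ev_point]] zero_less_divide_iff)
qed

lemma ev_plane_kernel:
  assumes "\<alpha> \<in> contact_forms" shows "ev_plane (cooriented_kernel \<alpha>) = ev_form \<alpha>"
proof -
  have "(SOME \<beta>. \<beta> \<in> contact_forms \<and> cooriented_kernel \<beta> = cooriented_kernel \<alpha>) \<in> contact_forms \<and>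
    cooriented_kernel (SOME \<beta>. \<beta> \<in> contact_forms \<and> cooriented_kernel \<beta> = cooriented_kernel \<alpha>) = cooriented_kernel \<alpha>"
    by (rule someI[of _ \<alpha>]) (simp add: assms)
  then show ?thesis unfolding ev_plane_def using ev_form_kernel assms by blast
qed

lemma continuous_map_ev_form:
  "continuous_map (subtopology smooth_topology contact_forms) (top_of_set (sphere 0 1)) ev_form"
proof -
  let ?X = "subtopology smooth_topology contact_forms"
  \<comment> \<open>The rotation fields of the circle and of the sphere extend the frame at
    \<open>ev_point\<close> to global vector fields.\<close>
  have Y1: "vector_field (\<lambda>m. (\<i> * fst m, 0))"
    unfolding vector_field_def tangent_space_def
    by (auto simp: inner_complex_def
        intro!: smooth_on_Pair smooth_on_const smooth_on_bounded_linear[OF bounded_linear_mult_right] smooth_on_fst smooth_on_id)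
  have Y2: "vector_field (\<lambda>m. (0, cross3 k (snd m)))" for k
    unfolding vector_field_def tangent_space_def
    by (auto simp: inner_commute dot_cross_self
        intro!: smooth_on_Pair smooth_on_const smooth_on_cross3 smooth_on_snd smooth_on_id)
  have e: "(\<i> * fst ev_point, 0) = (\<i>, 0 :: real^3)"
     "cross3 (vector [1, 0, 0]) (snd ev_point) = vector [0, -1, 0]"
     "cross3 (vector [0, 1, 0]) (snd ev_point) = vector [1, 0, 0]"
    by (simp_all add: ev_point_def cross3_def)
  have 1: "continuous_map ?X euclidean (\<lambda>\<alpha>. \<alpha> ev_point (\<i>, 0))"
    using continuous_map_from_subtopology[OF continuous_map_form_eval[OF ev_point Y1]] unfolding e .
  have 2: "continuous_map ?X euclidean (\<lambda>\<alpha>. \<alpha> ev_point (0, vector [0, -1, 0]))"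
    using continuous_map_from_subtopology[OF continuous_map_form_eval[OF ev_point Y2[of "vector [1, 0, 0]"]]] unfolding e .
  have 3: "continuous_map ?X euclidean (\<lambda>\<alpha>. \<alpha> ev_point (0, vector [1, 0, 0]))"
    using continuous_map_from_subtopology[OF continuous_map_form_eval[OF ev_point Y2[of "vector [0, 1, 0]"]]] unfolding e .
  define p where "p = (\<lambda>\<alpha> :: form. (\<alpha> ev_point (\<i>, 0), \<alpha> ev_point (0, vector [0, -1, 0]), \<alpha> ev_point (0, vector [1, 0, 0])))"
  have "continuous_map ?X (prod_topology euclidean (prod_topology euclidean euclidean)) p"
    unfolding p_def by (intro continuous_map_pairedI 1 2 3)
  then have "continuous_map ?X euclidean p" by simp
  moreover have "p \<alpha> \<noteq> 0" if "\<alpha> \<in> contact_forms" for \<alpha>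
    using ev_vec_nonzero[OF that] by (auto simp: p_def ev_vec_def zero_prod_def vec_eq_iff forall_3)
  ultimately have p: "continuous_map ?X (top_of_set (- {0})) p"
    by (auto simp: continuous_map_in_subtopology)
  define v where "v = (\<lambda>x :: real \<times> real \<times> real. fst x *\<^sub>R axis 1 1 + fst (snd x) *\<^sub>R axis 2 1 + snd (snd x) *\<^sub>R axis 3 1 :: real^3)"
  have v: "v x = vector [fst x, fst (snd x), snd (snd x)]" for x
    by (simp add: v_def vec_eq_iff forall_3 axis_def)
  have "v x \<noteq> 0" if "x \<noteq> 0" for x
    using that by (auto simp: v vec_eq_iff forall_3 zero_prod_def prod_eq_iff)
  then have "continuous_on (- {0}) (\<lambda>x. (1 / norm (v x)) *\<^sub>R v x)"
    unfolding v_def by (intro continuous_intros) auto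
  then have "continuous_map (top_of_set (- {0})) euclidean (\<lambda>x. (1 / norm (v x)) *\<^sub>R v x)"
    by simp
  from continuous_map_compose[OF p this]
  have "continuous_map ?X euclidean ev_form"
    by (simp add: o_def v ev_form_def[abs_def] p_def ev_vec_def[symmetric])
  then show ?thesis
    using ev_vec_nonzero by (auto simp: continuous_map_in_subtopology ev_form_def)
qed

text \<open>Descends from forms by the quotient topology: the contact forms whose structure lies in
  the preimage of \<open>U\<close> are those that \<open>ev_form\<close> maps into
  \<open>U\<close>.\<close>

lemma continuous_map_ev_plane:
  "continuous_map contact_structures (top_of_set (sphere 0 1)) ev_plane"
  unfolding continuous_map_def
proof (intro conjI allI impI)
  show "ev_plane \<in> topspace contact_structures \<rightarrow> topspace (top_of_set (sphere 0 1))"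
    using ev_vec_nonzero by (auto simp: topspace_contact_structures ev_plane_kernel ev_form_def)
  fix U :: "(real^3) set" assume U: "openin (top_of_set (sphere 0 1)) U"
  have top: "topspace (subtopology smooth_topology contact_forms) = contact_forms"
    by (auto simp: topspace_smooth_topology contact_forms_def)
  have "{\<alpha> \<in> contact_forms. cooriented_kernel \<alpha> \<in> {\<eta> \<in> topspace contact_structures. ev_plane \<eta> \<in> U}} =
      {\<alpha> \<in> topspace (subtopology smooth_topology contact_forms). ev_form \<alpha> \<in> U}"
    unfolding top topspace_contact_structures
    by (rule Collect_cong) (simp add: ev_plane_kernel cong: conj_cong)
  moreover have "openin (subtopology smooth_topology contact_forms) \<dots>"
    by (rule openin_continuous_map_preimage[OF continuous_map_ev_form U])
  ultimately show "openin contact_structures {\<eta> \<in> topspace contact_structures. ev_plane \<eta> \<in> U}"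
    unfolding openin_contact_structures by (auto simp: topspace_contact_structures)
qed

section \<open>The families of contact forms\<close>

text \<open>Cosine and sine of the angle are independent parameters, so that the real and imaginary
  part of the circle coordinate can be inserted without choosing an angle. It is a rotation for unit
  \<open>k\<close> and c^2 + s^2 = 1.\<close>

definition rodrigues :: "real^3 \<Rightarrow> real \<Rightarrow> real \<Rightarrow> real^3 \<Rightarrow> real^3" where
  "rodrigues k c s p = c *\<^sub>R p + s *\<^sub>R cross3 k p + ((1 - c) * (k \<bullet> p)) *\<^sub>R k"

lemma inner_vec3: "x \<bullet> (y :: real^3) = x $ 1 * y $ 1 + x $ 2 * y $ 2 + x $ 3 * y $ 3"
  by (simp add: inner_vec_def sum_3)

lemma cross3_nth:
  "cross3 x y $ 1 = x $ 2 * y $ 3 - x $ 3 * y $ 2"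
  "cross3 x y $ 2 = x $ 3 * y $ 1 - x $ 1 * y $ 3"
  "cross3 x y $ 3 = x $ 1 * y $ 2 - x $ 2 * y $ 1"
  by (simp_all add: cross3_def)

lemma norm_vec3_eq_1: "norm (k :: real^3) = 1 \<longleftrightarrow> k $ 1 * k $ 1 + k $ 2 * k $ 2 + k $ 3 * k $ 3 = 1"
  by (simp add: norm_eq_1 inner_vec3)

text \<open>Reversing the axis reverses the rotation, so the inverse has the same \<open>c\<close>
  and \<open>s\<close>.\<close>

lemma rodrigues_inverse:
  assumes "norm k = 1" "c * c + s * s = 1"
  shows "rodrigues (- k) c s (rodrigues k c s p) = p"
proof -
  define k1 k2 k3 p1 p2 p3 where "k1 = k $ 1" "k2 = k $ 2" "k3 = k $ 3" "p1 = p $ 1" "p2 = p $ 2" "p3 = p $ 3"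
  note d = this
  have "k1 * k1 + k2 * k2 + k3 * k3 = 1" using assms(1) by (simp add: norm_vec3_eq_1 d)
  then show ?thesis
    using assms(2) unfolding vec_eq_iff forall_3 rodrigues_def
    by (simp add: cross3_nth inner_vec3 d[symmetric]) (intro conjI; algebra)
qed

lemma rodrigues_inner:
  assumes "norm k = 1" "c * c + s * s = 1"
  shows "rodrigues k c s p \<bullet> rodrigues k c s q = p \<bullet> q"
proof -
  define k1 k2 k3 p1 p2 p3 q1 q2 q3 where "k1 = k $ 1" "k2 = k $ 2" "k3 = k $ 3" "p1 = p $ 1" "p2 = p $ 2" "p3 = p $ 3"
    "q1 = q $ 1" "q2 = q $ 2" "q3 = q $ 3"
  note d = this
  have "k1 * k1 + k2 * k2 + k3 * k3 = 1" using assms(1) by (simp add: norm_vec3_eq_1 d)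
  then show ?thesis
    using assms(2) unfolding rodrigues_def
    by (simp add: cross3_nth inner_vec3 d[symmetric]) algebra
qed

lemma rodrigues_cross:
  assumes "norm k = 1" "c * c + s * s = 1"
  shows "cross3 (rodrigues k c s p) (rodrigues k c s q) = rodrigues k c s (cross3 p q)"
proof -
  define k1 k2 k3 p1 p2 p3 q1 q2 q3 where "k1 = k $ 1" "k2 = k $ 2" "k3 = k $ 3" "p1 = p $ 1" "p2 = p $ 2" "p3 = p $ 3"
    "q1 = q $ 1" "q2 = q $ 2" "q3 = q $ 3"
  note d = this
  have "k1 * k1 + k2 * k2 + k3 * k3 = 1" using assms(1) by (simp add: norm_vec3_eq_1 d)
  then show ?thesis
    using assms(2) unfolding vec_eq_iff forall_3 rodrigues_def
    by (simp add: cross3_nth inner_vec3 d[symmetric]) (intro conjI; algebra)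
qed

text \<open>On \<open>S1xS2\<close> this is \<open>delta_diffeo\<close>, written without \<open>Arg2pi\<close> and hence polynomial.\<close>

definition twist :: "real^3 \<Rightarrow> ambient \<Rightarrow> ambient" where
  "twist u m = (fst m, rodrigues u (Re (fst m)) (Im (fst m)) (snd m))"

definition twist_deriv :: "real^3 \<Rightarrow> ambient \<Rightarrow> ambient \<Rightarrow> ambient" where
  "twist_deriv u m v = (fst v, rodrigues u (Re (fst m)) (Im (fst m)) (snd v)
     + Re (fst v) *\<^sub>R (snd m - (u \<bullet> snd m) *\<^sub>R u) + Im (fst v) *\<^sub>R cross3 u (snd m))"

text \<open>The second derivative of \<open>twist u\<close>, which is quadratic, hence no base
  point. Its symmetry is the reason why pulling back commutes with the exterior derivative.\<close>

definition twist_deriv2 :: "real^3 \<Rightarrow> ambient \<Rightarrow> ambient \<Rightarrow> ambient" where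
  "twist_deriv2 u x v = (0, Re (fst x) *\<^sub>R (snd v - (u \<bullet> snd v) *\<^sub>R u) + Im (fst x) *\<^sub>R cross3 u (snd v)
     + Re (fst v) *\<^sub>R (snd x - (u \<bullet> snd x) *\<^sub>R u) + Im (fst v) *\<^sub>R cross3 u (snd x))"

lemma has_derivative_cross3 [derivative_intros]:
  assumes "(f has_derivative f') (at x within S)" "(g has_derivative g') (at x within S)"
  shows "((\<lambda>x. cross3 (f x) (g x)) has_derivative (\<lambda>h. cross3 (f x) (g' h) + cross3 (f' h) (g x))) (at x within S)"
  by (rule bounded_bilinear.FDERIV[OF bounded_bilinear_cross3 assms])

lemma has_derivative_twist: "(twist u has_derivative twist_deriv u m) (at m)"
proof -
  have "((\<lambda>n. (fst n, Re (fst n) *\<^sub>R snd n + Im (fst n) *\<^sub>R cross3 u (snd n)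
      + ((1 - Re (fst n)) * (u \<bullet> snd n)) *\<^sub>R u)) has_derivative twist_deriv u m) (at m)"
    by (rule has_derivative_eq_rhs, (rule derivative_intros)+)
      (simp add: fun_eq_iff twist_deriv_def rodrigues_def vec_eq_iff forall_3 cross3_nth inner_vec3 algebra_simps)
  then show ?thesis by (simp add: twist_def[abs_def] rodrigues_def)
qed

lemma has_derivative_twist_deriv: "((\<lambda>n. twist_deriv u n v) has_derivative (\<lambda>x. twist_deriv2 u x v)) (at m)"
proof -
  have "((\<lambda>n. (fst v, Re (fst n) *\<^sub>R snd v + Im (fst n) *\<^sub>R cross3 u (snd v)
      + ((1 - Re (fst n)) * (u \<bullet> snd v)) *\<^sub>R u
      + Re (fst v) *\<^sub>R (snd n - (u \<bullet> snd n) *\<^sub>R u) + Im (fst v) *\<^sub>R cross3 u (snd n)))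
       has_derivative (\<lambda>x. twist_deriv2 u x v)) (at m)"
    by (rule has_derivative_eq_rhs, (rule derivative_intros)+)
      (simp add: fun_eq_iff twist_deriv2_def rodrigues_def vec_eq_iff forall_3 cross3_nth inner_vec3 algebra_simps)
  then show ?thesis by (simp add: twist_deriv_def[abs_def] rodrigues_def)
qed

lemma twist_deriv2_sym: "twist_deriv2 u x v = twist_deriv2 u v x"
  by (simp add: twist_deriv2_def)

lemma S1xS2_iff: "m \<in> S1xS2 \<longleftrightarrow> norm (fst m) = 1 \<and> norm (snd m) = 1"
  by (auto simp: S1xS2_def mem_Times_iff)

lemma norm_complex_eq_1: "norm w = 1 \<longleftrightarrow> Re w * Re w + Im w * Im w = 1"
  by (simp add: norm_complex_def power2_eq_square)

lemma norm_rodrigues: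
  assumes "norm k = 1" "c * c + s * s = 1"
  shows "norm (rodrigues k c s p) = norm p"
  using rodrigues_inner[OF assms, of p p] by (simp add: norm_eq_sqrt_inner)

lemma smooth_on_rodrigues:
  "smooth_on A k \<Longrightarrow> smooth_on A c \<Longrightarrow> smooth_on A s \<Longrightarrow> smooth_on A p \<Longrightarrow>
    smooth_on A (\<lambda>x. rodrigues (k x) (c x) (s x) (p x))"
  unfolding rodrigues_def by (intro smooth_on_intros)

lemma smooth_on_twist:
  "smooth_on A u \<Longrightarrow> smooth_on A F \<Longrightarrow> smooth_on A (\<lambda>x. twist (u x) (F x))"
  unfolding twist_def by (intro smooth_on_intros smooth_on_rodrigues)

lemma inverse_diffeos_twist:
  assumes "norm u = 1"
  shows "inverse_diffeos (twist u) (twist (- u))"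
  unfolding inverse_diffeos_def
  using assms rodrigues_inverse[of u] rodrigues_inverse[of "- u"]
  by (auto simp: S1xS2_iff twist_def norm_rodrigues norm_complex_eq_1 image_subset_iff prod_eq_iff
      simp del: split_paired_All
      intro!: smooth_on_twist smooth_on_const smooth_on_id)

lemma tangent_map_twist:
  assumes "m \<in> S1xS2" "v \<in> tangent_space m" shows "tangent_map (twist u) m v = twist_deriv u m v"
  by (rule tangent_map_eq[OF assms has_derivative_at_withinI[OF has_derivative_twist]])

definition pull :: "real^3 \<Rightarrow> form \<Rightarrow> form" where
  "pull u \<alpha> m v = \<alpha> (twist u m) (twist_deriv u m v)"

lemma pushes_twist:
  assumes "norm u = 1" shows "pushes (twist u) (twist (- u)) \<alpha> (pull (- u) \<alpha>)"
  by (rule pushes_pullback[OF inverse_diffeos_twist[OF assms]]) (simp add: pull_def tangent_map_twist)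

text \<open>The derivative is demanded at all points of the ambient space, so that exterior
  derivatives on \<open>S1xS2\<close> become the expression
  \<open>\<alpha>' m x y - \<alpha>' m y x\<close>.\<close>

definition form_derivative :: "form \<Rightarrow> (ambient \<Rightarrow> ambient \<Rightarrow> ambient \<Rightarrow> real) \<Rightarrow> bool" where
  "form_derivative \<alpha> \<alpha>' \<longleftrightarrow> (\<forall>m. linear (\<alpha> m)) \<and> (\<forall>m x. linear (\<alpha>' m x)) \<and>
     (\<forall>m v. ((\<lambda>n. \<alpha> n v) has_derivative (\<lambda>x. \<alpha>' m x v)) (at m))"

lemma exterior_derivative_eq:
  assumes "form_derivative \<alpha> \<alpha>'" "m \<in> S1xS2" "x \<in> tangent_space m" "y \<in> tangent_space m"
  shows "exterior_derivative \<alpha> m x y = \<alpha>' m x y - \<alpha>' m y x"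
proof -
  have "((\<lambda>n. \<alpha> n v) has_derivative (\<lambda>x. \<alpha>' m x v)) (at m within S1xS2)" for v
    using assms(1) unfolding form_derivative_def by (blast intro: has_derivative_at_withinI)
  note d = tangent_map_eq[OF assms(2) _ this]
  show ?thesis unfolding exterior_derivative_def d[OF assms(3)] d[OF assms(4)] ..
qed

lemma linear_twist_deriv: "linear (twist_deriv u m)"
  using has_derivative_linear[OF has_derivative_twist] .

lemma linear_expand:
  fixes f :: "'a::euclidean_space \<Rightarrow> real"
  assumes "linear f" shows "f x = (\<Sum>b\<in>Basis. (x \<bullet> b) * f b)"
proof -
  have "f x = f (\<Sum>b\<in>Basis. (x \<bullet> b) *\<^sub>R b)" by (simp add: euclidean_representation)
  then show ?thesis by (simp add: linear_sum[OF assms] linear_cmul[OF assms])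
qed

definition pull_deriv :: "real^3 \<Rightarrow> form \<Rightarrow> (ambient \<Rightarrow> ambient \<Rightarrow> ambient \<Rightarrow> real) \<Rightarrow> ambient \<Rightarrow> ambient \<Rightarrow> ambient \<Rightarrow> real" where
  "pull_deriv u \<alpha> \<alpha>' m x v = \<alpha>' (twist u m) (twist_deriv u m x) (twist_deriv u m v)
     + \<alpha> (twist u m) (twist_deriv2 u x v)"

text \<open>Both the point and the vector inserted into \<alpha> vary; by linearity the vector is
  expanded in \<open>Basis\<close>, and the product rule gives the two terms of
  \<open>pull_deriv\<close>.\<close>

lemma form_derivative_pull:
  assumes "form_derivative \<alpha> \<alpha>'"
  shows "form_derivative (pull u \<alpha>) (pull_deriv u \<alpha> \<alpha>')"
proof -
  have lin: "linear (\<alpha> m)" "linear (\<alpha>' m x)" for m x using assms by (auto simp: form_derivative_def simp del: split_paired_All)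
  have d: "((\<lambda>n. \<alpha> n v) has_derivative (\<lambda>x. \<alpha>' m x v)) (at m)" for m v
    using assms unfolding form_derivative_def by blast
  have lt2: "linear (twist_deriv2 u x)" for x
    using has_derivative_linear[OF has_derivative_twist_deriv, of u x] by (simp add: twist_deriv2_sym[of u _ x])
  have "linear (pull u \<alpha> m)" for m
    using linear_compose[OF linear_twist_deriv lin(1)] by (simp add: o_def pull_def[abs_def])
  moreover have "linear (pull_deriv u \<alpha> \<alpha>' m x)" for m x
    using linear_compose_add[OF linear_compose[OF linear_twist_deriv lin(2)] linear_compose[OF lt2 lin(1)]]
    by (simp add: o_def pull_deriv_def[abs_def])
  moreover have "((\<lambda>n. pull u \<alpha> n v) has_derivative (\<lambda>x. pull_deriv u \<alpha> \<alpha>' m x v)) (at m)" for m v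
  proof -
    have "((\<lambda>n. \<alpha> (twist u n) b) has_derivative (\<lambda>x. \<alpha>' (twist u m) (twist_deriv u m x) b)) (at m)" for b
      by (rule has_derivative_compose[OF has_derivative_twist d])
    then have "((\<lambda>n. \<Sum>b\<in>Basis. (twist_deriv u n v \<bullet> b) * \<alpha> (twist u n) b) has_derivative
        (\<lambda>x. \<Sum>b\<in>Basis. (twist_deriv u m v \<bullet> b) * \<alpha>' (twist u m) (twist_deriv u m x) b
           + (twist_deriv2 u x v \<bullet> b) * \<alpha> (twist u m) b)) (at m)"
      by (intro has_derivative_sum has_derivative_mult has_derivative_inner_left has_derivative_twist_deriv)
    then show ?thesis
      unfolding sum.distrib linear_expand[OF lin(1), symmetric] linear_expand[OF lin(2), symmetric]
      by (simp add: pull_def pull_deriv_def)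
  qed
  ultimately show ?thesis unfolding form_derivative_def by blast
qed

text \<open>The terms with \<open>twist_deriv2\<close> cancel by symmetry, so the wedge of the
  pullback is the pullback of the wedge; and \<open>twist_deriv\<close> maps onto the tangent space
  at the image point.\<close>

lemma contact_forms_pull:
  assumes "form_derivative \<alpha> \<alpha>'" "\<alpha> \<in> contact_forms" "one_form (pull u \<alpha>)" "norm u = 1"
  shows "pull u \<alpha> \<in> contact_forms"
proof -
  note I = inverse_diffeos_twist[OF assms(4)]
  have ext: "exterior_derivative (pull u \<alpha>) m x y =
      exterior_derivative \<alpha> (twist u m) (twist_deriv u m x) (twist_deriv u m y)"
    if "m \<in> S1xS2" "x \<in> tangent_space m" "y \<in> tangent_space m" for m x y
  proof -
    have "twist_deriv u m x \<in> tangent_space (twist u m)" "twist_deriv u m y \<in> tangent_space (twist u m)"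
      using inverse_diffeos_tangent(1)[OF I] that by (metis tangent_map_twist)+
    then show ?thesis
      using exterior_derivative_eq[OF form_derivative_pull[OF assms(1)] that]
        exterior_derivative_eq[OF assms(1) inverse_diffeosD(3)[OF I that(1)]]
      by (simp add: pull_deriv_def twist_deriv2_sym[of u x y])
  qed
  have "\<exists>x\<in>tangent_space m. \<exists>y\<in>tangent_space m. \<exists>z\<in>tangent_space m. form_wedge_d (pull u \<alpha>) m x y z \<noteq> 0"
    if m: "m \<in> S1xS2" for m
  proof -
    have lift: "\<exists>x\<in>tangent_space m. twist_deriv u m x = w" if w: "w \<in> tangent_space (twist u m)" for w
    proof -
      note J = inverse_diffeos_tangent[OF inverse_diffeosD(5)[OF I] inverse_diffeosD(3)[OF I m] w]
      have "twist (- u) (twist u m) = m" using inverse_diffeosD(4)[OF I m] .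
      with J show ?thesis using m by (metis tangent_map_twist)
    qed
    obtain a b c where abc: "a \<in> tangent_space (twist u m)" "b \<in> tangent_space (twist u m)" "c \<in> tangent_space (twist u m)"
      "form_wedge_d \<alpha> (twist u m) a b c \<noteq> 0"
      using assms(2) inverse_diffeosD(3)[OF I m] unfolding contact_forms_def by blast
    obtain x y z where "x \<in> tangent_space m" "y \<in> tangent_space m" "z \<in> tangent_space m"
      "twist_deriv u m x = a" "twist_deriv u m y = b" "twist_deriv u m z = c"
      using lift abc(1-3) by metis
    then show ?thesis
      using abc(4) by (intro bexI[of _ x] bexI[of _ y] bexI[of _ z]) (simp_all add: form_wedge_d_def ext m pull_def)
  qed
  then show ?thesis using assms(3) by (simp add: contact_forms_def)
qed

text \<open>For \<open>t = 0\<close> these are the forms of the family \<open>S\<close>; for the axis \<open>u = (0, 0, 1)\<close> and \<open>t = 1\<close> one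
  gets the pullback of \<open>alpha0\<close> under the twist about \<open>- u\<close>.\<close>

definition family_form :: "real^3 \<Rightarrow> real \<Rightarrow> form" where
  "family_form u t m v = (u \<bullet> snd m - t * (cross3 u (snd m) \<bullet> cross3 u (snd m))) * d_theta m v
     + cross3 u (snd m) \<bullet> snd v"

definition family_form_deriv :: "real^3 \<Rightarrow> real \<Rightarrow> ambient \<Rightarrow> ambient \<Rightarrow> ambient \<Rightarrow> real" where
  "family_form_deriv u t m x v =
     (u \<bullet> snd x - 2 * t * (cross3 u (snd m) \<bullet> cross3 u (snd x))) * d_theta m v
     + (u \<bullet> snd m - t * (cross3 u (snd m) \<bullet> cross3 u (snd m))) * d_theta x v
     + cross3 u (snd x) \<bullet> snd v"

lemma d_theta_Re_Im: "d_theta m v = Re (fst m) * Im (fst v) - Im (fst m) * Re (fst v)"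
  by (simp add: d_theta_def)

lemma form_derivative_family: "form_derivative (family_form u t) (family_form_deriv u t)"
  unfolding form_derivative_def
proof (intro conjI allI)
  show "linear (family_form u t m)" for m
    by (rule linearI) (simp_all add: family_form_def d_theta_Re_Im inner_simps algebra_simps)
  show "linear (family_form_deriv u t m x)" for m x
    by (rule linearI) (simp_all add: family_form_deriv_def d_theta_Re_Im inner_simps algebra_simps)
  show "((\<lambda>n. family_form u t n v) has_derivative (\<lambda>x. family_form_deriv u t m x v)) (at m)" for m v
    unfolding family_form_def d_theta_Re_Im
    by (rule has_derivative_eq_rhs, (rule derivative_intros)+)
      (simp add: fun_eq_iff family_form_deriv_def d_theta_Re_Im inner_commute algebra_simps)
qed

lemma one_form_family: "one_form (family_form u t)"
  unfolding one_form_def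
proof (intro conjI ballI allI)
  show "linear (family_form u t m)" for m
    using form_derivative_family unfolding form_derivative_def by blast
  show "smooth_on S1xS2 (\<lambda>m. family_form u t m v)" for v
    unfolding family_form_def d_theta_Re_Im by (intro smooth_on_intros)
qed

lemma unit_orthogonal_exists:
  fixes p :: "real^3" obtains v where "norm v = 1" "v \<bullet> p = 0"
proof -
  obtain y where y: "y \<noteq> 0" "orthogonal p y"
    by (rule orthogonal_to_vector_exists[of p]) auto
  show ?thesis
    using y by (intro that[of "y /\<^sub>R norm y"]) (auto simp: orthogonal_def inner_commute)
qed

text \<open>On the frame \<open>X\<close>, \<open>Y\<close>, \<open>Z\<close>, with \<open>X\<close>
  along the circle and \<open>v\<close>, \<open>v'\<close> orthonormal and tangent to the sphere,
  the wedge is 1 + (u . p)^2 for every \<open>t\<close>: the terms with \<open>t\<close>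
  cancel.\<close>

lemma contact_forms_family:
  assumes u: "norm u = 1" shows "family_form u t \<in> contact_forms"
proof -
  have "\<exists>x\<in>tangent_space m. \<exists>y\<in>tangent_space m. \<exists>z\<in>tangent_space m. form_wedge_d (family_form u t) m x y z \<noteq> 0"
    if m: "m \<in> S1xS2" for m
  proof -
    define p where "p = snd m"
    have p: "norm p = 1" and w: "norm (fst m) = 1" using m by (auto simp: S1xS2_iff p_def)
    obtain v where v: "norm v = 1" "v \<bullet> p = 0" by (rule unit_orthogonal_exists)
    define v' where "v' = cross3 p v"
    define X Y Z :: ambient where "X = (\<i> * fst m, 0)" and "Y = (0, v)" and "Z = (0, v')"
    have T: "X \<in> tangent_space m" "Y \<in> tangent_space m" "Z \<in> tangent_space m"
      using v by (simp_all add: X_def Y_def Z_def v'_def tangent_space_def p_def[symmetric] inner_complex_def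
          inner_commute[of "cross3 p v"] dot_cross_self)
    have dX: "d_theta m X = 1"
      using w by (simp add: X_def d_theta_Re_Im norm_complex_eq_1)
    have dYZ: "d_theta n Y = 0" "d_theta n Z = 0" "d_theta Y n = 0" "d_theta Z n = 0" for n
      by (simp_all add: Y_def Z_def d_theta_Re_Im)
    have XX: "d_theta X X = 0" by (simp add: d_theta_Re_Im)
    have wedge: "form_wedge_d (family_form u t) m X Y Z =
      (u \<bullet> p - t * (cross3 u p \<bullet> cross3 u p)) * (cross3 u v \<bullet> v' - cross3 u v' \<bullet> v)
      + (cross3 u p \<bullet> v) * (u \<bullet> v' - 2 * t * (cross3 u p \<bullet> cross3 u v'))
      - (cross3 u p \<bullet> v') * (u \<bullet> v - 2 * t * (cross3 u p \<bullet> cross3 u v))"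
      unfolding form_wedge_d_def exterior_derivative_eq[OF form_derivative_family m T(2,3)]
        exterior_derivative_eq[OF form_derivative_family m T(3,1)]
        exterior_derivative_eq[OF form_derivative_family m T(1,2)]
      unfolding family_form_def family_form_deriv_def dX dYZ p_def[symmetric]
      by (simp add: X_def Y_def Z_def d_theta_Re_Im right_diff_distrib)
    have "form_wedge_d (family_form u t) m X Y Z = 1 + (u \<bullet> p)\<^sup>2"
    proof -
      define u1 u2 u3 p1 p2 p3 v1 v2 v3 where d: "u1 = u $ 1" "u2 = u $ 2" "u3 = u $ 3" "p1 = p $ 1" "p2 = p $ 2"
        "p3 = p $ 3" "v1 = v $ 1" "v2 = v $ 2" "v3 = v $ 3"
      have "u1 * u1 + u2 * u2 + u3 * u3 = 1" "p1 * p1 + p2 * p2 + p3 * p3 = 1" "v1 * v1 + v2 * v2 + v3 * v3 = 1"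
        "v1 * p1 + v2 * p2 + v3 * p3 = 0"
        using u p v by (simp_all add: norm_vec3_eq_1 inner_vec3 d)
      note h = this
      define z a b where z: "z = u \<bullet> p" and a: "a = u \<bullet> v" and b: "b = u \<bullet> v'"
      have z': "z = u1 * p1 + u2 * p2 + u3 * p3" and a': "a = u1 * v1 + u2 * v2 + u3 * v3"
        and b': "b = u1 * (p2 * v3 - p3 * v2) + u2 * (p3 * v1 - p1 * v3) + u3 * (p1 * v2 - p2 * v1)"
        by (simp_all add: z a b v'_def cross3_nth inner_vec3 d)
      have 1: "cross3 u v \<bullet> v' = z" "cross3 u v' \<bullet> v = - z"
        unfolding v'_def inner_vec3 cross3_nth d[symmetric] z' using h by - algebra+
      have 2: "cross3 u p \<bullet> v = b" "cross3 u p \<bullet> v' = - a"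
        unfolding v'_def inner_vec3 cross3_nth d[symmetric] a' b' using h by - algebra+
      have 3: "cross3 u p \<bullet> cross3 u p = 1 - z * z" "cross3 u p \<bullet> cross3 u v' = - b * z"
        "cross3 u p \<bullet> cross3 u v = - a * z"
        unfolding v'_def inner_vec3 cross3_nth d[symmetric] z' a' b' using h by - algebra+
      have "b * b = u1 * u1 + u2 * u2 + u3 * u3 - z * z - a * a"
      proof -
        \<comment> \<open>The Gram determinant of \<open>u\<close>, \<open>p\<close>,
          \<open>v\<close>, whose triple product is \<open>b\<close>; \<open>z\<close> and
          \<open>a\<close> are the inner products of \<open>u\<close> with \<open>p\<close> and
          \<open>v\<close>.\<close>
        have "b * b = (u1 * u1 + u2 * u2 + u3 * u3) * ((p1 * p1 + p2 * p2 + p3 * p3) * (v1 * v1 + v2 * v2 + v3 * v3)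
           - (v1 * p1 + v2 * p2 + v3 * p3) * (v1 * p1 + v2 * p2 + v3 * p3))
           - z * (z * (v1 * v1 + v2 * v2 + v3 * v3) - a * (v1 * p1 + v2 * p2 + v3 * p3))
           - a * (a * (p1 * p1 + p2 * p2 + p3 * p3) - z * (v1 * p1 + v2 * p2 + v3 * p3))"
          unfolding z' a' b' by (simp add: algebra_simps)
        then show ?thesis unfolding h by simp
      qed
      then have 4: "b * b = 1 - z * z - a * a" using h by simp
      have "form_wedge_d (family_form u t) m X Y Z =
          (z - t * (1 - z * z)) * (z - - z) + b * (b - 2 * t * (- b * z)) - (- a) * (a - 2 * t * (- a * z))"
        unfolding wedge 1 2 3 z[symmetric] a[symmetric] b[symmetric] ..
      also have "\<dots> = 1 + z * z" using 4 by algebra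
      finally show ?thesis unfolding z power2_eq_square .
    qed
    moreover have "1 + (u \<bullet> p)\<^sup>2 > 0" by (rule add_pos_nonneg) auto
    ultimately have "form_wedge_d (family_form u t) m X Y Z \<noteq> 0" by simp
    then show ?thesis using T by blast
  qed
  then show ?thesis using one_form_family by (simp add: contact_forms_def)
qed

definition e3 :: "real^3" where "e3 = vector [0, 0, 1]"

lemma norm_e3 [simp]: "norm e3 = 1" by (simp add: e3_def norm_vec3)

lemma alpha0_family: "alpha0 = family_form e3 0"
  by (simp add: fun_eq_iff alpha0_def family_form_def e3_def inner_vec3 cross3_nth)

text \<open>A rotationally symmetric flow with \<open>shear t\<close> pulling \<open>alpha0\<close> back to a multiple of
  \<open>family_form e3 t\<close>: on the sphere it translates the coordinate \<open>z / (1 - z\<^sup>2)\<close> by \<open>- t\<close>.\<close>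

definition shear_denom :: "real \<Rightarrow> real^3 \<Rightarrow> real" where
  "shear_denom t p = (p $ 1)\<^sup>2 + (p $ 2)\<^sup>2
     + sqrt (((p $ 1)\<^sup>2 + (p $ 2)\<^sup>2)\<^sup>2 + 4 * (p $ 3 - t * ((p $ 1)\<^sup>2 + (p $ 2)\<^sup>2))\<^sup>2)"

definition shear :: "real \<Rightarrow> ambient \<Rightarrow> ambient" where
  "shear t m = (let p = snd m; D = shear_denom t p in
     (fst m, vector [sqrt (2 / D) * p $ 1, sqrt (2 / D) * p $ 2, 2 * (p $ 3 - t * ((p $ 1)\<^sup>2 + (p $ 2)\<^sup>2)) / D]))"

section \<open>The shear flow\<close>

lemma shear_radicand_pos:
  fixes p :: "real^3" assumes "norm p = 1"
  shows "((p $ 1)\<^sup>2 + (p $ 2)\<^sup>2)\<^sup>2 + 4 * (p $ 3 - t * ((p $ 1)\<^sup>2 + (p $ 2)\<^sup>2))\<^sup>2 > 0"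
proof (cases "(p $ 1)\<^sup>2 + (p $ 2)\<^sup>2 = 0")
  case True
  then have "p $ 3 \<noteq> 0" using assms by (auto simp: norm_vec3)
  then show ?thesis using True by simp
next
  case False
  then show ?thesis by (intro add_pos_nonneg) auto
qed

lemma shear_denom_pos: "norm p = 1 \<Longrightarrow> shear_denom t p > 0"
  unfolding shear_denom_def using shear_radicand_pos[of p t] by (intro add_nonneg_pos) auto

text \<open>Put w = z - t g and let Z = 2 w / D be the new height. Divided by D^2, the equation says
  1 - Z^2 = 2 g / D, hence the factor \<open>sqrt (2 / D)\<close> on the other coordinates and Z /
  (1 - Z^2) = w / g = z / g - t. Writing the root as 2 w / D keeps it smooth at the poles and where
  w = 0.\<close>

lemma shear_quadratic:
  assumes "norm p = 1" and "g = (p $ 1)\<^sup>2 + (p $ 2)\<^sup>2" and "D = shear_denom t p"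
  shows "D\<^sup>2 = 2 * g * D + 4 * (p $ 3 - t * g)\<^sup>2"
proof -
  have "D - g = sqrt (g\<^sup>2 + 4 * (p $ 3 - t * g)\<^sup>2)"
    by (simp add: assms shear_denom_def)
  then have "(D - g)\<^sup>2 = g\<^sup>2 + 4 * (p $ 3 - t * g)\<^sup>2" by simp
  then show ?thesis by (simp add: power2_eq_square algebra_simps)
qed

lemma shear_in_sphere:
  assumes "m \<in> S1xS2" shows "shear t m \<in> S1xS2"
proof -
  define p g D where "p = snd m" and "g = (p $ 1)\<^sup>2 + (p $ 2)\<^sup>2" and "D = shear_denom t p"
  have p: "norm p = 1" using assms by (simp add: S1xS2_iff p_def)
  have D: "D > 0" using shear_denom_pos[OF p] by (simp add: D_def)
  have q: "D\<^sup>2 = 2 * g * D + 4 * (p $ 3 - t * g)\<^sup>2" by (rule shear_quadratic[OF p g_def D_def])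
  have "(sqrt (2 / D) * p $ 1)\<^sup>2 + (sqrt (2 / D) * p $ 2)\<^sup>2 + (2 * (p $ 3 - t * g) / D)\<^sup>2
      = 2 / D * g + 4 * (p $ 3 - t * g)\<^sup>2 / D\<^sup>2"
  proof -
    have "(sqrt (2 / D))\<^sup>2 = 2 / D" using D by simp
    then show ?thesis by (simp only: power_mult_distrib power_divide g_def distrib_left) simp
  qed
  also have "\<dots> = (2 * g * D + 4 * (p $ 3 - t * g)\<^sup>2) / D\<^sup>2"
    using D by (simp add: field_simps power2_eq_square)
  also have "\<dots> = 1" unfolding q[symmetric] using D by simp
  finally have "norm (snd (shear t m)) = 1"
    by (simp add: shear_def Let_def norm_vec3 p_def[symmetric] g_def[symmetric] D_def[symmetric])
  then show ?thesis using assms by (simp add: S1xS2_iff shear_def Let_def)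
qed

lemma shear_inverse:
  assumes "m \<in> S1xS2" shows "shear (- t) (shear t m) = m"
proof -
  define p g D where "p = snd m" and "g = (p $ 1)\<^sup>2 + (p $ 2)\<^sup>2" and "D = shear_denom t p"
  have p: "norm p = 1" using assms by (simp add: S1xS2_iff p_def)
  then have g: "g = 1 - (p $ 3)\<^sup>2" by (simp add: norm_vec3 g_def)
  have D: "D > 0" using shear_denom_pos[OF p] by (simp add: D_def)
  define q where "q = snd (shear t m)"
  have q: "q $ 1 = sqrt (2 / D) * p $ 1" "q $ 2 = sqrt (2 / D) * p $ 2" "q $ 3 = 2 * (p $ 3 - t * g) / D"
    by (simp_all add: q_def shear_def Let_def p_def g_def D_def)
  have g': "(q $ 1)\<^sup>2 + (q $ 2)\<^sup>2 = 2 * g / D"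
    using D by (simp add: q power_mult_distrib g_def algebra_simps add_divide_distrib)
  have h': "q $ 3 - (- t) * (2 * g / D) = 2 * p $ 3 / D"
    using D by (simp add: q field_simps)
  \<comment> \<open>Since g = 1 - z^2, the sum g^2 + 4 z^2 is the square of 1 + z^2. So the root
    disappears, and the denominator of the inverse is 4 / D.\<close>
  have "(2 * g / D)\<^sup>2 + 4 * (2 * p $ 3 / D)\<^sup>2 = (2 * (1 + (p $ 3)\<^sup>2) / D)\<^sup>2"
    using D unfolding g by (simp add: field_simps power2_eq_square)
  then have "sqrt ((2 * g / D)\<^sup>2 + 4 * (2 * p $ 3 / D)\<^sup>2) = 2 * (1 + (p $ 3)\<^sup>2) / D"
    using D by (simp add: add_nonneg_nonneg)
  then have D': "shear_denom (- t) q = 4 / D"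
    unfolding shear_denom_def g' h' using D by (simp add: g field_simps)
  have s: "sqrt (2 / (4 / D)) * (sqrt (2 / D) * x) = x" for x
    using D by (simp add: real_sqrt_mult[symmetric] mult.assoc[symmetric])
  have "shear (- t) (shear t m) = (fst m, vector [sqrt (2 / (4 / D)) * q $ 1, sqrt (2 / (4 / D)) * q $ 2,
      2 * (2 * p $ 3 / D) / (4 / D)])"
    unfolding shear_def[of "- t"] Let_def q_def[symmetric] g' h' D' by (simp add: shear_def Let_def)
  also have "\<dots> = m"
    unfolding q s using D by (simp add: prod_eq_iff vec_eq_iff forall_3 p_def)
  finally show ?thesis .
qed

lemma smooth_on_vector3:
  assumes "smooth_on A f" "smooth_on A g" "smooth_on A h"
  shows "smooth_on A (\<lambda>x. vector [f x, g x, h x] :: real^3)"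
proof -
  have "(\<lambda>x. vector [f x, g x, h x] :: real^3) =
      (\<lambda>x. f x *\<^sub>R axis 1 1 + g x *\<^sub>R axis 2 1 + h x *\<^sub>R axis 3 1)"
    by (auto simp: vec_eq_iff forall_3 axis_def)
  then show ?thesis by (simp add: smooth_on_intros assms)
qed

lemma smooth_on_shear_denom:
  assumes "smooth_on A t" "smooth_on A p" "\<And>x. x \<in> A \<Longrightarrow> norm (p x) = 1"
  shows "smooth_on A (\<lambda>x. shear_denom (t x) (p x))"
  unfolding shear_denom_def by (intro smooth_on_intros assms(1,2) shear_radicand_pos assms(3))

lemma smooth_on_shear:
  assumes "smooth_on A t" "smooth_on A F" "\<And>x. x \<in> A \<Longrightarrow> norm (snd (F x)) = 1"
  shows "smooth_on A (\<lambda>x. shear (t x) (F x))"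
proof -
  have pos: "shear_denom (t x) (snd (F x)) > 0" if "x \<in> A" for x
    using shear_denom_pos assms(3) that by blast
  have D: "smooth_on A (\<lambda>x. shear_denom (t x) (snd (F x)))"
    by (intro smooth_on_shear_denom smooth_on_snd assms)
  show ?thesis
    unfolding shear_def Let_def
    by (intro smooth_on_Pair smooth_on_vector3 smooth_on_fst smooth_on_snd smooth_on_mult smooth_on_sqrt
        smooth_on_divide smooth_on_diff smooth_on_power smooth_on_add smooth_on_vec_nth smooth_on_const D assms(1,2))
      (use pos in \<open>auto simp: less_imp_neq[symmetric] intro: less_imp_neq[symmetric]\<close>)
qed

lemma inverse_diffeos_shear: "inverse_diffeos (shear t) (shear (- t))"
  unfolding inverse_diffeos_def
proof (intro conjI ballI)
  show "smooth_on S1xS2 (shear t)" "smooth_on S1xS2 (shear (- t))"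
    using smooth_on_shear[OF smooth_on_const smooth_on_id, of S1xS2] by (simp_all add: S1xS2_iff)
  show "shear t ` S1xS2 \<subseteq> S1xS2" "shear (- t) ` S1xS2 \<subseteq> S1xS2" using shear_in_sphere by blast+
  show "shear (- t) (shear t m) = m" "shear t (shear (- t) m) = m" if "m \<in> S1xS2" for m
    using shear_inverse[OF that, of t] shear_inverse[OF that, of "- t"] by simp_all
qed

lemma tangent_map_bounded_linear:
  assumes "bounded_linear L" "smooth_on S1xS2 F" "m \<in> S1xS2" "v \<in> tangent_space m"
  shows "tangent_map (\<lambda>n. L (F n)) m v = L (tangent_map F m v)"
  by (rule tangent_map_eq[OF assms(3,4) bounded_linear.has_derivative[OF assms(1) tangent_map_linear(2)[OF assms(2,3)]]])

text \<open>Scaling x and y by the same function \<open>l\<close> multiplies x dy - y dx by l^2,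
  because the derivative of \<open>l\<close> cancels. As l^2 = 2 / D, both terms of the form get the
  factor 2 / D.\<close>

lemma pushes_shear: "pushes (shear t) (shear (- t)) (family_form e3 t) alpha0"
  unfolding pushes_def
proof (intro conjI ballI inverse_diffeos_shear)
  fix m assume m: "m \<in> S1xS2"
  define p g D where "p = snd m" and "g = (p $ 1)\<^sup>2 + (p $ 2)\<^sup>2" and "D = shear_denom t p"
  have p: "norm p = 1" using m by (simp add: S1xS2_iff p_def)
  have D: "D > 0" using shear_denom_pos[OF p] by (simp add: D_def)
  define l where "l = (\<lambda>n :: ambient. sqrt (2 / shear_denom t (snd n)))"
  have nz: "shear_denom t (snd n) > 0" if "n \<in> S1xS2" for n :: ambient
    using shear_denom_pos that by (simp add: S1xS2_iff)
  have l: "smooth_on S1xS2 l"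
    unfolding l_def
    by (intro smooth_on_sqrt smooth_on_divide smooth_on_const smooth_on_shear_denom smooth_on_snd smooth_on_id)
      (use nz in \<open>auto simp: S1xS2_iff less_imp_neq[symmetric] intro: less_imp_neq[symmetric]\<close>)
  note S = inverse_diffeosD(1)[OF inverse_diffeos_shear[of t]]
  have "alpha0 (shear t m) (tangent_map (shear t) m v) = 2 / D * family_form e3 t m v" if v: "v \<in> tangent_space m" for v
  proof -
    define V where "V = tangent_map (shear t) m v"
    have "fst V = fst v"
    proof -
      have "fst V = tangent_map (\<lambda>n. fst (shear t n)) m v"
        unfolding V_def by (rule tangent_map_bounded_linear[OF bounded_linear_fst S m v, symmetric])
      also have "\<dots> = tangent_map fst m v" by (simp add: shear_def Let_def)
      also have "\<dots> = fst v" by (rule tangent_map_eq[OF m v has_derivative_fst[OF has_derivative_ident]])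
      finally show ?thesis .
    qed
    have comp: "snd V $ i = tangent_map l m v * p $ i + l m * snd v $ i" if i: "i = 1 \<or> i = 2" for i
    proof -
      have "snd V $ i = tangent_map (\<lambda>n. snd (shear t n) $ i) m v"
        unfolding V_def
        by (rule tangent_map_bounded_linear[OF bounded_linear_compose[OF bounded_linear_vec_nth bounded_linear_snd] S m v, symmetric])
      also have "(\<lambda>n. snd (shear t n) $ i) = (\<lambda>n. l n * snd n $ i)"
        using i by (auto simp: shear_def Let_def l_def)
      also have "tangent_map \<dots> m v = l m * snd v $ i + tangent_map l m v * p $ i"
        unfolding p_def
        by (rule tangent_map_eq[OF m v has_derivative_mult[OF tangent_map_linear(2)[OF l m]]],
            rule bounded_linear.has_derivative[OF bounded_linear_vec_nth], rule has_derivative_snd, rule has_derivative_ident)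
      finally show ?thesis by simp
    qed
    have s: "fst (shear t m) = fst m" "snd (shear t m) $ 1 = l m * p $ 1" "snd (shear t m) $ 2 = l m * p $ 2"
      "snd (shear t m) $ 3 = 2 * (p $ 3 - t * g) / D"
      by (simp_all add: shear_def Let_def l_def p_def g_def D_def)
    have ll: "l m * l m = 2 / D" using D by (simp add: l_def D_def p_def)
    have "alpha0 (shear t m) V = 2 * (p $ 3 - t * g) / D * d_theta m v
        + l m * p $ 1 * (tangent_map l m v * p $ 2 + l m * snd v $ 2) - l m * p $ 2 * (tangent_map l m v * p $ 1 + l m * snd v $ 1)"
      unfolding alpha0_def s comp[of 1, simplified] comp[of 2, simplified] d_theta_def \<open>fst V = fst v\<close> ..
    also have "\<dots> = 2 / D * (p $ 3 - t * g) * d_theta m v + (l m * l m) * (p $ 1 * snd v $ 2 - p $ 2 * snd v $ 1)"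
    proof -
      have "2 * (p $ 3 - t * g) / D = 2 / D * (p $ 3 - t * g)" by simp
      then show ?thesis by algebra
    qed
    also have "\<dots> = 2 / D * family_form e3 t m v"
    proof -
      have "family_form e3 t m v = (p $ 3 - t * g) * d_theta m v + (p $ 1 * snd v $ 2 - p $ 2 * snd v $ 1)"
        by (simp add: family_form_def e3_def inner_vec3 cross3_nth p_def g_def power2_eq_square)
      then show ?thesis unfolding ll by (simp only: distrib_left mult.assoc)
    qed
    finally show ?thesis unfolding V_def .
  qed
  then show "\<exists>c>0. \<forall>v\<in>tangent_space m. alpha0 (shear t m) (tangent_map (shear t) m v) = c * family_form e3 t m v"
    using D by (intro exI[of _ "2 / D"]) simp
qed

section \<open>The twisted family: continuity, contact condition and isotopy to the standard
  structure\<close>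

definition separated_field :: "'q::metric_space set \<Rightarrow> ('q \<Rightarrow> ambient \<Rightarrow> ambient) \<Rightarrow> bool" where
  "separated_field Q F \<longleftrightarrow> separated Q (\<lambda>q m. Re (fst (F q m))) \<and> separated Q (\<lambda>q m. Im (fst (F q m))) \<and>
     (\<forall>i. separated Q (\<lambda>q m. snd (F q m) $ i))"

lemma separated_field_smooth:
  assumes "smooth_on S1xS2 Y" shows "separated_field Q (\<lambda>q. Y)"
  unfolding separated_field_def by (intro conjI allI separated_smooth smooth_on_intros assms)

lemma separated_fieldD:
  assumes "separated_field Q F"
  shows "separated Q (\<lambda>q m. Re (fst (F q m)))" "separated Q (\<lambda>q m. Im (fst (F q m)))" "separated Q (\<lambda>q m. snd (F q m) $ i)"
  using assms by (simp_all add: separated_field_def)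

lemma separated_field_twist:
  assumes "continuous_on Q u" "separated_field Q F"
  shows "separated_field Q (\<lambda>q m. twist (u q) (F q m))"
  unfolding separated_field_def forall_3 twist_def rodrigues_def
  by (simp add: cross3_nth inner_vec3)
    (intro conjI separated_add separated_diff separated_mult separated_fieldD[OF assms(2)] separated_param
      continuous_on_component continuous_on_const assms(1))

lemma separated_field_twist_deriv:
  assumes "continuous_on Q u" "separated_field Q F" "separated_field Q V"
  shows "separated_field Q (\<lambda>q m. twist_deriv (u q) (F q m) (V q m))"
  unfolding separated_field_def forall_3 twist_deriv_def rodrigues_def
  by (simp add: cross3_nth inner_vec3)
    (intro conjI separated_add separated_diff separated_mult separated_fieldD[OF assms(2)] separated_fieldD[OF assms(3)]
      separated_param continuous_on_component continuous_on_const assms(1))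

lemma separated_family:
  assumes "continuous_on Q u" "continuous_on Q t" "separated_field Q F" "separated_field Q V"
  shows "separated Q (\<lambda>q m. family_form (u q) (t q) (F q m) (V q m))"
  unfolding family_form_def d_theta_Re_Im inner_vec3 cross3_nth
  by (intro separated_add separated_diff separated_mult separated_fieldD[OF assms(3)] separated_fieldD[OF assms(4)]
      separated_param continuous_on_component assms(1,2))

text \<open>The parameter is a dummy: smoothness in the point is read off the closure rules for
  \<open>separated\<close>.\<close>

lemma one_formI:
  assumes "form_derivative \<alpha> \<alpha>'" "\<And>v. separated (UNIV :: real set) (\<lambda>q m. \<alpha> m v)"
  shows "one_form \<alpha>"
proof -
  have "smooth_on S1xS2 (\<lambda>m. \<alpha> m v)" for v
    using separated_iterated[OF assms(2)[of v], of "[]"] by auto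
  moreover have "linear (\<alpha> m)" for m using assms(1) unfolding form_derivative_def by blast
  ultimately show ?thesis unfolding one_form_def by blast
qed

text \<open>Interpolates between \<open>delta_sphere\<close> at \<open>t = 1\<close> and, at \<open>t = 0\<close>, a sphere through \<open>xi\<close>.\<close>

definition twisted_form :: "real^3 \<Rightarrow> real \<Rightarrow> form" where
  "twisted_form u t = pull (- u) (pull e3 (family_form e3 t))"

lemma separated_twisted:
  assumes "continuous_on Q u" "continuous_on Q t" "smooth_on S1xS2 Y"
  shows "separated Q (\<lambda>q m. twisted_form (u q) (t q) m (Y m))"
  unfolding twisted_form_def pull_def
  by (intro separated_family separated_field_twist separated_field_twist_deriv separated_field_smooth
      continuous_on_const continuous_on_minus assms smooth_on_id)

lemma contact_forms_twisted:
  assumes "norm u = 1" shows "twisted_form u t \<in> contact_forms"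
proof -
  note d = form_derivative_pull[OF form_derivative_family[of e3 t], of e3]
  have "one_form (pull e3 (family_form e3 t))"
    by (rule one_formI[OF d]) (unfold pull_def,
      intro separated_family separated_field_twist separated_field_twist_deriv separated_field_smooth
        continuous_on_const smooth_on_const smooth_on_id)
  then have 1: "pull e3 (family_form e3 t) \<in> contact_forms"
    by (intro contact_forms_pull[OF form_derivative_family contact_forms_family]) simp_all
  have "one_form (twisted_form u t)"
    unfolding twisted_form_def
    by (rule one_formI[OF form_derivative_pull[OF d]])
      (fold twisted_form_def, intro separated_twisted continuous_on_const smooth_on_const)
  then show ?thesis
    unfolding twisted_form_def by (intro contact_forms_pull[OF d 1]) (simp_all add: assms)
qed

text \<open>Pulling back by a twist is pushing forward by its inverse, so each of the two pulls in
  \<open>twisted_form\<close> contributes a twist about the reversed axis.\<close>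

lemma pushes_twisted:
  assumes "norm u = 1"
  shows "pushes (\<lambda>m. twist u (twist (- e3) (shear (- t) m))) (\<lambda>m. shear t (twist e3 (twist (- u) m))) alpha0 (twisted_form u t)"
proof -
  have 1: "pushes (shear (- t)) (shear t) alpha0 (family_form e3 t)"
    by (rule pushes_sym[OF pushes_shear])
  have 2: "pushes (twist (- e3)) (twist e3) (family_form e3 t) (pull e3 (family_form e3 t))"
    using pushes_twist[of "- e3"] by simp
  have 3: "pushes (twist u) (twist (- u)) (pull e3 (family_form e3 t)) (twisted_form u t)"
    unfolding twisted_form_def by (rule pushes_twist[OF assms])
  show ?thesis using pushes_trans[OF pushes_trans[OF 1 2] 3] .
qed

text \<open>The axis is horizontal and orthogonal to \<open>u\<close>, and the angle is that between
  \<open>e3\<close> and \<open>u\<close>. For vertical \<open>u\<close> this axis is undetermined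
  and the first coordinate axis serves.\<close>

lemma rotate_e3:
  assumes "norm u = 1" obtains k \<sigma> where "norm k = 1" "rodrigues k (cos \<sigma>) (sin \<sigma>) e3 = u"
proof -
  have u: "(u $ 1)\<^sup>2 + (u $ 2)\<^sup>2 + (u $ 3)\<^sup>2 = 1"
    using assms by (simp add: norm_vec3)
  define r where "r = sqrt ((u $ 1)\<^sup>2 + (u $ 2)\<^sup>2)"
  have r2: "r\<^sup>2 = (u $ 1)\<^sup>2 + (u $ 2)\<^sup>2" by (simp add: r_def)
  then have "(u $ 3)\<^sup>2 + r\<^sup>2 = 1" using u by simp
  then obtain \<sigma> where \<sigma>: "u $ 3 = cos \<sigma>" "r = sin \<sigma>" by (rule sincos_total_2pi)
  show ?thesis
  proof (cases "r = 0")
    case True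
    then have "u $ 1 = 0" "u $ 2 = 0" using r2 by (simp_all add: sum_power2_eq_zero_iff)
    then have "rodrigues (vector [1, 0, 0]) (cos \<sigma>) (sin \<sigma>) e3 = u"
      using \<sigma> True by (simp add: rodrigues_def vec_eq_iff forall_3 cross3_nth inner_vec3 e3_def)
    moreover have "norm (vector [1, 0, 0] :: real^3) = 1" by (simp add: norm_vec3)
    ultimately show ?thesis using that by blast
  next
    case False
    define k :: "real^3" where "k = vector [- (u $ 2) / r, u $ 1 / r, 0]"
    have "(u $ 2 / r)\<^sup>2 + (u $ 1 / r)\<^sup>2 = ((u $ 1)\<^sup>2 + (u $ 2)\<^sup>2) / r\<^sup>2"
      by (simp add: power_divide add_divide_distrib)
    then have "(u $ 2 / r)\<^sup>2 + (u $ 1 / r)\<^sup>2 = 1"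
      unfolding r2[symmetric] using False by simp
    then have "norm k = 1" by (simp add: norm_vec3 k_def)
    moreover have "rodrigues k (cos \<sigma>) (sin \<sigma>) e3 = u"
      using \<sigma> False by (simp add: rodrigues_def vec_eq_iff forall_3 cross3_nth inner_vec3 e3_def k_def)
    ultimately show ?thesis using that by blast
  qed
qed

lemma isotopicI:
  fixes F :: "real \<times> ambient \<Rightarrow> ambient"
  assumes "smooth_on ({0..1} \<times> S1xS2) F"
    "\<And>s. s \<in> {0..1} \<Longrightarrow> \<exists>G. inverse_diffeos (\<lambda>m. F (s, m)) G"
    "\<And>m. m \<in> S1xS2 \<Longrightarrow> F (0, m) = m" "pushes (\<lambda>m. F (1, m)) G \<alpha> \<beta>"
  shows "isotopic (cooriented_kernel \<alpha>) (cooriented_kernel \<beta>)"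
  unfolding isotopic_def
  using assms(1,3) pushes_pushforward[OF assms(4)] assms(2) inverse_diffeos_diffeomorphism by blast

lemma cos_sin_1: "cos x * cos x + sin x * sin (x :: real) = 1"
  using sin_cos_squared_add[of x] by (simp add: power2_eq_square)

lemma shear_zero:
  assumes "m \<in> S1xS2" shows "shear 0 m = m"
proof -
  define p where "p = snd m"
  have g: "(p $ 1)\<^sup>2 + (p $ 2)\<^sup>2 = 1 - (p $ 3)\<^sup>2" using assms by (simp add: S1xS2_iff norm_vec3 p_def)
  have "(1 - (p $ 3)\<^sup>2)\<^sup>2 + 4 * (p $ 3)\<^sup>2 = (1 + (p $ 3)\<^sup>2)\<^sup>2"
    by (simp add: power2_eq_square algebra_simps)
  then have "shear_denom 0 p = 2"
    unfolding shear_denom_def g by simp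
  then show ?thesis
    by (simp add: shear_def Let_def p_def[symmetric]) (simp add: p_def prod_eq_iff vec_eq_iff forall_3)
qed

lemma isotopic_twisted:
  assumes "norm u = 1" shows "isotopic xi (cooriented_kernel (twisted_form u t))"
proof -
  obtain k \<sigma> where k: "norm k = 1" "rodrigues k (cos \<sigma>) (sin \<sigma>) e3 = u" by (rule rotate_e3[OF assms])
  define w where "w = (\<lambda>s. rodrigues k (cos (s * \<sigma>)) (sin (s * \<sigma>)) e3)"
  have nw: "norm (w s) = 1" for s
    unfolding w_def using norm_rodrigues[OF k(1) cos_sin_1] by simp
  have w: "w 0 = e3" "w 1 = u" using k(2) by (simp_all add: w_def rodrigues_def)
  \<comment> \<open>At time 0 the axis is \<open>e3\<close>, so the two twists cancel and the shear
    is the identity; at time 1 this is the map of \<open>pushes_twisted\<close>.\<close>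
  define F where "F = (\<lambda>x :: real \<times> ambient. twist (w (fst x)) (twist (- e3) (shear (- (fst x * t)) (snd x))))"
  note p = pushes_twisted[OF nw]
  show ?thesis
    unfolding xi_def
  proof (rule isotopicI)
    show "smooth_on ({0..1} \<times> S1xS2) F"
      unfolding F_def w_def
      by (intro smooth_on_twist smooth_on_rodrigues smooth_on_shear smooth_on_const smooth_on_cos smooth_on_sin
          smooth_on_mult smooth_on_minus smooth_on_fst smooth_on_snd smooth_on_id) (auto simp: S1xS2_iff)
    show "\<exists>G. inverse_diffeos (\<lambda>m. F (s, m)) G" for s
      using p[of s "s * t"] unfolding F_def pushes_def by auto
    show "F (0, m) = m" if "m \<in> S1xS2" for m
    proof -
      have "shear 0 m = m" by (rule shear_zero[OF that])
      then show ?thesis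
        using inverse_diffeosD(4)[OF inverse_diffeos_twist[of "- e3"] that] by (simp add: F_def w)
    qed
    show "pushes (\<lambda>m. F (1, m)) (\<lambda>m. shear t (twist e3 (twist (- u) m))) alpha0 (twisted_form u t)"
      using p[of 1 t] by (simp add: F_def w)
  qed
qed

section \<open>Rotations of the sphere and isotopies for the family \<open>S_sphere\<close>\<close>

definition spin :: "real^3 \<Rightarrow> real \<Rightarrow> ambient \<Rightarrow> ambient" where
  "spin k \<sigma> m = (fst m, rodrigues k (cos \<sigma>) (sin \<sigma>) (snd m))"

lemma inverse_diffeos_spin:
  assumes "norm k = 1" shows "inverse_diffeos (spin k \<sigma>) (spin (- k) \<sigma>)"
  unfolding inverse_diffeos_def
proof (intro conjI ballI)
  show "smooth_on S1xS2 (spin k \<sigma>)" "smooth_on S1xS2 (spin (- k) \<sigma>)"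
    unfolding spin_def[abs_def] by (intro smooth_on_intros smooth_on_rodrigues)+
  show "spin k \<sigma> ` S1xS2 \<subseteq> S1xS2" "spin (- k) \<sigma> ` S1xS2 \<subseteq> S1xS2"
    using assms norm_rodrigues[OF _ cos_sin_1] by (auto simp: S1xS2_iff spin_def image_subset_iff)
  show "spin (- k) \<sigma> (spin k \<sigma> m) = m" "spin k \<sigma> (spin (- k) \<sigma> m) = m" for m
    using rodrigues_inverse[OF assms cos_sin_1] rodrigues_inverse[of "- k", OF _ cos_sin_1] assms
    by (simp_all add: spin_def prod_eq_iff)
qed

text \<open>Rotations preserve inner and cross products, so rotating the sphere just rotates the
  axis of the form.\<close>

lemma pushes_spin:
  assumes "norm k = 1"
  shows "pushes (spin k \<sigma>) (spin (- k) \<sigma>) (family_form u 0) (family_form (rodrigues k (cos \<sigma>) (sin \<sigma>) u) 0)"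
  unfolding pushes_def
proof (intro conjI ballI exI[of _ 1] inverse_diffeos_spin assms)
  fix m v assume m: "m \<in> S1xS2" "v \<in> tangent_space m"
  have "(spin k \<sigma> has_derivative (\<lambda>v. (fst v, rodrigues k (cos \<sigma>) (sin \<sigma>) (snd v)))) (at m within S1xS2)"
    unfolding spin_def[abs_def] rodrigues_def
    by (rule has_derivative_eq_rhs, (rule derivative_intros)+) (simp add: fun_eq_iff)
  then have "tangent_map (spin k \<sigma>) m v = (fst v, rodrigues k (cos \<sigma>) (sin \<sigma>) (snd v))"
    by (rule tangent_map_eq[OF m])
  then show "family_form (rodrigues k (cos \<sigma>) (sin \<sigma>) u) 0 (spin k \<sigma> m) (tangent_map (spin k \<sigma>) m v) =
      1 * family_form u 0 m v"
    by (simp add: family_form_def spin_def d_theta_Re_Im rodrigues_inner[OF assms cos_sin_1]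
        rodrigues_cross[OF assms cos_sin_1])
qed simp

lemma isotopic_family:
  assumes "norm u = 1" shows "isotopic xi (cooriented_kernel (family_form u 0))"
proof -
  obtain k \<sigma> where k: "norm k = 1" "rodrigues k (cos \<sigma>) (sin \<sigma>) e3 = u" by (rule rotate_e3[OF assms])
  show ?thesis
    unfolding xi_def
  proof (rule isotopicI)
    show "smooth_on ({0..1} \<times> S1xS2) (\<lambda>x. spin k (fst x * \<sigma>) (snd x))"
      unfolding spin_def by (intro smooth_on_intros smooth_on_rodrigues)
    show "\<exists>G. inverse_diffeos (\<lambda>m. spin k (fst (s, m) * \<sigma>) (snd (s, m))) G" for s
      using inverse_diffeos_spin[OF k(1), of "s * \<sigma>"] by auto
    show "spin k (fst (0, m) * \<sigma>) (snd (0, m)) = m" for m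
      by (simp add: spin_def rodrigues_def)
    show "pushes (\<lambda>m. spin k (fst (1, m) * \<sigma>) (snd (1, m))) (spin (- k) \<sigma>) alpha0 (family_form u 0)"
      using pushes_spin[OF k(1), of \<sigma> e3] k(2) by (simp add: alpha0_family)
  qed
qed

section \<open>The two spheres as families of forms, and their evaluations\<close>

lemma cooriented_kernel_cong:
  assumes "\<And>m v. m \<in> S1xS2 \<Longrightarrow> v \<in> tangent_space m \<Longrightarrow> \<alpha> m v = \<beta> m v"
  shows "cooriented_kernel \<alpha> = cooriented_kernel \<beta>"
proof
  show "cooriented_kernel \<alpha> m = cooriented_kernel \<beta> m" for m
    using assms[of m] unfolding cooriented_kernel_def by (auto simp: restrict_def)
qed

lemma twist_tangent:
  assumes "norm u = 1" "m \<in> S1xS2" "v \<in> tangent_space m"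
  shows "twist u m \<in> S1xS2" "twist_deriv u m v \<in> tangent_space (twist u m)"
    "twist (- u) (twist u m) = m" "twist_deriv (- u) (twist u m) (twist_deriv u m v) = v"
proof -
  note I = inverse_diffeos_twist[OF assms(1)]
  note t = inverse_diffeos_tangent[OF I assms(2,3), unfolded tangent_map_twist[OF assms(2,3)]]
  show 1: "twist u m \<in> S1xS2" by (rule inverse_diffeosD(3)[OF I assms(2)])
  show 2: "twist_deriv u m v \<in> tangent_space (twist u m)" by (rule t(1))
  show "twist (- u) (twist u m) = m" by (rule inverse_diffeosD(4)[OF I assms(2)])
  show "twist_deriv (- u) (twist u m) (twist_deriv u m v) = v"
    using t(2) unfolding tangent_map_twist[OF 1 2] .
qed

lemma twisted_form_e3: "cooriented_kernel (twisted_form e3 0) = xi"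
  unfolding xi_def
proof (rule cooriented_kernel_cong)
  fix m v assume "m \<in> S1xS2" "v \<in> tangent_space m"
  then show "twisted_form e3 0 m v = alpha0 m v"
    using twist_tangent(3,4)[of "- e3" m v] by (simp add: twisted_form_def pull_def alpha0_family)
qed

text \<open>The twist about \<open>e3\<close> adds \<theta> to the polar angle \<phi>, so r^2
  d\<phi> gains r^2 d\<theta>, which cancels the term - r^2 d\<theta> of the form at
  \<open>t = 1\<close>.\<close>

lemma pull_e3_family:
  assumes "m \<in> S1xS2" "v \<in> tangent_space m"
  shows "pull e3 (family_form e3 1) m v = alpha0 m v"
proof -
  define c s a b x y z v1 v2 v3 where d: "c = Re (fst m)" "s = Im (fst m)" "a = Re (fst v)" "b = Im (fst v)"
    "x = snd m $ 1" "y = snd m $ 2" "z = snd m $ 3" "v1 = snd v $ 1" "v2 = snd v $ 2" "v3 = snd v $ 3"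
  have "c * c + s * s = 1" "x * x + y * y + z * z = 1" "a * c + b * s = 0"
    using assms by (auto simp: d S1xS2_iff norm_complex_eq_1 norm_vec3_eq_1 tangent_space_def inner_complex_def split_def)
  then show ?thesis
    unfolding pull_def family_form_def alpha0_def twist_def twist_deriv_def rodrigues_def d_theta_Re_Im
    by (simp add: inner_vec3 cross3_nth e3_def d[symmetric]) algebra
qed

lemma twisted_form_1:
  assumes "norm u = 1" "m \<in> S1xS2" "v \<in> tangent_space m"
  shows "twisted_form u 1 m v = alpha0 (twist (- u) m) (twist_deriv (- u) m v)"
  using pull_e3_family twist_tangent(1,2)[of "- u" m v] assms
  by (simp add: twisted_form_def pull_def[of "- u"])

lemma delta_diffeo_twist:
  assumes "m \<in> S1xS2" shows "delta_diffeo u m = twist u m"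
proof -
  have n: "norm (fst m) = 1" using assms by (simp add: S1xS2_iff)
  have "fst m = of_real (cmod (fst m)) * exp (\<i> * of_real (Arg2pi (fst m)))"
    by (rule Arg2pi_eq)
  then have "fst m = cis (Arg2pi (fst m))" using n by (simp add: cis_conv_exp)
  then have "Re (fst m) = cos (Arg2pi (fst m))" "Im (fst m) = sin (Arg2pi (fst m))"
    by (metis cis.simps(1), metis cis.simps(2))
  then show ?thesis by (simp add: delta_diffeo_def twist_def rodrigues_def rotation_def)
qed

lemma delta_sphere_twisted:
  assumes "norm u = 1" shows "delta_sphere u = cooriented_kernel (twisted_form u 1)"
proof -
  note I = inverse_diffeos_twist[OF assms]
  have eq: "twist u m = delta_diffeo u m" if "m \<in> S1xS2" for m using delta_diffeo_twist that by simp
  \<comment> \<open>\<open>Arg2pi\<close> jumps, so the smoothness of \<open>delta_diffeo u\<close>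
    is taken over from the polynomial map with which it agrees on \<open>S1xS2\<close>.\<close>
  have I': "inverse_diffeos (delta_diffeo u) (twist (- u))"
    using I smooth_on_cong[OF inverse_diffeosD(1)[OF I] eq]
    unfolding inverse_diffeos_def by (simp add: eq[symmetric] image_subset_iff)
  have "pushes (delta_diffeo u) (twist (- u)) alpha0 (twisted_form u 1)"
    by (rule pushes_pullback[OF I']) (simp add: twisted_form_1[OF assms] tangent_map_twist)
  then show ?thesis unfolding delta_sphere_def xi_def by (rule pushes_pushforward)
qed

text \<open>The axes of \<open>alpha0\<close>, \<open>alpha1\<close>, \<open>alpha2\<close> are the third, first and second coordinate axis.\<close>

definition cycle3 :: "real^3 \<Rightarrow> real^3" where
  "cycle3 q = vector [q $ 2, q $ 3, q $ 1]"

lemma norm_cycle3: "norm (cycle3 q) = norm q"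
  by (simp add: norm_vec3 cycle3_def algebra_simps)

lemma S_sphere_family: "S_sphere q = cooriented_kernel (family_form (cycle3 q) 0)"
proof -
  have "(\<lambda>m v. q $ 1 * alpha0 m v + q $ 2 * alpha1 m v + q $ 3 * alpha2 m v) = family_form (cycle3 q) 0"
    by (simp add: fun_eq_iff alpha0_def alpha1_def alpha2_def family_form_def cycle3_def inner_vec3 cross3_nth algebra_simps
        del: split_paired_All)
  then show ?thesis by (simp add: S_sphere_def)
qed

lemma S_sphere_base: "S_sphere base_point = xi"
proof -
  have "cycle3 base_point = e3" by (simp add: cycle3_def base_point_def e3_def)
  then show ?thesis by (simp add: S_sphere_family xi_def alpha0_family)
qed

lemma ev_S_sphere:
  assumes "norm q = 1" shows "ev_plane (S_sphere q) = q"
proof -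
  have "ev_vec (family_form (cycle3 q) 0) = q"
    by (simp add: ev_vec_def ev_point_def family_form_def cycle3_def d_theta_Re_Im inner_vec3 cross3_nth vec_eq_iff forall_3)
  then show ?thesis
    unfolding S_sphere_family using assms contact_forms_family[of "cycle3 q" 0]
    by (simp add: ev_plane_kernel norm_cycle3 ev_form_def)
qed

lemma ev_xi: "ev_plane xi = base_point"
  using ev_S_sphere[of base_point] unfolding S_sphere_base by (simp add: base_point_def norm_vec3)

lemma ev_delta_sphere:
  assumes "norm u = 1" shows "ev_plane (delta_sphere u) = base_point"
proof -
  \<comment> \<open>The circle coordinate of \<open>ev_point\<close> is 1, so the twist rotates by
    the angle 0 there.\<close>
  have t: "twist (- u) ev_point = ev_point"
    by (simp add: twist_def ev_point_def rodrigues_def)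
  have T: "(\<i>, 0) \<in> tangent_space ev_point" "(0, vector [0, - 1, 0]) \<in> tangent_space ev_point"
    "(0, vector [1, 0, 0]) \<in> tangent_space ev_point"
    by (simp_all add: tangent_space_def ev_point_def inner_vec3)
  have a: "alpha0 ev_point v = Im (fst v)" for v
    by (simp add: alpha0_def ev_point_def d_theta_Re_Im)
  have "ev_vec (twisted_form u 1) = base_point"
    unfolding ev_vec_def by (simp add: twisted_form_1[OF assms ev_point] T t a twist_deriv_def base_point_def)
  then show ?thesis
    by (simp add: delta_sphere_twisted[OF assms] ev_plane_kernel[OF contact_forms_twisted[OF assms]] ev_form_def
        base_point_def norm_vec3)
qed

section \<open>The two classes\<close>

lemma S_sphere_continuous: "continuous_map (top_of_set (sphere 0 1)) (contact_space xi) S_sphere"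
proof -
  have c: "continuous_on (sphere 0 1) cycle3"
    unfolding cycle3_def[abs_def]
    by (rule continuous_on_eq[OF smooth_on_imp_continuous_on[OF smooth_on_vector3]])
      (auto intro!: smooth_on_vec_nth smooth_on_id)
  show ?thesis
    unfolding S_sphere_family[abs_def]
    by (rule continuous_map_contact_space)
      (auto simp: norm_cycle3 vector_field_def
        intro!: contact_forms_family isotopic_family separated_family c continuous_on_const separated_field_smooth smooth_on_id)
qed

lemma twisted_continuous:
  "continuous_map (top_of_set (sphere 0 1 \<times> {0..1})) (contact_space xi)
     (\<lambda>x. cooriented_kernel (twisted_form (fst x) (snd x)))"
  by (rule continuous_map_contact_space)
    (auto simp: vector_field_def
      intro!: contact_forms_twisted isotopic_twisted separated_twisted continuous_on_fst continuous_on_snd continuous_on_id)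

lemma sphere_collapse_sq_maps:
  assumes "continuous_map (top_of_set (sphere 0 1)) X f" "f base_point = x"
  shows "f \<circ> collapse \<in> sq_maps X x"
proof -
  have "continuous_map (top_of_set square) (top_of_set (sphere 0 1)) collapse"
    using continuous_collapse collapse_norm by (auto simp: continuous_map_in_subtopology)
  from continuous_map_compose[OF this assms(1)] show ?thesis
    using assms(2) collapse_frontier by (simp add: sq_maps_def)
qed

lemma continuous_map_ev_contact_space:
  "continuous_map (contact_space xi) (top_of_set (sphere 0 1)) ev_plane"
  unfolding contact_space_def by (rule continuous_map_from_subtopology[OF continuous_map_ev_plane])

lemma hopf_degree_sq_class:
  assumes "g \<in> sq_class (contact_space xi) xi f" "hopf_degree (ev_plane \<circ> f) d"
  shows "hopf_degree (ev_plane \<circ> g) d"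
proof (rule hopf_degree_homotopic[OF assms(2)])
  show "homotopic_with (\<lambda>h. \<forall>b\<in>frontier square. h b = base_point) (top_of_set square) (top_of_set (sphere 0 1))
      (ev_plane \<circ> f) (ev_plane \<circ> g)"
    using assms(1) unfolding sq_class_def
    by (auto intro!: homotopic_with_compose_continuous_map_left[OF _ continuous_map_ev_contact_space] simp: ev_xi)
qed

lemma in_sq_class_self: "f \<in> sq_maps X x \<Longrightarrow> f \<in> sq_class X x f"
  by (simp add: sq_class_def sq_maps_def)

lemma hopf_degree_S_sphere: "hopf_degree (ev_plane \<circ> (S_sphere \<circ> collapse)) 1"
  by (rule hopf_degree_cong[OF hopf_degree_collapse]) (simp add: ev_S_sphere collapse_norm)

text \<open>By the definition of \<open>mult\<close> in \<open>pi2\<close>, every member of a power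
  is homotopic to a join of a member of the preceding power with a member of the class of
  \<open>S_sphere\<close>. Hence the claim is about all members \<open>h\<close>.\<close>

lemma hopf_degree_power:
  fixes n :: nat
  assumes "h \<in> sphere_class (contact_space xi) xi S_sphere [^]\<^bsub>pi2 (contact_space xi) xi\<^esub> n"
  shows "hopf_degree (ev_plane \<circ> h) (int n)"
  using assms
proof (induction n arbitrary: h)
  case 0
  then have "h \<in> sq_class (contact_space xi) xi (\<lambda>_. xi)" by (simp add: nat_pow_def pi2_def)
  moreover have "hopf_degree (ev_plane \<circ> (\<lambda>_. xi)) 0"
    using hopf_degree_const by (simp add: o_def ev_xi)
  ultimately have "hopf_degree (ev_plane \<circ> h) 0" by (rule hopf_degree_sq_class)
  then show ?case by (simp add: o_def)
next
  case (Suc n)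
  then obtain f g where fg: "f \<in> sphere_class (contact_space xi) xi S_sphere [^]\<^bsub>pi2 (contact_space xi) xi\<^esub> n"
    "g \<in> sphere_class (contact_space xi) xi S_sphere" "h \<in> sq_class (contact_space xi) xi (sq_join f g)"
    by (auto simp: nat_pow_def pi2_def)
  have "hopf_degree (ev_plane \<circ> g) 1"
    using fg(2) unfolding sphere_class_def by (rule hopf_degree_sq_class[OF _ hopf_degree_S_sphere])
  from hopf_degree_join[OF Suc.IH[OF fg(1)] this]
  have "hopf_degree (sq_join (ev_plane \<circ> f) (ev_plane \<circ> g)) (int (Suc n))"
    by (simp only: of_nat_Suc add.commute)
  moreover have "sq_join (ev_plane \<circ> f) (ev_plane \<circ> g) = ev_plane \<circ> sq_join f g"
    by (auto simp: sq_join_def fun_eq_iff)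
  ultimately have "hopf_degree (ev_plane \<circ> sq_join f g) (int (Suc n))" by simp
  then show ?case by (rule hopf_degree_sq_class[OF fg(3)])
qed

text \<open>While \<open>t\<close> decreases from 1 to 0, all axes make a quarter turn that takes
  \<open>base_point\<close> to \<open>e3\<close>. The final sphere has the value \<open>xi\<close>
  at \<open>base_point\<close>, where the two twists cancel.\<close>

lemma free_sphere_classes_nonempty: "free_sphere_classes (contact_space xi) xi delta_sphere \<noteq> {}"
proof -
  \<comment> \<open>Chosen such that \<open>cross3 k base_point = e3\<close>.\<close>
  define k :: "real^3" where "k = vector [0, -1, 0]"
  have k: "norm k = 1" by (simp add: k_def norm_vec3)
  define \<rho> where "\<rho> = (\<lambda>x :: real \<times> (real^3). rodrigues k (cos (fst x * (pi / 2))) (sin (fst x * (pi / 2))) (snd x))"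
  have \<rho>n: "norm (\<rho> x) = norm (snd x)" for x
    unfolding \<rho>_def by (rule norm_rodrigues[OF k cos_sin_1])
  define H where "H = (\<lambda>x. cooriented_kernel (twisted_form (\<rho> x) (1 - fst x)))"
  have "continuous_on ({0..1} \<times> sphere 0 1) (\<lambda>x. (\<rho> x, 1 - fst x))"
    unfolding \<rho>_def
    by (intro smooth_on_imp_continuous_on smooth_on_Pair smooth_on_rodrigues smooth_on_diff smooth_on_cos smooth_on_sin
        smooth_on_mult smooth_on_fst smooth_on_snd smooth_on_const smooth_on_id)
  then have "continuous_map (top_of_set ({0..1} \<times> sphere 0 1)) (top_of_set (sphere 0 1 \<times> {0..1})) (\<lambda>x. (\<rho> x, 1 - fst x))"
    using \<rho>n by (auto simp: continuous_map_in_subtopology)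
  from continuous_map_compose[OF this twisted_continuous]
  have "continuous_map (prod_topology (top_of_set {0..1}) (top_of_set (sphere 0 1))) (contact_space xi) H"
    by (simp add: H_def o_def subtopology_Times)
  then have "homotopic_with (\<lambda>_. True) (top_of_set (sphere 0 1)) (contact_space xi) (\<lambda>q. H (0, q)) (\<lambda>q. H (1, q))"
    unfolding homotopic_with_def by (intro exI[of _ H]) simp
  moreover have "delta_sphere q = H (0, q)" if "q \<in> topspace (top_of_set (sphere 0 1))" for q
    using that by (simp add: H_def \<rho>_def rodrigues_def delta_sphere_twisted)
  ultimately have "homotopic_with (\<lambda>_. True) (top_of_set (sphere 0 1)) (contact_space xi) delta_sphere (\<lambda>q. H (1, q))"
    by (rule homotopic_with_eq) auto
  then have "homotopic_with (\<lambda>_. True) (top_of_set (sphere 0 1)) (contact_space xi) (\<lambda>q. H (1, q)) delta_sphere"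
    by (simp add: homotopic_with_sym)
  moreover have "\<rho> (1, base_point) = e3"
    by (simp add: \<rho>_def rodrigues_def k_def e3_def base_point_def vec_eq_iff forall_3 cross3_nth inner_vec3)
  then have "H (1, base_point) = xi"
    by (simp add: H_def twisted_form_e3)
  ultimately have "sphere_class (contact_space xi) xi (\<lambda>q. H (1, q)) \<in> free_sphere_classes (contact_space xi) xi delta_sphere"
    unfolding free_sphere_classes_def by (intro CollectI exI[of _ "\<lambda>q. H (1, q)"] conjI refl)
  then show ?thesis by (metis empty_iff)
qed

lemma hopf_degree_free_sphere:
  assumes "f base_point = xi"
    "homotopic_with (\<lambda>_. True) (top_of_set (sphere 0 1)) (contact_space xi) f delta_sphere"
  shows "hopf_degree (ev_plane \<circ> (f \<circ> collapse)) 0"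
proof -
  have "homotopic_with (\<lambda>_. True) (top_of_set (sphere 0 1)) (top_of_set (sphere 0 1)) (ev_plane \<circ> f) (ev_plane \<circ> delta_sphere)"
    by (rule homotopic_with_compose_continuous_map_left[OF assms(2) continuous_map_ev_contact_space]) simp
  then have "homotopic_with (\<lambda>_. True) (top_of_set (sphere 0 1)) (top_of_set (sphere 0 1)) (ev_plane \<circ> f) (\<lambda>_. base_point)"
    by (rule homotopic_with_eq) (auto simp: ev_delta_sphere)
  from hopf_degree_nullhomotopic[OF _ this continuous_collapse] show ?thesis
    using assms(1) collapse_norm collapse_frontier by (simp add: ev_xi o_assoc image_subset_iff)
qed

theorem proposition22:
  defines "C \<equiv> contact_space xi"
  defines "G \<equiv> pi2 C xi"
  defines "S_cl \<equiv> sphere_class C xi S_sphere"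
  defines "delta_cls \<equiv> free_sphere_classes C xi delta_sphere"
  shows "S_cl \<in> carrier G \<and> delta_cls \<noteq> {} \<and> delta_cls \<subseteq> carrier G
    \<and> (\<forall>delta_cl \<in> delta_cls. S_cl \<noteq> delta_cl)
    \<and> (\<forall>n::nat. n > 0 \<longrightarrow> S_cl [^]\<^bsub>G\<^esub> n \<noteq> \<one>\<^bsub>G\<^esub>)"
proof (intro conjI ballI allI impI)
  have S: "S_sphere \<circ> collapse \<in> sq_maps C xi"
    unfolding C_def by (rule sphere_collapse_sq_maps[OF S_sphere_continuous S_sphere_base])
  then show "S_cl \<in> carrier G"
    by (simp add: G_def S_cl_def pi2_def sphere_class_def)
  show "delta_cls \<noteq> {}"
    unfolding delta_cls_def C_def by (rule free_sphere_classes_nonempty)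
  have free: "f \<circ> collapse \<in> sq_maps C xi" if "f base_point = xi"
    "homotopic_with (\<lambda>_. True) (top_of_set (sphere 0 1)) C f delta_sphere" for f
    using sphere_collapse_sq_maps[of C f, OF _ that(1)] homotopic_with_imp_continuous_maps[OF that(2)] by blast
  then show "delta_cls \<subseteq> carrier G"
    by (auto simp: delta_cls_def free_sphere_classes_def G_def pi2_def sphere_class_def)
  show "S_cl \<noteq> delta_cl" if delta: "delta_cl \<in> delta_cls" for delta_cl
  proof
    assume eq: "S_cl = delta_cl"
    obtain f where f: "delta_cl = sphere_class C xi f" "f base_point = xi"
      "homotopic_with (\<lambda>_. True) (top_of_set (sphere 0 1)) C f delta_sphere"
      using delta unfolding delta_cls_def free_sphere_classes_def by blast
    have "f \<circ> collapse \<in> sq_class C xi (S_sphere \<circ> collapse)"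
      using in_sq_class_self[OF free[OF f(2,3)]] eq f(1) by (simp add: S_cl_def sphere_class_def)
    then have "hopf_degree (ev_plane \<circ> (f \<circ> collapse)) 1"
      unfolding C_def by (rule hopf_degree_sq_class[OF _ hopf_degree_S_sphere])
    with hopf_degree_free_sphere[OF f(2) f(3)[unfolded C_def]] show False
      using hopf_degree_unique by force
  qed
  show "S_cl [^]\<^bsub>G\<^esub> n \<noteq> \<one>\<^bsub>G\<^esub>" if "n > 0" for n :: nat
  proof
    assume eq: "S_cl [^]\<^bsub>G\<^esub> n = \<one>\<^bsub>G\<^esub>"
    \<comment> \<open>This makes the constant square a member of the unit class, hence of the power;
      its degree would then be both n and 0.\<close>
    have "xi \<in> topspace C"
    proof -
      have "S_sphere base_point \<in> topspace C"
        using continuous_map_image_subset_topspace[OF S_sphere_continuous] unfolding C_def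
        by (auto simp: base_point_def norm_vec3)
      then show ?thesis by (simp add: S_sphere_base)
    qed
    then have "(\<lambda>_. xi) \<in> sq_maps C xi" by (simp add: sq_maps_def)
    then have "(\<lambda>_. xi) \<in> \<one>\<^bsub>G\<^esub>"
      using in_sq_class_self by (simp add: G_def pi2_def)
    then have "(\<lambda>_. xi) \<in> S_cl [^]\<^bsub>G\<^esub> n" using eq by simp
    then have "hopf_degree (ev_plane \<circ> (\<lambda>_. xi)) (int n)"
      unfolding S_cl_def G_def C_def by (rule hopf_degree_power)
    moreover have "hopf_degree (ev_plane \<circ> (\<lambda>_. xi)) 0"
      using hopf_degree_const by (simp add: o_def ev_xi)
    ultimately show False using hopf_degree_unique that by force
  qed
qed

end
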